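(* Let $\kappa$ be a singular cardinal with $\operatorname{cf}(\kappa)=\omega$ such that $\nu^\omega<\kappa$ for every cardinal $\nu<\kappa$, and let $\mathbb{P}=\mathbb{M}_\kappa$. Suppose $p\in\mathbb{P}$ and $\dot A$ is a $\mathbb{P}$-name such that $p\Vdash$ "$\dot A$ is a function from $\omega$ to $\check V$ and $\dot A\notin\check V$". Then $p\Vdash \Gamma(\mathbb{P})\in \check V[\dot A]$, where $\Gamma(\mathbb{P})$ is the canonical name for the generic filter. That is, for every $V$-generic filter $G$ with $p\in G$, we have $G\in V[\dot A^G]$; in particular $\mathbb{M}_\kappa$ is minimal for $\omega$-sequences.
   Context: Fix a strictly increasing sequence $\langle\kappa_n: n<\omega\rangle$ of regular infinite cardinals with supremum $\kappa$. Let $N=\bigcup_{n<\omega}\prod_{m<n}\kappa_m$ (finite sequences $t$ with $t(m)<\kappa_m$), ordered by end-extension $\sqsubseteq$. A tree is a nonempty $T\subseteq N$ closed under initial segments; $\mathrm{Succ}_T(t)$ is the set of immediate successors of $t$ in $T$. A tree $T$ is perfect if every node has a proper extension in $T$ and for every $s\in T$ and every $n<\omega$ there is $t\in T$ with $s\sqsubseteq t$ and $|\mathrm{Succ}_T(t)|\ge\kappa_n$. $\mathbb{M}_\kappa$ is the set of perfect trees ordered by inclusion ($q\le p$ iff $q\subseteq p$). A forcing $\mathbb{P}$ is minimal for $\omega$-sequences if for every transitive model $M$ with $V\subseteq M\subseteq V[G]$, if $M$ contains a function $A:\omega\to\mathrm{On}$ with $A\notin V$, then $M=V[G]$. *)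

theory Defs
  imports "HOL-Library.Sublist"
begin

section \<open>The background universe of sets\<close>

text \<open>
  Forcing is read in the usual way over transitive models: the ground model "V" is a transitive
  class model M of first-order ZFC inside a background universe of sets, in which filters
  generic over M and the extensions M[G] are formed.  The background is a well-founded
  extensional structure closed under pairing, union and replacement for arbitrary HOL
  functions and predicates.  Neither power set nor infinity is required of it, so that for instance
  the hereditarily countable sets, which contain all countable transitive models together with all
  their generic extensions, qualify.
\<close>

class set_universe =
  fixes vmem :: "'a \<Rightarrow> 'a \<Rightarrow> bool"  (infix "\<in>\<^sub>V" 50)
  assumes vmem_extensional: "(\<And>z. z \<in>\<^sub>V x \<longleftrightarrow> z \<in>\<^sub>V y) \<Longrightarrow> x = y"
    and vmem_wf: "wfp (\<in>\<^sub>V)"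
    and vmem_pairing: "\<exists>z. \<forall>w. w \<in>\<^sub>V z \<longleftrightarrow> w = x \<or> w = y"
    and vmem_union: "\<exists>u. \<forall>w. w \<in>\<^sub>V u \<longleftrightarrow> (\<exists>y. y \<in>\<^sub>V x \<and> w \<in>\<^sub>V y)"
    and vmem_replacement: "\<exists>b. \<forall>w. w \<in>\<^sub>V b \<longleftrightarrow> (\<exists>y. y \<in>\<^sub>V x \<and> Q y \<and> w = F y)"

definition ext :: "'a::set_universe \<Rightarrow> 'a set" where
  "ext a = {x. x \<in>\<^sub>V a}"

text \<open>Meaningful only if \<open>A\<close> is the extension of some set of the universe.\<close>
definition vset :: "'a::set_universe set \<Rightarrow> 'a" where
  "vset A = (THE a. ext a = A)"

text \<open>The collection \<open>A\<close> is (the extension of) an element of the class \<open>M\<close>.\<close>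
definition coded_in :: "'a::set_universe set \<Rightarrow> 'a set \<Rightarrow> bool" where
  "coded_in M A \<longleftrightarrow> (\<exists>a\<in>M. ext a = A)"

definition vpair :: "'a::set_universe \<Rightarrow> 'a \<Rightarrow> 'a" where
  "vpair x y = vset {vset {x}, vset {x, y}}"

primrec vnat :: "nat \<Rightarrow> 'a::set_universe" where
  "vnat 0 = vset {}"
| "vnat (Suc n) = vset (insert (vnat n) (ext (vnat n)))"

definition graph_on :: "'a::set_universe set \<Rightarrow> ('a \<Rightarrow> 'a) \<Rightarrow> 'a set" where
  "graph_on A f = (\<lambda>x. vpair x (f x)) ` A"

definition seq_graph :: "(nat \<Rightarrow> 'a::set_universe) \<Rightarrow> 'a set" where
  "seq_graph f = range (\<lambda>n. vpair (vnat n) (f n))"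

definition vlist :: "'a::set_universe list \<Rightarrow> 'a" where
  "vlist xs = vset ((\<lambda>i. vpair (vnat i) (xs ! i)) ` {..<length xs})"

lemma ext_inject: "ext a = ext b \<Longrightarrow> a = b"
  unfolding ext_def by (rule vmem_extensional) blast

lemma vset_ext [simp]: "vset (ext a) = a"
  unfolding vset_def by (rule the_equality) (auto intro: ext_inject)

lemma ext_vset: "\<exists>a. ext a = A \<Longrightarrow> ext (vset A) = A"
  using vset_ext by metis

lemma ext_vset_pair [simp]: "ext (vset {x, y}) = {x, y}"
proof (rule ext_vset)
  obtain z where "\<forall>w. w \<in>\<^sub>V z \<longleftrightarrow> w = x \<or> w = y"
    using vmem_pairing by blast
  then show "\<exists>a. ext a = {x, y}"
    by (auto simp: ext_def)
qed

lemma ext_vset_singleton [simp]: "ext (vset {x}) = {x}"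
  using ext_vset_pair[of x x] by simp

lemma vpair_component_below:
  fixes s r t :: "'a::set_universe"
  assumes "vpair s r \<in>\<^sub>V t"
  shows "(s, t) \<in> {(x, y). x \<in>\<^sub>V y}\<^sup>+"
proof -
  have "s \<in> ext (vset {s})" "vset {s} \<in> ext (vpair s r)"
    by (simp_all add: vpair_def)
  then have "s \<in>\<^sub>V vset {s}" "vset {s} \<in>\<^sub>V vpair s r"
    by (simp_all add: ext_def)
  then have "(s, vset {s}) \<in> {(x, y). x \<in>\<^sub>V y}\<^sup>+"
    "(vset {s}, vpair s r) \<in> {(x, y). x \<in>\<^sub>V y}\<^sup>+"
    by (auto intro: r_into_trancl)
  moreover have "(vpair s r, t) \<in> {(x, y). x \<in>\<^sub>V y}\<^sup>+"
    using assms by (auto intro: r_into_trancl)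
  ultimately show ?thesis
    by (blast intro: trancl_trans)
qed

lemma wf_vmem: "wf {(x, y :: 'a::set_universe). x \<in>\<^sub>V y}"
  using vmem_wf by (simp add: wfp_def)


section \<open>Transitive models of ZFC\<close>

text \<open>Formulas of the language of set theory, with de Bruijn indices.\<close>

datatype fm = Mem nat nat | Equal nat nat | Neg fm | Conj fm fm | Exists fm

primrec sat :: "'a::set_universe set \<Rightarrow> (nat \<Rightarrow> 'a) \<Rightarrow> fm \<Rightarrow> bool" where
  "sat M e (Mem i j) \<longleftrightarrow> e i \<in>\<^sub>V e j"
| "sat M e (Equal i j) \<longleftrightarrow> e i = e j"
| "sat M e (Neg \<phi>) \<longleftrightarrow> \<not> sat M e \<phi>"
| "sat M e (Conj \<phi> \<psi>) \<longleftrightarrow> sat M e \<phi> \<and> sat M e \<psi>"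
| "sat M e (Exists \<phi>) \<longleftrightarrow> (\<exists>x\<in>M. sat M (case_nat x e) \<phi>)"

definition ax_extensionality :: "'a::set_universe set \<Rightarrow> bool" where
  "ax_extensionality M \<longleftrightarrow>
     (\<forall>x\<in>M. \<forall>y\<in>M. (\<forall>z\<in>M. z \<in>\<^sub>V x \<longleftrightarrow> z \<in>\<^sub>V y) \<longrightarrow> x = y)"

definition ax_foundation :: "'a::set_universe set \<Rightarrow> bool" where
  "ax_foundation M \<longleftrightarrow>
     (\<forall>x\<in>M. (\<exists>y\<in>M. y \<in>\<^sub>V x) \<longrightarrow> (\<exists>y\<in>M. y \<in>\<^sub>V x \<and> \<not> (\<exists>z\<in>M. z \<in>\<^sub>V x \<and> z \<in>\<^sub>V y)))"

definition ax_pairing :: "'a::set_universe set \<Rightarrow> bool" where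
  "ax_pairing M \<longleftrightarrow>
     (\<forall>x\<in>M. \<forall>y\<in>M. \<exists>z\<in>M. \<forall>w\<in>M. w \<in>\<^sub>V z \<longleftrightarrow> w = x \<or> w = y)"

definition ax_union :: "'a::set_universe set \<Rightarrow> bool" where
  "ax_union M \<longleftrightarrow>
     (\<forall>x\<in>M. \<exists>u\<in>M. \<forall>w\<in>M. w \<in>\<^sub>V u \<longleftrightarrow> (\<exists>y\<in>M. y \<in>\<^sub>V x \<and> w \<in>\<^sub>V y))"

definition ax_power :: "'a::set_universe set \<Rightarrow> bool" where
  "ax_power M \<longleftrightarrow>
     (\<forall>x\<in>M. \<exists>y\<in>M. \<forall>z\<in>M. z \<in>\<^sub>V y \<longleftrightarrow> (\<forall>w\<in>M. w \<in>\<^sub>V z \<longrightarrow> w \<in>\<^sub>V x))"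

definition ax_infinity :: "'a::set_universe set \<Rightarrow> bool" where
  "ax_infinity M \<longleftrightarrow>
     (\<exists>x\<in>M. (\<exists>e\<in>M. e \<in>\<^sub>V x \<and> (\<forall>w\<in>M. \<not> w \<in>\<^sub>V e)) \<and>
        (\<forall>y\<in>M. y \<in>\<^sub>V x \<longrightarrow>
           (\<exists>s\<in>M. s \<in>\<^sub>V x \<and> (\<forall>w\<in>M. w \<in>\<^sub>V s \<longleftrightarrow> w \<in>\<^sub>V y \<or> w = y))))"

text \<open>Parameters of the two schemes are supplied by the environment \<open>e\<close>.\<close>
definition ax_separation :: "'a::set_universe set \<Rightarrow> bool" where
  "ax_separation M \<longleftrightarrow>
     (\<forall>\<phi> e. range e \<subseteq> M \<longrightarrow>
        (\<forall>x\<in>M. \<exists>y\<in>M. \<forall>z\<in>M. z \<in>\<^sub>V y \<longleftrightarrow> z \<in>\<^sub>V x \<and> sat M (case_nat z e) \<phi>))"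

definition ax_replacement :: "'a::set_universe set \<Rightarrow> bool" where
  "ax_replacement M \<longleftrightarrow>
     (\<forall>\<phi> e. range e \<subseteq> M \<longrightarrow>
        (\<forall>x\<in>M. (\<forall>u\<in>M. u \<in>\<^sub>V x \<longrightarrow> (\<exists>!v. v \<in> M \<and> sat M (case_nat u (case_nat v e)) \<phi>)) \<longrightarrow>
           (\<exists>y\<in>M. \<forall>v\<in>M. v \<in>\<^sub>V y \<longleftrightarrow>
              (\<exists>u\<in>M. u \<in>\<^sub>V x \<and> sat M (case_nat u (case_nat v e)) \<phi>))))"

definition ax_choice :: "'a::set_universe set \<Rightarrow> bool" where
  "ax_choice M \<longleftrightarrow>
     (\<forall>x\<in>M.
        (\<forall>y\<in>M. y \<in>\<^sub>V x \<longrightarrow> (\<exists>w\<in>M. w \<in>\<^sub>V y)) \<and>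
        (\<forall>y\<in>M. \<forall>z\<in>M. y \<in>\<^sub>V x \<and> z \<in>\<^sub>V x \<and> y \<noteq> z \<longrightarrow> \<not> (\<exists>w\<in>M. w \<in>\<^sub>V y \<and> w \<in>\<^sub>V z)) \<longrightarrow>
        (\<exists>c\<in>M. \<forall>y\<in>M. y \<in>\<^sub>V x \<longrightarrow> (\<exists>!w. w \<in> M \<and> w \<in>\<^sub>V y \<and> w \<in>\<^sub>V c)))"

definition models_ZFC :: "'a::set_universe set \<Rightarrow> bool" where
  "models_ZFC M \<longleftrightarrow>
     ax_extensionality M \<and> ax_foundation M \<and> ax_pairing M \<and> ax_union M \<and> ax_power M \<and>
     ax_infinity M \<and> ax_separation M \<and> ax_replacement M \<and> ax_choice M"

definition transitive_model :: "'a::set_universe set \<Rightarrow> bool" where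
  "transitive_model M \<longleftrightarrow> (\<forall>x\<in>M. ext x \<subseteq> M) \<and> models_ZFC M"

text \<open>\<open>M[a]\<close>, the least transitive model of ZFC that includes \<open>M\<close> and has \<open>a\<close> as an element.\<close>
definition model_adjoin :: "'a::set_universe set \<Rightarrow> 'a \<Rightarrow> 'a set" where
  "model_adjoin M a = \<Inter>{N. transitive_model N \<and> M \<subseteq> N \<and> a \<in> N}"


section \<open>Ordinals and cardinals of a transitive model\<close>

definition ordinal :: "'a::set_universe \<Rightarrow> bool" where
  "ordinal a \<longleftrightarrow> (\<forall>x\<in>ext a. ext x \<subseteq> ext a) \<and> (\<forall>x\<in>ext a. \<forall>y\<in>ext x. ext y \<subseteq> ext x)"

definition card_le_in :: "'a::set_universe set \<Rightarrow> 'a set \<Rightarrow> 'a set \<Rightarrow> bool" where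
  "card_le_in M A B \<longleftrightarrow> (\<exists>f. inj_on f A \<and> f ` A \<subseteq> B \<and> coded_in M (graph_on A f))"

definition equipollent_in :: "'a::set_universe set \<Rightarrow> 'a set \<Rightarrow> 'a set \<Rightarrow> bool" where
  "equipollent_in M A B \<longleftrightarrow> (\<exists>f. bij_betw f A B \<and> coded_in M (graph_on A f))"

definition cardinal_in :: "'a::set_universe set \<Rightarrow> 'a \<Rightarrow> bool" where
  "cardinal_in M k \<longleftrightarrow>
     k \<in> M \<and> ordinal k \<and> (\<forall>a\<in>ext k. \<not> equipollent_in M (ext k) (ext a))"

definition infinite_cardinal_in :: "'a::set_universe set \<Rightarrow> 'a \<Rightarrow> bool" where
  "infinite_cardinal_in M k \<longleftrightarrow> cardinal_in M k \<and> range vnat \<subseteq> ext k"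

definition has_cofinal_map_in :: "'a::set_universe set \<Rightarrow> 'a \<Rightarrow> 'a \<Rightarrow> bool" where
  "has_cofinal_map_in M d k \<longleftrightarrow>
     (\<exists>f. f ` ext d \<subseteq> ext k \<and> (\<forall>x\<in>ext k. \<exists>y\<in>ext d. x = f y \<or> x \<in>\<^sub>V f y) \<and>
          coded_in M (graph_on (ext d) f))"

text \<open>\<open>M\<close> satisfies "the cofinality of \<open>k\<close> is \<open>d\<close>".\<close>
definition cofinality_in :: "'a::set_universe set \<Rightarrow> 'a \<Rightarrow> 'a \<Rightarrow> bool" where
  "cofinality_in M k d \<longleftrightarrow>
     d \<in> M \<and> ordinal d \<and> has_cofinal_map_in M d k \<and> (\<forall>c\<in>ext d. \<not> has_cofinal_map_in M c k)"

definition regular_in :: "'a::set_universe set \<Rightarrow> 'a \<Rightarrow> bool" where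
  "regular_in M k \<longleftrightarrow> infinite_cardinal_in M k \<and> cofinality_in M k k"

definition singular_in :: "'a::set_universe set \<Rightarrow> 'a \<Rightarrow> bool" where
  "singular_in M k \<longleftrightarrow> infinite_cardinal_in M k \<and> \<not> cofinality_in M k k"

definition vomega :: "'a::set_universe" where
  "vomega = vset (range vnat)"

definition omega_seqs_in :: "'a::set_universe set \<Rightarrow> 'a \<Rightarrow> 'a set" where
  "omega_seqs_in M v = {g \<in> M. \<exists>f. range f \<subseteq> ext v \<and> ext g = seq_graph f}"

text \<open>\<open>M\<close> satisfies: the cardinal power of \<open>v\<close> to the exponent \<open>\<omega>\<close> is less than \<open>k\<close>.\<close>
definition omega_power_less_in :: "'a::set_universe set \<Rightarrow> 'a \<Rightarrow> 'a \<Rightarrow> bool" where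
  "omega_power_less_in M v k \<longleftrightarrow>
     (\<exists>m\<in>ext k. cardinal_in M m \<and> equipollent_in M (omega_seqs_in M v) (ext m))"


section \<open>Forcing over a transitive model\<close>

text \<open>A forcing notion is a collection \<open>P\<close> of conditions with \<open>le q p\<close> for "\<open>q\<close> is stronger than \<open>p\<close>".\<close>

definition forcing_filter :: "'a::set_universe set \<Rightarrow> ('a \<Rightarrow> 'a \<Rightarrow> bool) \<Rightarrow> 'a set \<Rightarrow> bool" where
  "forcing_filter P le G \<longleftrightarrow>
     G \<subseteq> P \<and> G \<noteq> {} \<and>
     (\<forall>q\<in>G. \<forall>p\<in>P. le q p \<longrightarrow> p \<in> G) \<and>
     (\<forall>p\<in>G. \<forall>q\<in>G. \<exists>r\<in>G. le r p \<and> le r q)"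

definition dense_in :: "'a::set_universe set \<Rightarrow> ('a \<Rightarrow> 'a \<Rightarrow> bool) \<Rightarrow> 'a set \<Rightarrow> bool" where
  "dense_in P le D \<longleftrightarrow> D \<subseteq> P \<and> (\<forall>p\<in>P. \<exists>q\<in>D. le q p)"

definition generic ::
  "'a::set_universe set \<Rightarrow> 'a set \<Rightarrow> ('a \<Rightarrow> 'a \<Rightarrow> bool) \<Rightarrow> 'a set \<Rightarrow> bool" where
  "generic M P le G \<longleftrightarrow>
     forcing_filter P le G \<and> (\<forall>D. dense_in P le D \<and> coded_in M D \<longrightarrow> G \<inter> D \<noteq> {})"

inductive is_name :: "'a::set_universe set \<Rightarrow> 'a \<Rightarrow> bool" for P where
  "(\<And>z. z \<in>\<^sub>V t \<Longrightarrow> \<exists>s r. z = vpair s r \<and> r \<in> P \<and> is_name P s) \<Longrightarrow> is_name P t"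

function name_val :: "'a::set_universe set \<Rightarrow> 'a \<Rightarrow> 'a" where
  "name_val G t = vset (name_val G ` {s. \<exists>r\<in>G. vpair s r \<in>\<^sub>V t})"
  by auto
termination
proof (relation "inv_image ({(x, y). x \<in>\<^sub>V y}\<^sup>+) snd")
  show "wf (inv_image ({(x, y :: 'a). x \<in>\<^sub>V y}\<^sup>+) snd)"
    by (intro wf_inv_image wf_trancl wf_vmem)
next
  fix G :: "'a set" and t s :: 'a
  assume "s \<in> {s. \<exists>r\<in>G. vpair s r \<in>\<^sub>V t}"
  then obtain r where "vpair s r \<in>\<^sub>V t"
    by blast
  from vpair_component_below[OF this]
  show "((G, s), (G, t)) \<in> inv_image ({(x, y). x \<in>\<^sub>V y}\<^sup>+) snd"
    unfolding in_inv_image snd_conv .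
qed

declare name_val.simps [simp del]

definition generic_extension ::
  "'a::set_universe set \<Rightarrow> 'a set \<Rightarrow> 'a set \<Rightarrow> 'a set" where
  "generic_extension M P G = name_val G ` {t \<in> M. is_name P t}"

text \<open>The canonical name of \<open>x\<close>.  Every condition is attached to every element, which avoids
  reference to a largest condition; the value under any nonempty \<open>G \<subseteq> P\<close> is \<open>x\<close>.\<close>
function check_name :: "'a::set_universe set \<Rightarrow> 'a \<Rightarrow> 'a" where
  "check_name P x = vset ((\<lambda>(c, r). vpair c r) ` ((check_name P ` ext x) \<times> P))"
  by auto
termination
proof (relation "inv_image {(x, y). x \<in>\<^sub>V y} snd")
  show "wf (inv_image {(x, y :: 'a). x \<in>\<^sub>V y} snd)"
    by (intro wf_inv_image wf_vmem)
qed (simp add: ext_def)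

declare check_name.simps [simp del]

definition filter_name :: "'a::set_universe set \<Rightarrow> 'a" where
  "filter_name P = vset ((\<lambda>r. vpair (check_name P r) r) ` P)"

text \<open>\<open>p\<close> forces a statement about the generic filter; the statement may refer to the ground model.\<close>
definition forces ::
  "'a::set_universe set \<Rightarrow> 'a set \<Rightarrow> ('a \<Rightarrow> 'a \<Rightarrow> bool) \<Rightarrow> 'a \<Rightarrow> ('a set \<Rightarrow> bool) \<Rightarrow> bool" where
  "forces M P le p \<Phi> \<longleftrightarrow> (\<forall>G. generic M P le G \<and> p \<in> G \<longrightarrow> \<Phi> G)"

definition is_omega_seq :: "'a::set_universe \<Rightarrow> 'a set \<Rightarrow> bool" where
  "is_omega_seq a B \<longleftrightarrow> (\<exists>f. range f \<subseteq> B \<and> ext a = seq_graph f)"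

definition minimal_for_omega_sequences ::
  "'a::set_universe set \<Rightarrow> 'a set \<Rightarrow> ('a \<Rightarrow> 'a \<Rightarrow> bool) \<Rightarrow> bool" where
  "minimal_for_omega_sequences M P le \<longleftrightarrow>
     (\<forall>G N. generic M P le G \<and> transitive_model N \<and> M \<subseteq> N \<and> N \<subseteq> generic_extension M P G \<and>
        (\<exists>a\<in>N. is_omega_seq a {b. ordinal b} \<and> a \<notin> M) \<longrightarrow>
        N = generic_extension M P G)"


section \<open>The forcing with perfect trees\<close>

text \<open>Nodes are handled as HOL lists, and end-extension is \<^term>\<open>prefix\<close>; as an element of a
  condition a node \<open>t\<close> is the finite function \<^term>\<open>vlist t\<close>.\<close>

definition nodes :: "(nat \<Rightarrow> 'a::set_universe) \<Rightarrow> 'a list set" where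
  "nodes K = {t. \<forall>m<length t. t ! m \<in>\<^sub>V K m}"

definition tree :: "(nat \<Rightarrow> 'a::set_universe) \<Rightarrow> 'a list set \<Rightarrow> bool" where
  "tree K T \<longleftrightarrow> T \<noteq> {} \<and> T \<subseteq> nodes K \<and> (\<forall>t\<in>T. \<forall>s. prefix s t \<longrightarrow> s \<in> T)"

definition tree_succ :: "'a list set \<Rightarrow> 'a list \<Rightarrow> 'a list set" where
  "tree_succ T t = {u \<in> T. \<exists>a. u = t @ [a]}"

definition perfect_tree_in ::
  "'a::set_universe set \<Rightarrow> (nat \<Rightarrow> 'a) \<Rightarrow> 'a list set \<Rightarrow> bool" where
  "perfect_tree_in M K T \<longleftrightarrow>
     tree K T \<and>
     (\<forall>s\<in>T. \<exists>t\<in>T. strict_prefix s t) \<and>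
     (\<forall>s\<in>T. \<forall>n. \<exists>t\<in>T. prefix s t \<and> card_le_in M (ext (K n)) (vlist ` tree_succ T t))"

definition perfect_trees :: "'a::set_universe set \<Rightarrow> (nat \<Rightarrow> 'a) \<Rightarrow> 'a set" where
  "perfect_trees M K = {p \<in> M. \<exists>T. ext p = vlist ` T \<and> perfect_tree_in M K T}"

definition tree_le :: "'a::set_universe \<Rightarrow> 'a \<Rightarrow> bool" where
  "tree_le q p \<longleftrightarrow> ext q \<subseteq> ext p"

end

theory Submission
  imports Defs
begin

text \<open>
  Suppose that \<open>A\<close> names a new sequence below \<open>p\<close>.  Below every \<open>r \<le> p\<close> and for every \<open>m\<close>, some
  \<open>A(i)\<close> has at least \<open>\<kappa>\<^sub>m\<close> possible values.  Otherwise the sequence runs through a product of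
  fewer than \<open>\<kappa>\<close> many functions \<open>f\<close>, because \<open>\<nu>\<^sup>\<omega> < \<kappa>\<close>.  For each \<open>f\<close> the Cantor--Bendixson derivative
  of the conditions compatible with \<open>A = f\<close> dies out, since from a nonempty kernel a fusion would
  produce a condition that forces \<open>A = f\<close>.  A splitting node with more successors than there are
  functions has a successor above which the ranks of all \<open>f\<close> drop at once; iterating this, one decides \<open>A\<close>
  to be a function \<open>f\<close> whose rank drops infinitely often.

  With many values available, a second fusion yields densely many trees \<open>Q\<close> in which any two
  distinct successors of a node force different values of some \<open>A(i)\<close>.  If \<open>Q\<close> is in the generic filter,
  then the generic branch consists of those \<open>s \<in> Q\<close> for which everything that \<open>Q\<close> forces about \<open>A\<close>
  above \<open>s\<close> is true, and the generic filter consists of the trees that contain the branch.  Hence the filter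
  belongs to every transitive model of ZFC that includes the ground model and contains the
  sequence; that the generic extension is itself such a model is not needed.
\<close>

section \<open>Small sets\<close>

text \<open>The ground model may be uncountable or a proper class, so a condition need not lie in
  any generic filter, and the combinatorics cannot appeal to generic extensions. It rests instead on
  an internal forcing relation, defined by recursion over \<open>M\<close> for atomic statements,
  and on a condition \<open>p0\<close> found by density in the given filter \<open>G\<close>; the
  condition \<open>p\<close> of the theorem enters through what it makes true of that
  \<open>G\<close>. Every choice, recursion and set formed on the way has to be an element of
  \<open>M\<close>, which is why constructions come with proofs of definability.

  All functions \<open>f\<close> must lose rank simultaneously because the one that is finally
  followed is known only after infinitely many steps. The decreasing sequence of conditions that
  decides it may have no lower bound; only the decided function is used. The cardinal hypothesis is
  spent on making the functions fewer than the successors of some splitting node, where regularity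
  of the \<kappa>_n allows the small sets of bad successors to be avoided together.\<close>

definition small :: "'a::set_universe set \<Rightarrow> bool" where
  "small A \<longleftrightarrow> (\<exists>a. ext a = A)"

abbreviation ext_subset :: "'a::set_universe \<Rightarrow> 'a \<Rightarrow> bool" (infix "\<unlhd>" 50) where
  "x \<unlhd> y \<equiv> ext x \<subseteq> ext y"

lemma mem_ext: "x \<in>\<^sub>V a \<longleftrightarrow> x \<in> ext a"
  by (simp add: ext_def)

lemma small_ext [simp]: "small (ext a)"
  by (auto simp: small_def)

lemma ext_vset_small [simp]: "small A \<Longrightarrow> ext (vset A) = A"
  unfolding small_def by (rule ext_vset)

lemma vset_eq_iff: "small A \<Longrightarrow> small B \<Longrightarrow> vset A = vset B \<longleftrightarrow> A = B"
  by (metis ext_vset_small)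

lemma ext_eqI: "(\<And>z. z \<in> ext x \<longleftrightarrow> z \<in> ext y) \<Longrightarrow> x = y"
  by (rule ext_inject) blast

lemma small_image_Collect:
  fixes f :: "'a::set_universe \<Rightarrow> 'a"
  assumes "small A" shows "small (f ` {x \<in> A. R x})"
proof -
  from assms obtain a where a: "ext a = A" by (auto simp: small_def)
  obtain b where "\<forall>w. w \<in>\<^sub>V b \<longleftrightarrow> (\<exists>y. y \<in>\<^sub>V a \<and> R y \<and> w = f y)"
    using vmem_replacement[where x = a and Q = R and F = f] by blast
  then have "ext b = f ` {x \<in> A. R x}"
    using a by (auto simp: ext_def)
  then show ?thesis by (auto simp: small_def)
qed

lemma small_image [simp]: "small A \<Longrightarrow> small ((f :: 'a::set_universe \<Rightarrow> 'a) ` A)"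
  using small_image_Collect[of A f "\<lambda>_. True"] by simp

lemma small_Collect [simp]: "small A \<Longrightarrow> small {x \<in> A. R x}"
  using small_image_Collect[of A id R] by simp

lemma small_subset: "small A \<Longrightarrow> B \<subseteq> A \<Longrightarrow> small B"
  using small_Collect[of A "\<lambda>x. x \<in> B"] by (metis Collect_conj_eq Collect_mem_eq inf.absorb_iff2)

lemma small_empty [simp]: "small {}"
  by (rule small_subset[of "ext undefined"]) auto

lemma small_Union_ext [simp]: "small (\<Union>x\<in>ext a. ext x)"
proof -
  obtain u where "\<forall>w. w \<in>\<^sub>V u \<longleftrightarrow> (\<exists>y. y \<in>\<^sub>V a \<and> w \<in>\<^sub>V y)"
    using vmem_union by blast
  then have "ext u = (\<Union>x\<in>ext a. ext x)"
    by (auto simp: ext_def)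
  then show ?thesis by (auto simp: small_def)
qed

lemma small_UN [simp]:
  fixes B :: "'a::set_universe \<Rightarrow> 'a set"
  assumes "small A" "\<And>x. x \<in> A \<Longrightarrow> small (B x)" shows "small (\<Union>x\<in>A. B x)"
proof -
  from assms(1) obtain a where a: "ext (vset ((\<lambda>x. vset (B x)) ` A)) = (\<lambda>x. vset (B x)) ` A"
    by simp
  have "(\<Union>x\<in>A. B x) = (\<Union>x\<in>ext (vset ((\<lambda>x. vset (B x)) ` A)). ext x)"
    unfolding a using assms(2) by auto
  then show ?thesis by (simp only: small_Union_ext)
qed

lemma small_Un [simp]: assumes "small A" "small B" shows "small (A \<union> B)"
proof -
  have "A \<union> B = (\<Union>x\<in>ext (vset {vset A, vset B}). ext x)"
    using assms by (simp only: ext_vset_pair) auto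
  then show ?thesis by (simp only: small_Union_ext)
qed

lemma small_insert [simp]: assumes "small A" shows "small (insert x A)"
proof -
  have "insert x A = ext (vset {x}) \<union> A" by simp
  then show ?thesis using small_Un[OF small_ext assms] by metis
qed

section \<open>Coding of pairs, numbers and finite sequences\<close>

lemma vpair_inject [simp]: "vpair a b = vpair c d \<longleftrightarrow> a = c \<and> b = d"
  by (auto simp: vpair_def vset_eq_iff doubleton_eq_iff)

lemma ext_vnat_Suc [simp]: "ext (vnat (Suc n)) = insert (vnat n) (ext (vnat n))"
  by simp

declare vnat.simps(2) [simp del]

lemma ext_vnat_0 [simp]: "ext (vset {}) = {}"
  by simp

lemma ext_vnat: "ext (vnat n) = vnat ` {..<n}"
  by (induction n) (auto simp: lessThan_Suc)

lemma vmem_irrefl: "x \<notin> ext x"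
  using wf_vmem by (auto simp: ext_def dest: wf_not_refl)

lemma vnat_inject [simp]: "(vnat m :: 'a::set_universe) = vnat n \<longleftrightarrow> m = n"
proof -
  have "m < n \<Longrightarrow> (vnat m :: 'a) \<noteq> vnat n" for m n
    using vmem_irrefl[of "vnat n :: 'a"] by (metis ext_vnat imageI lessThan_iff)
  then show ?thesis by (metis nat_neq_iff)
qed

lemma vnat_mem_vnat [simp]: "(vnat m :: 'a::set_universe) \<in> ext (vnat n) \<longleftrightarrow> m < n"
  by (auto simp: ext_vnat)

text \<open>Replacement maps only sets of the universe, so the index set is carried to
  \<open>vnat (length xs)\<close>, and \<open>THE j\<close> inverts \<open>vnat\<close>
  there.\<close>

lemma small_vlist: "small ((\<lambda>i. vpair (vnat i) (xs ! i)) ` {..<length xs})"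
  using small_image[OF small_ext, of "\<lambda>i. vpair i (xs ! (THE j. i = vnat j))" "vnat (length xs)"]
  by (simp add: ext_vnat image_image)

lemma ext_vlist: "ext (vlist xs) = (\<lambda>i. vpair (vnat i) (xs ! i)) ` {..<length xs}"
  by (simp add: vlist_def small_vlist)

lemma vpair_mem_vlist [simp]:
  "vpair (vnat i) x \<in> ext (vlist xs) \<longleftrightarrow> i < length xs \<and> x = xs ! i"
  by (auto simp: ext_vlist)

lemma vlist_le_iff [simp]: "vlist xs \<unlhd> vlist ys \<longleftrightarrow> prefix xs ys"
proof
  assume "vlist xs \<unlhd> vlist ys"
  then have *: "i < length ys \<and> ys ! i = xs ! i" if "i < length xs" for i
    using that vpair_mem_vlist by (metis subset_iff)
  then have "length xs \<le> length ys"
    by (meson linorder_not_less order.irrefl)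
  then have "xs = take (length xs) ys"
    using * by (intro nth_equalityI) auto
  then show "prefix xs ys" by (metis take_is_prefix)
qed (auto simp: ext_vlist prefix_def nth_append)

lemma vlist_inject [simp]: "vlist xs = vlist ys \<longleftrightarrow> xs = ys"
  by (metis vlist_le_iff order_refl prefix_order.antisym)

lemma vlist_Nil: "vlist [] = vset {}"
  by (simp add: vlist_def)

lemma vlist_append1: "ext (vlist (xs @ [x])) = insert (vpair (vnat (length xs)) x) (ext (vlist xs))"
  by (auto simp: ext_vlist nth_append lessThan_Suc)


subsection \<open>Functions as sets\<close>

definition vUnion :: "'a::set_universe \<Rightarrow> 'a" where
  "vUnion a = vset (\<Union>x\<in>ext a. ext x)"

lemma ext_vUnion [simp]: "ext (vUnion a) = (\<Union>x\<in>ext a. ext x)"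
  by (simp add: vUnion_def)

text \<open>Cutting \<open>f\<close> down to \<open>a\<close> makes a set of an arbitrary HOL
  function. Whether that set lies in \<open>M\<close> is a separate matter, and is how functions of
  the model are recognised.\<close>

definition lam :: "'a::set_universe \<Rightarrow> ('a \<Rightarrow> 'a) \<Rightarrow> 'a" where
  "lam a f = vset (graph_on (ext a) f)"

lemma ext_lam [simp]: "ext (lam a f) = (\<lambda>x. vpair x (f x)) ` ext a"
  by (simp add: lam_def graph_on_def)

lemma lam_cong: "a = b \<Longrightarrow> (\<And>x. x \<in> ext b \<Longrightarrow> f x = g x) \<Longrightarrow> lam a f = lam b g"
  by (rule ext_inject) auto

text \<open>The components of a Kuratowski pair sit two membership levels below it. The double union
  therefore bounds domain and range of a relation, so that \<open>app\<close> can be defined by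
  bounded separation.\<close>

lemma fst_snd_mem_vUnion2:
  "vpair x y \<in> ext f \<Longrightarrow> x \<in> ext (vUnion (vUnion f)) \<and> y \<in> ext (vUnion (vUnion f))"
proof -
  assume "vpair x y \<in> ext f"
  moreover have "vset {x, y} \<in> ext (vpair x y)" by (simp add: vpair_def)
  ultimately have "vset {x, y} \<in> ext (vUnion f)" by auto
  moreover have "x \<in> ext (vset {x, y})" "y \<in> ext (vset {x, y})" by auto
  ultimately show ?thesis by (metis UN_I ext_vUnion)
qed

text \<open>The union over all values at \<open>x\<close>; it is the value at \<open>x\<close> when \<open>f\<close> is functional there.\<close>
definition app :: "'a::set_universe \<Rightarrow> 'a \<Rightarrow> 'a" where
  "app f x = vUnion (vset {y \<in> ext (vUnion (vUnion f)). vpair x y \<in> ext f})"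

lemma app_eqI:
  assumes "\<And>z. vpair x z \<in> ext f \<longleftrightarrow> z = y" shows "app f x = y"
proof -
  have "vpair x y \<in> ext f" using assms by simp
  with assms have "{y \<in> ext (vUnion (vUnion f)). vpair x y \<in> ext f} = {y}"
    using fst_snd_mem_vUnion2[of x y f] by (auto simp del: ext_vUnion)
  then show ?thesis
    unfolding app_def by (intro ext_inject) (simp del: ext_vUnion, simp)
qed

lemma app_lam [simp]: "x \<in> ext a \<Longrightarrow> app (lam a f) x = f x"
  by (rule app_eqI) auto

lemma lam_app_lam [simp]: "lam a (app (lam a f)) = lam a f"
  by (rule lam_cong) auto

subsection \<open>Transitive closures and recursion\<close>

abbreviation memrel :: "('a::set_universe \<times> 'a) set" where
  "memrel \<equiv> {(x, y). x \<in>\<^sub>V y}"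

definition tcl :: "'a::set_universe \<Rightarrow> 'a" where
  "tcl x = vset {y. (y, x) \<in> memrel\<^sup>+}"

lemma vmem_induct [case_names step]: "(\<And>x. (\<And>y. y \<in> ext x \<Longrightarrow> P y) \<Longrightarrow> P x) \<Longrightarrow> P x"
  using wf_vmem by (metis (no_types, lifting) wf_induct case_prodI mem_Collect_eq mem_ext)

lemma trancl_mem_unfold:
  "{y. (y, x) \<in> memrel\<^sup>+} = ext x \<union> (\<Union>z\<in>ext x. {y. (y, z) \<in> memrel\<^sup>+})"
  by (auto simp: ext_def elim: tranclE intro: trancl_into_trancl)

text \<open>Membership induction takes the place of a union of omega iterates, since the background
  may lack the set omega.\<close>

lemma small_trancl_mem: "small {y. (y, x) \<in> memrel\<^sup>+}"
  by (induction x rule: vmem_induct) (subst trancl_mem_unfold, simp)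

lemma mem_tcl_iff: "y \<in> ext (tcl x) \<longleftrightarrow> (y, x) \<in> memrel\<^sup>+"
  by (simp add: tcl_def small_trancl_mem)

lemma ext_tcl: "ext (tcl x) = ext x \<union> (\<Union>z\<in>ext x. ext (tcl z))"
  using trancl_mem_unfold[of x] by (simp add: tcl_def small_trancl_mem)

lemma tcl_trans: "y \<in> ext x \<Longrightarrow> x \<in> ext (tcl z) \<Longrightarrow> y \<in> ext (tcl z)"
  unfolding mem_tcl_iff by (rule trancl_into_trancl2) (simp_all add: mem_ext)

lemma tcl_subset: "y \<in> ext (tcl x) \<Longrightarrow> tcl y \<unlhd> tcl x"
  by (auto simp: mem_tcl_iff)

lemma ext_subset_tcl: "x \<unlhd> tcl x"
  by (subst ext_tcl) simp

lemma tcl_least: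
  assumes "ext x \<subseteq> D" "\<And>y. y \<in> D \<Longrightarrow> ext y \<subseteq> D" shows "ext (tcl x) \<subseteq> D"
  using assms(1)
proof (induction x rule: vmem_induct)
  case (step x)
  then show ?case using assms(2) by (subst ext_tcl) blast
qed

lemma tcl_induct [case_names step]: "(\<And>x. (\<And>y. y \<in> ext (tcl x) \<Longrightarrow> P y) \<Longrightarrow> P x) \<Longrightarrow> P x"
  using wf_trancl[OF wf_vmem] by (metis (no_types, lifting) wf_induct mem_tcl_iff)

lemma vpair_mem_tcl: "vpair s r \<in> ext t \<Longrightarrow> s \<in> ext (tcl t)"
  using vpair_component_below by (simp add: mem_tcl_iff mem_ext)

text \<open>The recursion runs along the transitive closure because names occur inside pairs,
  several levels down. Earlier values reach \<open>G\<close> as the set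
  \<open>lam (tcl x) f\<close>, so that \<open>G\<close> can be a definable term in two set
  variables.\<close>

definition vrec :: "('a::set_universe \<Rightarrow> 'a \<Rightarrow> 'a) \<Rightarrow> 'a \<Rightarrow> 'a" where
  "vrec G = wfrec (memrel\<^sup>+) (\<lambda>f x. G x (lam (tcl x) f))"

lemma vrec: "vrec G x = G x (lam (tcl x) (vrec G))"
proof -
  have "lam (tcl x) (cut f (memrel\<^sup>+) x) = lam (tcl x) f" for f :: "'a \<Rightarrow> 'a"
    by (rule lam_cong) (auto simp: cut_apply mem_tcl_iff)
  then show ?thesis
    unfolding vrec_def by (subst wfrec[OF wf_trancl[OF wf_vmem]]) simp
qed


section \<open>Definability over a class\<close>

text \<open>Interleaving reserves infinitely many variables both for arguments and for parameters,
  so that no arities have to be tracked.\<close>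

definition mix :: "(nat \<Rightarrow> 'a) \<Rightarrow> (nat \<Rightarrow> 'a) \<Rightarrow> nat \<Rightarrow> 'a" where
  "mix e c n = (if even n then e (n div 2) else c (n div 2))"

primrec ren :: "fm \<Rightarrow> (nat \<Rightarrow> nat) \<Rightarrow> fm" where
  "ren (Mem i j) \<rho> = Mem (\<rho> i) (\<rho> j)"
| "ren (Equal i j) \<rho> = Equal (\<rho> i) (\<rho> j)"
| "ren (Neg \<phi>) \<rho> = Neg (ren \<phi> \<rho>)"
| "ren (Conj \<phi> \<psi>) \<rho> = Conj (ren \<phi> \<rho>) (ren \<psi> \<rho>)"
| "ren (Exists \<phi>) \<rho> = Exists (ren \<phi> (case_nat 0 (\<lambda>n. Suc (\<rho> n))))"

lemma sat_ren: "sat M e (ren \<phi> \<rho>) \<longleftrightarrow> sat M (\<lambda>n. e (\<rho> n)) \<phi>"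
proof (induction \<phi> arbitrary: e \<rho>)
  case (Exists \<phi>)
  have "(\<lambda>n. case_nat x e (case_nat 0 (\<lambda>n. Suc (\<rho> n)) n)) = case_nat x (\<lambda>n. e (\<rho> n))" for x
    by (auto split: nat.split)
  then show ?case by (simp add: Exists)
qed simp_all

text \<open>Even-numbered variables carry the arguments of the relation, odd-numbered ones
  parameters from \<open>M\<close>.\<close>
definition definable :: "'a::set_universe set \<Rightarrow> ((nat \<Rightarrow> 'a) \<Rightarrow> bool) \<Rightarrow> bool" where
  "definable M R \<longleftrightarrow>
     (\<exists>\<phi> c. range c \<subseteq> M \<and> (\<forall>e. range e \<subseteq> M \<longrightarrow> sat M (mix e c) \<phi> = R e))"

definition definable_term :: "'a::set_universe set \<Rightarrow> ((nat \<Rightarrow> 'a) \<Rightarrow> 'a) \<Rightarrow> bool" where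
  "definable_term M F \<longleftrightarrow>
     (\<forall>e. range e \<subseteq> M \<longrightarrow> F e \<in> M) \<and> definable M (\<lambda>e. e 0 = F (\<lambda>n. e (Suc n)))"

lemma definable_cong:
  "definable M R \<Longrightarrow> (\<And>e. range e \<subseteq> M \<Longrightarrow> R e = R' e) \<Longrightarrow> definable M R'"
  unfolding definable_def by metis

lemma range_mix: "range e \<subseteq> M \<Longrightarrow> range c \<subseteq> M \<Longrightarrow> range (mix e c) \<subseteq> M"
  by (auto simp: mix_def)

lemma range_case_nat: "x \<in> M \<Longrightarrow> range e \<subseteq> M \<Longrightarrow> range (case_nat x e) \<subseteq> M"
  by (auto simp: image_subset_iff split: nat.split)

lemma mix_even [simp]: "mix e c (2 * n) = e n"
  and mix_odd [simp]: "mix e c (Suc (2 * n)) = c n"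
  by (simp_all add: mix_def)

lemma parity_cases: obtains k where "n = 2 * k" | k where "n = Suc (2 * k)"
  by (cases "even n") (auto elim!: evenE oddE)

lemma definable_ren:
  assumes "definable M R" shows "definable M (\<lambda>e. R (\<lambda>n. e (\<rho> n)))"
proof -
  obtain \<phi> c where c: "range c \<subseteq> M" "\<And>e. range e \<subseteq> M \<Longrightarrow> sat M (mix e c) \<phi> = R e"
    using assms unfolding definable_def by blast
  let ?\<rho> = "\<lambda>n. if even n then 2 * \<rho> (n div 2) else n"
  have "(\<lambda>n. mix e c (?\<rho> n)) = mix (\<lambda>n. e (\<rho> n)) c" for e
    by (auto simp: mix_def)
  then have "sat M (mix e c) (ren \<phi> ?\<rho>) = R (\<lambda>n. e (\<rho> n))" if "range e \<subseteq> M" for e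
    unfolding sat_ren using that by (simp only:) (auto intro!: c(2))
  then show ?thesis using c(1) unfolding definable_def by blast
qed

lemma definable_var_mem: "M \<noteq> {} \<Longrightarrow> definable M (\<lambda>e. e i \<in> ext (e j))"
  unfolding definable_def
  by (rule exI[of _ "Mem (2*i) (2*j)"], rule exI[of _ "\<lambda>_. SOME x. x \<in> M"])
    (auto simp: mix_def ext_def some_in_eq)

lemma definable_var_eq: "M \<noteq> {} \<Longrightarrow> definable M (\<lambda>e. e i = e j)"
  unfolding definable_def
  by (rule exI[of _ "Equal (2*i) (2*j)"], rule exI[of _ "\<lambda>_. SOME x. x \<in> M"])
    (auto simp: mix_def some_in_eq)

lemma definable_not:
  assumes "definable M R" shows "definable M (\<lambda>e. \<not> R e)"
proof -
  obtain \<phi> c where "range c \<subseteq> M" "\<And>e. range e \<subseteq> M \<Longrightarrow> sat M (mix e c) \<phi> = R e"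
    using assms unfolding definable_def by blast
  then show ?thesis
    unfolding definable_def by (intro exI[of _ "Neg \<phi>"] exI[of _ c]) auto
qed

lemma definable_conj:
  assumes "definable M R" "definable M S" shows "definable M (\<lambda>e. R e \<and> S e)"
proof -
  obtain \<phi> c where c: "range c \<subseteq> M" "\<And>e. range e \<subseteq> M \<Longrightarrow> sat M (mix e c) \<phi> = R e"
    using assms(1) unfolding definable_def by blast
  obtain \<psi> d where d: "range d \<subseteq> M" "\<And>e. range e \<subseteq> M \<Longrightarrow> sat M (mix e d) \<psi> = S e"
    using assms(2) unfolding definable_def by blast
  \<comment> \<open>The two parameter sequences are merged into \<open>mix c d\<close>: parameter k
    of \<open>\<phi>\<close> moves from variable 2k+1 to 4k+1, parameter k of \<open>\<psi>\<close>
    to 4k+3.\<close>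
  let ?\<rho> = "\<lambda>n. if even n then n else Suc (2 * (n - 1))"
  let ?\<sigma> = "\<lambda>n. if even n then n else Suc (2 * n)"
  have "mix e (mix c d) (?\<rho> n) = mix e c n" "mix e (mix c d) (?\<sigma> n) = mix e d n" for e n
    by (cases n rule: parity_cases; simp only: mix_odd mix_even even_Suc dvd_triv_left if_True
        not_True_eq_False if_False diff_Suc_1 simp_thms)+
  then have "(\<lambda>n. mix e (mix c d) (?\<rho> n)) = mix e c" "(\<lambda>n. mix e (mix c d) (?\<sigma> n)) = mix e d" for e
    by auto
  then have "sat M (mix e (mix c d)) (Conj (ren \<phi> ?\<rho>) (ren \<psi> ?\<sigma>)) \<longleftrightarrow> R e \<and> S e"
    if "range e \<subseteq> M" for e
    using c(2)[OF that] d(2)[OF that] by (simp add: sat_ren)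
  then show ?thesis
    using range_mix[OF c(1) d(1)] unfolding definable_def by blast
qed

text \<open>A quantifier shifts every variable by one and so exchanges the parities. With this
  renaming, a formula that reads the bound variable as argument 0 can be placed below the
  quantifier.\<close>

definition under_binder :: "nat \<Rightarrow> nat" where
  "under_binder n = (if n = 0 then 0 else if even n then n - 1 else Suc n)"

lemma nat_parity_cases: obtains "n = 0" | k where "n = Suc (2 * k)" | k where "n = Suc (Suc (2 * k))"
  by (cases n) (auto elim: parity_cases)

lemma mix_case_nat: "mix (case_nat x e) c = (\<lambda>n. case_nat x (mix e c) (under_binder n))"
proof
  fix n show "mix (case_nat x e) c n = case_nat x (mix e c) (under_binder n)"
    by (cases n rule: nat_parity_cases) (simp_all add: mix_def under_binder_def)
qed

lemma definable_bex:
  assumes "definable M (\<lambda>e. R (e 0) (\<lambda>n. e (Suc n)))"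
  shows "definable M (\<lambda>e. \<exists>x\<in>M. R x e)"
proof -
  obtain \<phi> c where c: "range c \<subseteq> M"
      "\<And>e. range e \<subseteq> M \<Longrightarrow> sat M (mix e c) \<phi> = R (e 0) (\<lambda>n. e (Suc n))"
    using assms unfolding definable_def by blast
  have "sat M (mix e c) (Exists (ren \<phi> under_binder)) \<longleftrightarrow> (\<exists>x\<in>M. R x e)" if "range e \<subseteq> M" for e
    using c(2)[OF range_case_nat[OF _ that]] by (simp add: sat_ren mix_case_nat[symmetric])
  then show ?thesis
    using c(1) unfolding definable_def by blast
qed

lemma definable_param:
  assumes "a \<in> M" "definable M (\<lambda>e. R (e 0) (\<lambda>n. e (Suc n)))"
  shows "definable M (R a)"
proof -
  obtain \<phi> c where c: "range c \<subseteq> M"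
      "\<And>e. range e \<subseteq> M \<Longrightarrow> sat M (mix e c) \<phi> = R (e 0) (\<lambda>n. e (Suc n))"
    using assms unfolding definable_def by blast
  define \<rho> where "\<rho> n = (if n = 0 then 1 else if even n then n - 2 else n + 2)" for n :: nat
  have "mix (case_nat a e) c n = mix e (case_nat a c) (\<rho> n)" for e n
    by (cases n rule: nat_parity_cases) (simp_all add: mix_def \<rho>_def)
  then have "(\<lambda>n. mix e (case_nat a c) (\<rho> n)) = mix (case_nat a e) c" for e
    by (intro HOL.ext) simp
  then have "sat M (mix e (case_nat a c)) (ren \<phi> \<rho>) = R a e" if "range e \<subseteq> M" for e
    using c(2)[OF range_case_nat[OF assms(1) that]] by (simp add: sat_ren)
  then show ?thesis
    using range_case_nat[OF assms(1) c(1)] unfolding definable_def by blast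
qed

lemma definable_disj:
  assumes "definable M R" "definable M S" shows "definable M (\<lambda>e. R e \<or> S e)"
proof -
  have "definable M (\<lambda>e. \<not> (\<not> R e \<and> \<not> S e))"
    by (rule definable_not definable_conj assms)+
  then show ?thesis by simp
qed

lemma definable_imp:
  assumes "definable M R" "definable M S" shows "definable M (\<lambda>e. R e \<longrightarrow> S e)"
  unfolding imp_conv_disj by (rule definable_disj definable_not assms)+

lemma definable_iff:
  assumes "definable M R" "definable M S" shows "definable M (\<lambda>e. R e = S e)"
proof -
  have "definable M (\<lambda>e. (R e \<longrightarrow> S e) \<and> (S e \<longrightarrow> R e))"
    by (rule definable_imp definable_conj assms)+
  then show ?thesis by (simp add: iff_conv_conj_imp)
qed

lemma definable_ball:
  assumes "definable M (\<lambda>e. R (e 0) (\<lambda>n. e (Suc n)))"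
  shows "definable M (\<lambda>e. \<forall>x\<in>M. R x e)"
proof -
  have "definable M (\<lambda>e. \<not> (\<exists>x\<in>M. \<not> R x e))"
    by (rule definable_not definable_bex assms)+
  then show ?thesis by simp
qed

lemma definable_subst:
  assumes F: "definable_term M F" and R: "definable M (\<lambda>e. R (e 0) (\<lambda>n. e (Suc n)))"
  shows "definable M (\<lambda>e. R (F e) e)"
proof -
  have "definable M (\<lambda>e. \<exists>x\<in>M. x = F e \<and> R x e)"
    using F R by (intro definable_bex definable_conj) (auto simp: definable_term_def)
  then show ?thesis
    by (rule definable_cong) (use F in \<open>auto simp: definable_term_def\<close>)
qed

lemma definable_term_closed: "definable_term M F \<Longrightarrow> range e \<subseteq> M \<Longrightarrow> F e \<in> M"
  by (simp add: definable_term_def)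

lemma definable_term_ren:
  assumes "definable_term M F" shows "definable_term M (\<lambda>e. F (\<lambda>n. e (\<rho> n)))"
proof -
  have "definable M (\<lambda>e. e 0 = F (\<lambda>n. e (Suc n)))"
    using assms by (simp add: definable_term_def)
  from definable_ren[OF this, of "case_nat 0 (\<lambda>n. Suc (\<rho> n))"]
  have "definable M (\<lambda>e. e 0 = F (\<lambda>n. e (Suc (\<rho> n))))" by simp
  moreover have "F (\<lambda>n. e (\<rho> n)) \<in> M" if "range e \<subseteq> M" for e
    by (rule definable_term_closed[OF assms]) (use that in auto)
  ultimately show ?thesis by (simp add: definable_term_def)
qed

lemma definable_term_var: "M \<noteq> {} \<Longrightarrow> definable_term M (\<lambda>e. e i)"
  using definable_var_eq[of M 0 "Suc i"] by (auto simp: definable_term_def)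

lemma definable_term_const:
  assumes "a \<in> M" shows "definable_term M (\<lambda>e. a)"
proof -
  have "definable M (\<lambda>e. e 0 = a)"
    by (rule definable_param[OF assms, of "\<lambda>a e. e 0 = a"], rule definable_var_eq) (use assms in auto)
  then show ?thesis using assms by (simp add: definable_term_def)
qed

lemma definable1:
  assumes "definable M (\<lambda>e. R (e 0))" "definable_term M F"
  shows "definable M (\<lambda>e. R (F e))"
  by (rule definable_subst[OF assms(2), of "\<lambda>x e. R x"]) (rule assms(1))

lemma definable2:
  assumes "definable M (\<lambda>e. R (e 0) (e 1))" "definable_term M F" "definable_term M G"
  shows "definable M (\<lambda>e. R (F e) (G e))"
proof -
  have "definable M (\<lambda>e. R (F e) (e 0))"
    by (rule definable_subst[OF assms(2), of "\<lambda>x e. R x (e 0)"]) (use assms(1) in simp)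
  from definable_ren[OF this]
  have *: "definable M (\<lambda>e. R (F (\<lambda>n. e (\<rho> n))) (e (\<rho> 0)))" for \<rho> .
  have F': "definable_term M (\<lambda>e. F (\<lambda>n. e (Suc n)))"
    by (rule definable_term_ren[OF assms(2)])
  have "definable M (\<lambda>e. R (F (\<lambda>n. e (Suc n))) (e 0))"
    by (rule definable_subst[OF F', of "\<lambda>x e. R x (e 0)"]) (use assms(1) in simp)
  then show ?thesis
    by (rule definable_subst[OF assms(3), of "\<lambda>y e. R (F e) y"])
qed

lemma definable3:
  assumes R: "definable M (\<lambda>e. R (e 0) (e 1) (e 2))"
    and F: "definable_term M F" and G: "definable_term M G" and H: "definable_term M H"
  shows "definable M (\<lambda>e. R (F e) (G e) (H e))"
proof -
  have F': "definable_term M (\<lambda>e. F (\<lambda>n. e (Suc (Suc n))))"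
    by (rule definable_term_ren[OF F])
  have G': "definable_term M (\<lambda>e. G (\<lambda>n. e (Suc n)))"
    by (rule definable_term_ren[OF G])
  have "definable M (\<lambda>e. R (F (\<lambda>n. e (Suc (Suc n)))) (e 0) (e 1))"
    by (rule definable_subst[OF F', of "\<lambda>x e. R x (e 0) (e 1)"]) (use R in \<open>simp add: numeral_2_eq_2\<close>)
  then have "definable M (\<lambda>e. R (F (\<lambda>n. e (Suc n))) (G (\<lambda>n. e (Suc n))) (e 0))"
    using definable_subst[OF G', of "\<lambda>y e. R (F (\<lambda>n. e (Suc n))) y (e 0)"] by simp
  then show ?thesis
    by (rule definable_subst[OF H, of "\<lambda>z e. R (F e) (G e) z"])
qed

lemma definable4:
  assumes R: "definable M (\<lambda>e. R (e 0) (e 1) (e 2) (e 3))"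
    and F: "definable_term M F" and G: "definable_term M G" and H: "definable_term M H"
    and J: "definable_term M J"
  shows "definable M (\<lambda>e. R (F e) (G e) (H e) (J e))"
proof -
  have F': "definable_term M (\<lambda>e. F (\<lambda>n. e (Suc (Suc (Suc n)))))"
    by (rule definable_term_ren[OF F])
  have G': "definable_term M (\<lambda>e. G (\<lambda>n. e (Suc (Suc n))))"
    by (rule definable_term_ren[OF G])
  have H': "definable_term M (\<lambda>e. H (\<lambda>n. e (Suc n)))"
    by (rule definable_term_ren[OF H])
  have "definable M (\<lambda>e. R (F (\<lambda>n. e (Suc (Suc (Suc n))))) (e 0) (e 1) (e 2))"
    by (rule definable_subst[OF F', of "\<lambda>x e. R x (e 0) (e 1) (e 2)"])
      (use R in \<open>simp add: numeral_2_eq_2 numeral_3_eq_3\<close>)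
  then have "definable M (\<lambda>e. R (F (\<lambda>n. e (Suc (Suc n)))) (G (\<lambda>n. e (Suc (Suc n)))) (e 0) (e 1))"
    using definable_subst[OF G', of "\<lambda>y e. R (F (\<lambda>n. e (Suc (Suc n)))) y (e 0) (e 1)"]
    by (simp add: numeral_2_eq_2)
  then have "definable M (\<lambda>e. R (F (\<lambda>n. e (Suc n))) (G (\<lambda>n. e (Suc n))) (H (\<lambda>n. e (Suc n))) (e 0))"
    using definable_subst[OF H', of "\<lambda>z e. R (F (\<lambda>n. e (Suc n))) (G (\<lambda>n. e (Suc n))) z (e 0)"] by simp
  then show ?thesis
    by (rule definable_subst[OF J, of "\<lambda>w e. R (F e) (G e) (H e) w"])
qed

section \<open>Transitive models\<close>

locale ctm =
  fixes M :: "'a::set_universe set"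
  assumes transitive_model: "transitive_model M"
begin

abbreviation "Def \<equiv> definable M"
abbreviation "Trm \<equiv> definable_term M"

text \<open>In proofs by these rules, a parameter of the form \<open>lam a f\<close> needs its fact \<open>term_const\<close> in front of
  \<open>dfn\<close>, which otherwise goes on to ask for the definability of \<open>f\<close>.\<close>

named_theorems dfn

lemma ext_subset_M: "x \<in> M \<Longrightarrow> ext x \<subseteq> M"
  using transitive_model by (simp add: transitive_model_def)

lemma mem_M: "y \<in> ext x \<Longrightarrow> x \<in> M \<Longrightarrow> y \<in> M"
  using ext_subset_M by blast

lemma ZFC: "models_ZFC M"
  using transitive_model by (simp add: transitive_model_def)

lemma M_nonempty: "M \<noteq> {}"
  using ZFC by (auto simp: models_ZFC_def ax_infinity_def)

lemma pair_M: assumes "x \<in> M" "y \<in> M" shows "vset {x, y} \<in> M"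
proof -
  obtain z where z: "z \<in> M" "\<forall>w\<in>M. w \<in> ext z \<longleftrightarrow> w = x \<or> w = y"
    using ZFC assms unfolding models_ZFC_def ax_pairing_def mem_ext by blast
  have "ext z = {x, y}"
    using z assms mem_M by blast
  then have "vset {x, y} = z" by (metis vset_ext)
  then show ?thesis using z by simp
qed

lemma vUnion_M: assumes "x \<in> M" shows "vUnion x \<in> M"
proof -
  obtain u where u: "u \<in> M" "\<forall>w\<in>M. w \<in> ext u \<longleftrightarrow> (\<exists>y\<in>M. y \<in> ext x \<and> w \<in> ext y)"
    using ZFC assms unfolding models_ZFC_def ax_union_def mem_ext by blast
  have "ext u = ext (vUnion x)"
    using u assms mem_M by (auto; blast)
  then show ?thesis using u ext_inject by metis
qed

lemma empty_M: "vset {} \<in> M"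
proof -
  obtain e where e: "e \<in> M" "\<forall>w\<in>M. w \<notin> ext e"
    using ZFC unfolding models_ZFC_def ax_infinity_def mem_ext by blast
  have "e = vset {}"
    by (rule ext_inject) (use e mem_M in auto)
  then show ?thesis using e by simp
qed

definition pow :: "'a \<Rightarrow> 'a" where
  "pow x = vset {y \<in> M. y \<unlhd> x}"

lemma pow_aux: assumes "x \<in> M" shows "\<exists>z\<in>M. ext z = {y \<in> M. y \<unlhd> x}"
proof -
  obtain u where u: "u \<in> M" "\<forall>z\<in>M. z \<in> ext u \<longleftrightarrow> (\<forall>w\<in>M. w \<in> ext z \<longrightarrow> w \<in> ext x)"
    using ZFC assms unfolding models_ZFC_def ax_power_def mem_ext by blast
  then have "ext u = {y \<in> M. y \<unlhd> x}"
    using mem_M by (auto; blast)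
  then show ?thesis using u by blast
qed

lemma ext_pow: "x \<in> M \<Longrightarrow> ext (pow x) = {y \<in> M. y \<unlhd> x}"
  unfolding pow_def by (rule ext_vset) (use pow_aux in blast)

lemma pow_M: "x \<in> M \<Longrightarrow> pow x \<in> M"
  using pow_aux ext_pow ext_inject by metis

lemma separation:
  assumes "x \<in> M" "range e \<subseteq> M" "Def (\<lambda>e. R (e 0) (\<lambda>n. e (Suc n)))"
  shows "vset {z \<in> ext x. R z e} \<in> M"
proof -
  obtain \<phi> c where c: "range c \<subseteq> M"
      "\<And>e. range e \<subseteq> M \<Longrightarrow> sat M (mix e c) \<phi> = R (e 0) (\<lambda>n. e (Suc n))"
    using assms(3) unfolding definable_def by blast
  have sat: "sat M (case_nat z (mix e c)) (ren \<phi> under_binder) = R z e" if "z \<in> M" for z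
    using c(2)[OF range_case_nat[OF that assms(2)]] by (simp add: sat_ren mix_case_nat[symmetric])
  obtain y where y: "y \<in> M"
      "\<forall>z\<in>M. z \<in> ext y \<longleftrightarrow> z \<in> ext x \<and> sat M (case_nat z (mix e c)) (ren \<phi> under_binder)"
    using ZFC range_mix[OF assms(2) c(1)] assms(1)
    unfolding models_ZFC_def ax_separation_def mem_ext by blast
  have "ext y = {z \<in> ext x. R z e}"
    using y assms(1) mem_M sat by blast
  then have "vset {z \<in> ext x. R z e} = y" by (metis vset_ext)
  then show ?thesis using y by simp
qed

lemma replacement:
  assumes x: "x \<in> M" and e: "range e \<subseteq> M"
    and R: "Def (\<lambda>e. R (e 0) (e 1) (\<lambda>n. e (Suc (Suc n))))"
    and T: "\<And>u. u \<in> ext x \<Longrightarrow> T u \<in> M" "\<And>u v. u \<in> ext x \<Longrightarrow> v \<in> M \<Longrightarrow> R u v e \<longleftrightarrow> v = T u"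
  shows "vset (T ` ext x) \<in> M"
proof -
  have rep: "ax_replacement M" using ZFC by (simp add: models_ZFC_def)
  obtain \<phi> c where c: "range c \<subseteq> M"
      "\<And>e. range e \<subseteq> M \<Longrightarrow> sat M (mix e c) \<phi> = R (e 0) (e 1) (\<lambda>n. e (Suc (Suc n)))"
    using R unfolding definable_def by blast
  \<comment> \<open>The axiom puts \<open>u\<close> and \<open>v\<close> in front of an environment
    that is already interleaved. \<open>under_binder\<close> is applied below the binder of
    \<open>u\<close> to absorb \<open>v\<close>, and at the top to absorb \<open>u\<close>.\<close>
  define \<psi> where "\<psi> = ren (ren \<phi> under_binder) (case_nat 0 (\<lambda>n. Suc (under_binder n)))"
  have *: "(\<lambda>n. case_nat u (case_nat v (mix e c)) (case_nat 0 (\<lambda>n. Suc (under_binder n)) n)) =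
      case_nat u (mix (case_nat v e) c)" for u v
    unfolding mix_case_nat[of v] by (auto split: nat.split)
  have sat: "sat M (case_nat u (case_nat v (mix e c))) \<psi> = R u v e" if "u \<in> M" "v \<in> M" for u v
    unfolding \<psi>_def sat_ren[of _ _ "ren \<phi> under_binder"] *
    using c(2)[OF range_case_nat[OF that(1) range_case_nat[OF that(2) e]]]
    by (simp add: sat_ren mix_case_nat[symmetric])
  have "\<forall>u\<in>M. u \<in> ext x \<longrightarrow> (\<exists>!v. v \<in> M \<and> sat M (case_nat u (case_nat v (mix e c))) \<psi>)"
  proof (intro ballI impI)
    fix u assume "u \<in> M" "u \<in> ext x"
    then show "\<exists>!v. v \<in> M \<and> sat M (case_nat u (case_nat v (mix e c))) \<psi>"
      by (intro ex1I[of _ "T u"]) (auto simp: sat T)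
  qed
  then obtain y where y: "y \<in> M" "\<forall>v\<in>M. v \<in> ext y \<longleftrightarrow>
        (\<exists>u\<in>M. u \<in> ext x \<and> sat M (case_nat u (case_nat v (mix e c))) \<psi>)"
    using rep[unfolded ax_replacement_def mem_ext, THEN spec, THEN spec, of "mix e c" \<psi>]
      range_mix[OF e c(1)] x by blast
  have "v \<in> ext y \<longleftrightarrow> v \<in> T ` ext x" if "v \<in> M" for v
    using y(2) that mem_M[OF _ x] by (auto simp: sat T image_iff)
  moreover have "T ` ext x \<subseteq> M" using T(1) by blast
  ultimately have "ext y = T ` ext x"
    using mem_M[OF _ y(1)] by blast
  then have "vset (T ` ext x) = y" by (metis vset_ext)
  then show ?thesis using y by simp
qed

subsection \<open>Definable terms\<close>

lemmas term_var [dfn] = definable_term_var[OF M_nonempty]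
lemmas term_const = definable_term_const
lemmas [dfn] = definable_not definable_conj definable_disj definable_imp definable_iff
  definable_bex definable_ball

lemma in_M: "Trm (\<lambda>e. a) \<Longrightarrow> a \<in> M"
  using definable_term_closed[of M "\<lambda>_. a" "\<lambda>_. SOME x. x \<in> M"] M_nonempty by (auto simp: some_in_eq)

lemma def_mem [dfn]: "Trm F \<Longrightarrow> Trm G \<Longrightarrow> Def (\<lambda>e. F e \<in> ext (G e))"
  by (rule definable2[where R = "\<lambda>x y. x \<in> ext y"]) (rule definable_var_mem[OF M_nonempty])

lemma def_eq [dfn]: "Trm F \<Longrightarrow> Trm G \<Longrightarrow> Def (\<lambda>e. F e = G e)"
  by (rule definable2[where R = "\<lambda>x y. x = y"]) (rule definable_var_eq[OF M_nonempty])

lemma def_bex [dfn]: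
  assumes "Trm F" "Def (\<lambda>e. R (e 0) (\<lambda>n. e (Suc n)))"
  shows "Def (\<lambda>e. \<exists>x\<in>ext (F e). R x e)"
proof -
  have "Def (\<lambda>e. \<exists>x\<in>M. x \<in> ext (F e) \<and> R x e)"
    by (rule definable_bex definable_conj def_mem term_var definable_term_ren[OF assms(1)] assms)+
  then show ?thesis
    by (rule definable_cong) (use mem_M definable_term_closed[OF assms(1)] in blast)
qed

lemma def_ball [dfn]:
  assumes "Trm F" "Def (\<lambda>e. R (e 0) (\<lambda>n. e (Suc n)))"
  shows "Def (\<lambda>e. \<forall>x\<in>ext (F e). R x e)"
proof -
  have "Def (\<lambda>e. \<not> (\<exists>x\<in>ext (F e). \<not> R x e))"
    by (rule definable_not def_bex assms)+
  then show ?thesis by simp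
qed

lemma def_subset [dfn]: assumes "Trm F" "Trm G" shows "Def (\<lambda>e. F e \<unlhd> G e)"
  unfolding subset_eq by (rule dfn definable_term_ren[OF assms(1)] definable_term_ren[OF assms(2)])+

text \<open>By extensionality in \<open>M\<close>, the graph of \<open>F\<close> is definable as
  soon as membership in its value is.\<close>

lemma trmI:
  assumes "\<And>e. range e \<subseteq> M \<Longrightarrow> F e \<in> M" "Def (\<lambda>e. e 0 \<in> ext (F (\<lambda>n. e (Suc n))))"
  shows "Trm F"
proof -
  have "Def (\<lambda>e. \<forall>z\<in>M. (z \<in> ext (e 0)) = (z \<in> ext (F (\<lambda>n. e (Suc n)))))"
    using definable_ren[OF assms(2), of "case_nat 0 (\<lambda>n. Suc (Suc n))"]
    by (intro definable_ball definable_iff) (rule dfn, simp)+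
  then have "Def (\<lambda>e. e 0 = F (\<lambda>n. e (Suc n)))"
  proof (rule definable_cong)
    fix e :: "nat \<Rightarrow> 'a" assume e: "range e \<subseteq> M"
    then have "F (\<lambda>n. e (Suc n)) \<in> M" "e 0 \<in> M" by (auto intro!: assms(1))
    then show "(\<forall>z\<in>M. (z \<in> ext (e 0)) = (z \<in> ext (F (\<lambda>n. e (Suc n))))) =
        (e 0 = F (\<lambda>n. e (Suc n)))"
      using mem_M by (auto intro: ext_inject)
  qed
  then show ?thesis using assms(1) by (simp add: definable_term_def)
qed

lemma trm_Collect [dfn]:
  assumes F: "Trm F" and R: "Def (\<lambda>e. R (e 0) (\<lambda>n. e (Suc n)))"
  shows "Trm (\<lambda>e. vset {x \<in> ext (F e). R x e})"
proof (rule trmI)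
  show "vset {x \<in> ext (F e). R x e} \<in> M" if "range e \<subseteq> M" for e
    using definable_term_closed[OF F that] that R by (rule separation)
  have "Def (\<lambda>e. e 0 \<in> ext (F (\<lambda>n. e (Suc n))) \<and> R (e 0) (\<lambda>n. e (Suc n)))"
    by (rule definable_conj def_mem term_var definable_term_ren[OF F] R)+
  then show "Def (\<lambda>e. e 0 \<in> ext (vset {x \<in> ext (F (\<lambda>n. e (Suc n))). R x (\<lambda>n. e (Suc n))}))"
    by simp
qed

lemma trm_image [dfn]:
  assumes F: "Trm F" and H: "Trm (\<lambda>e. H (e 0) (\<lambda>n. e (Suc n)))"
  shows "Trm (\<lambda>e. vset ((\<lambda>x. H x e) ` ext (F e)))"
proof (rule trmI)
  have R: "Def (\<lambda>e. e 1 = H (e 0) (\<lambda>n. e (Suc (Suc n))))"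
    using definable_term_ren[OF H, of "case_nat 0 (\<lambda>n. Suc (Suc n))"]
    by (intro def_eq term_var) simp
  show "vset ((\<lambda>x. H x e) ` ext (F e)) \<in> M" if "range e \<subseteq> M" for e
  proof (rule replacement[where R = "\<lambda>u v e. v = H u e"])
    show "F e \<in> M" using F that by (rule definable_term_closed)
    then show "H u e \<in> M" if "u \<in> ext (F e)" for u
      using definable_term_closed[OF H range_case_nat[OF _ \<open>range e \<subseteq> M\<close>], of u] mem_M that by simp
  qed (use that R in simp_all)
  have "Def (\<lambda>e. \<exists>x\<in>ext (F (\<lambda>n. e (Suc n))). e 0 = H x (\<lambda>n. e (Suc n)))"
    using definable_term_ren[OF H, of "case_nat 0 (\<lambda>n. Suc (Suc n))"]
    by (intro def_bex def_eq definable_term_ren[OF F] term_var) simp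
  then show "Def (\<lambda>e. e 0 \<in> ext (vset ((\<lambda>x. H x (\<lambda>n. e (Suc n))) ` ext (F (\<lambda>n. e (Suc n))))))"
    by (simp add: image_iff)
qed

lemma trm1: assumes "Trm (\<lambda>e. G (e 0))" "Trm F" shows "Trm (\<lambda>e. G (F e))"
proof -
  have "Def (\<lambda>e. e 0 = G (e 1))" using assms(1) by (simp add: definable_term_def)
  then have "Def (\<lambda>e. e 0 = G (F (\<lambda>n. e (Suc n))))"
    by (rule definable2[where R = "\<lambda>x y. x = G y"]) (rule term_var definable_term_ren[OF assms(2)])+
  moreover have "G (F e) \<in> M" if "range e \<subseteq> M" for e
    using definable_term_closed[OF assms(1), of "\<lambda>_. F e"] definable_term_closed[OF assms(2) that] by auto
  ultimately show ?thesis by (simp add: definable_term_def)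
qed

lemma trm2:
  assumes "Trm (\<lambda>e. G (e 0) (e 1))" "Trm F" "Trm H" shows "Trm (\<lambda>e. G (F e) (H e))"
proof -
  have "Def (\<lambda>e. e 0 = G (e 1) (e 2))"
    using assms(1) by (simp add: definable_term_def numeral_2_eq_2)
  then have "Def (\<lambda>e. e 0 = G (F (\<lambda>n. e (Suc n))) (H (\<lambda>n. e (Suc n))))"
    by (rule definable3[where R = "\<lambda>x y z. x = G y z"]) (rule term_var definable_term_ren[OF assms(2)] definable_term_ren[OF assms(3)])+
  moreover have "G (F e) (H e) \<in> M" if "range e \<subseteq> M" for e
    using definable_term_closed[OF assms(1), of "case_nat (F e) (\<lambda>_. H e)"]
      definable_term_closed[OF assms(2) that] definable_term_closed[OF assms(3) that]
    by (auto simp: image_subset_iff split: nat.splits)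
  ultimately show ?thesis by (simp add: definable_term_def)
qed

lemma trm_pair [dfn]: "Trm F \<Longrightarrow> Trm G \<Longrightarrow> Trm (\<lambda>e. vset {F e, G e})"
proof (rule trm2[where G = "\<lambda>x y. vset {x, y}"], rule trmI)
  show "vset {e 0, e 1} \<in> M" if "range e \<subseteq> M" for e :: "nat \<Rightarrow> 'a"
    using that by (intro pair_M) auto
  have "Def (\<lambda>e. e 0 = e 1 \<or> e 0 = e 2)" by (rule dfn)+
  then show "Def (\<lambda>e. e 0 \<in> ext (vset {e (Suc 0), e (Suc 1)}))"
    by (simp add: numeral_2_eq_2)
qed

lemma trm_singleton [dfn]: "Trm F \<Longrightarrow> Trm (\<lambda>e. vset {F e})"
  using trm_pair[of F F] by simp

lemma trm_vpair [dfn]: "Trm F \<Longrightarrow> Trm G \<Longrightarrow> Trm (\<lambda>e. vpair (F e) (G e))"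
  unfolding vpair_def by (rule dfn | assumption)+

lemma trm_vUnion [dfn]: "Trm F \<Longrightarrow> Trm (\<lambda>e. vUnion (F e))"
proof (rule trm1[where G = vUnion], rule trmI)
  show "vUnion (e 0) \<in> M" if "range e \<subseteq> M" for e :: "nat \<Rightarrow> 'a"
    using that by (intro vUnion_M) auto
  have "Def (\<lambda>e. \<exists>y\<in>ext (e 1). e 0 \<in> ext y)" by (rule dfn)+
  then show "Def (\<lambda>e. e 0 \<in> ext (vUnion (e (Suc 0))))" by simp
qed

lemma trm_Un [dfn]: assumes "Trm F" "Trm G" shows "Trm (\<lambda>e. vset (ext (F e) \<union> ext (G e)))"
proof -
  have "vset (ext x \<union> ext y) = vUnion (vset {x, y})" for x y :: 'a
    by (rule ext_inject) simp
  then show ?thesis by (simp add: dfn assms)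
qed

lemma trm_insert [dfn]: assumes "Trm F" "Trm G" shows "Trm (\<lambda>e. vset (insert (F e) (ext (G e))))"
proof -
  have "vset (insert x (ext y)) = vset (ext (vset {x}) \<union> ext y)" for x y :: 'a
    by simp
  then show ?thesis by (simp only:) (rule dfn assms)+
qed

lemma trm_pow [dfn]: "Trm F \<Longrightarrow> Trm (\<lambda>e. pow (F e))"
proof (rule trm1[where G = pow], rule trmI)
  show "pow (e 0) \<in> M" if "range e \<subseteq> M" for e :: "nat \<Rightarrow> 'a"
    using that by (intro pow_M) auto
  have "Def (\<lambda>e. e 0 \<unlhd> e 1)" by (rule dfn)+
  then show "Def (\<lambda>e. e 0 \<in> ext (pow (e (Suc 0))))"
    by (rule definable_cong) (auto simp: ext_pow image_subset_iff)
qed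

lemma trm_UN [dfn]:
  assumes "Trm F" "Trm (\<lambda>e. H (e 0) (\<lambda>n. e (Suc n)))"
  shows "Trm (\<lambda>e. vset (\<Union>x\<in>ext (F e). ext (H x e)))"
proof -
  have "Trm (\<lambda>e. vUnion (vset ((\<lambda>x. H x e) ` ext (F e))))" by (rule dfn assms)+
  then show ?thesis by (simp add: vUnion_def)
qed

lemma trm_lam [dfn]:
  assumes "Trm F" "Trm (\<lambda>e. H (e 0) (\<lambda>n. e (Suc n)))"
  shows "Trm (\<lambda>e. lam (F e) (\<lambda>x. H x e))"
  unfolding lam_def graph_on_def by (rule dfn assms)+

lemma trm_app [dfn]: "Trm F \<Longrightarrow> Trm G \<Longrightarrow> Trm (\<lambda>e. app (F e) (G e))"
  by (rule trm2[where G = app]) (unfold app_def, (rule dfn)+)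

definition cart :: "'a \<Rightarrow> 'a \<Rightarrow> 'a" where
  "cart a b = vset (\<Union>x\<in>ext a. ext (vset ((\<lambda>y. vpair x y) ` ext b)))"

lemma ext_cart: "ext (cart a b) = (\<Union>x\<in>ext a. (\<lambda>y. vpair x y) ` ext b)"
  by (simp add: cart_def)

lemma mem_cart [simp]: "vpair x y \<in> ext (cart a b) \<longleftrightarrow> x \<in> ext a \<and> y \<in> ext b"
  by (auto simp: ext_cart)

lemma trm_cart [dfn]: "Trm F \<Longrightarrow> Trm G \<Longrightarrow> Trm (\<lambda>e. cart (F e) (G e))"
  by (rule trm2[where G = cart]) (unfold cart_def, (rule dfn)+)

lemma trm_if [dfn]:
  assumes "Def R" "Trm F" "Trm G" shows "Trm (\<lambda>e. if R e then F e else G e)"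
proof (rule trmI)
  show "(if R e then F e else G e) \<in> M" if "range e \<subseteq> M" for e
    using that assms(2,3) by (auto intro: definable_term_closed)
  have "Def (\<lambda>e. R (\<lambda>n. e (Suc n)) \<and> e 0 \<in> ext (F (\<lambda>n. e (Suc n))) \<or>
      \<not> R (\<lambda>n. e (Suc n)) \<and> e 0 \<in> ext (G (\<lambda>n. e (Suc n))))"
    by (rule definable_conj definable_disj definable_not def_mem term_var
        definable_term_ren[OF assms(2)] definable_term_ren[OF assms(3)] definable_ren[OF assms(1)])+
  then show "Def (\<lambda>e. e 0 \<in> ext (if R (\<lambda>n. e (Suc n)) then F (\<lambda>n. e (Suc n)) else G (\<lambda>n. e (Suc n))))"
    by (rule definable_cong) auto
qed

subsection \<open>Recursion\<close>

text \<open>Replacement needs a definition of \<open>tcl\<close> over \<open>M\<close>: it is the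
  least transitive superset among the elements of \<open>M\<close>. By the induction hypothesis the
  true closure of each element of \<open>x\<close> is among the competitors, so the two notions
  agree.\<close>

lemma tcl_M: "x \<in> M \<Longrightarrow> tcl x \<in> M"
proof (induction x rule: vmem_induct)
  case (step x)
  define least where "least y d \<longleftrightarrow> y \<unlhd> d \<and> (\<forall>z\<in>ext d. z \<unlhd> d) \<and>
      (\<forall>d'\<in>M. y \<unlhd> d' \<and> (\<forall>z\<in>ext d'. z \<unlhd> d') \<longrightarrow> d \<unlhd> d')" for y d
  have "vset (tcl ` ext x) \<in> M"
  proof (rule replacement[where R = "\<lambda>u v e. least u v" and e = "\<lambda>_. x"])
    show "Def (\<lambda>e. least (e 0) (e 1))"
      unfolding least_def by (rule dfn)+
    show "tcl u \<in> M" if "u \<in> ext x" for u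
      using step that mem_M by blast
    then show "least u v \<longleftrightarrow> v = tcl u" if "u \<in> ext x" "v \<in> M" for u v
    proof -
      have 1: "u \<unlhd> tcl u" "\<forall>z\<in>ext (tcl u). z \<unlhd> tcl u"
        by (rule ext_subset_tcl) (blast intro: tcl_trans)
      have 2: "tcl u \<unlhd> d" if "u \<unlhd> d" "\<forall>z\<in>ext d. z \<unlhd> d" for d
        by (rule tcl_least) (use that in blast)+
      have 3: "tcl u \<in> M" by (rule step.IH) (use that step.prems mem_M in blast)+
      show ?thesis
      proof
        assume L: "least u v"
        then have "v \<unlhd> tcl u" using 1 3 unfolding least_def by blast
        moreover have "tcl u \<unlhd> v" by (rule 2) (use L least_def in blast)+
        ultimately show "v = tcl u" by (intro ext_inject equalityI)
      next
        assume "v = tcl u"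
        then show "least u v" using 1 2 unfolding least_def by simp
      qed
    qed
  qed (use step in auto)
  then have "vset (ext x \<union> ext (vUnion (vset (tcl ` ext x)))) \<in> M"
    using step.prems by (intro in_M) (rule dfn term_const | assumption)+
  also have "vset (ext x \<union> ext (vUnion (vset (tcl ` ext x)))) = tcl x"
    by (rule ext_inject, subst ext_tcl) simp
  finally show ?case .
qed

lemma trm_tcl [dfn]: "Trm F \<Longrightarrow> Trm (\<lambda>e. tcl (F e))"
proof (rule trm1[where G = tcl], rule trmI)
  show "tcl (e 0) \<in> M" if "range e \<subseteq> M" for e :: "nat \<Rightarrow> 'a"
    using that by (intro tcl_M) auto
  have "Def (\<lambda>e. \<forall>d\<in>M. e 1 \<unlhd> d \<and> (\<forall>z\<in>ext d. z \<unlhd> d) \<longrightarrow> e 0 \<in> ext d)"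
    by (rule dfn)+
  then show "Def (\<lambda>e. e 0 \<in> ext (tcl (e (Suc 0))))"
  proof (rule definable_cong)
    fix e :: "nat \<Rightarrow> 'a" assume e: "range e \<subseteq> M"
    show "(\<forall>d\<in>M. e 1 \<unlhd> d \<and> (\<forall>z\<in>ext d. z \<unlhd> d) \<longrightarrow> e 0 \<in> ext d) =
        (e 0 \<in> ext (tcl (e (Suc 0))))" (is "?L = ?R")
    proof
      assume ?L
      moreover have "tcl (e 1) \<in> M" using e by (intro tcl_M) auto
      ultimately show ?R using ext_subset_tcl[of "e 1"] tcl_trans by (metis One_nat_def subsetI)
    next
      assume ?R
      then show ?L using tcl_least[of "e 1"] by (metis One_nat_def subsetD)
    qed
  qed
qed

lemma vrec_unique:
  assumes "\<And>y. y \<in> ext (tcl x) \<Longrightarrow> f y = G y (lam (tcl y) f)" "y \<in> ext (tcl x)"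
  shows "f y = vrec G y"
  using assms(2)
proof (induction y rule: tcl_induct)
  case (step y)
  then have "lam (tcl y) f = lam (tcl y) (vrec G)"
    using tcl_subset by (intro lam_cong) auto
  then show ?case using assms(1)[OF step.prems] vrec[of G y] by simp
qed

lemma trm_vrec:
  assumes G: "Trm (\<lambda>e. G (e 0) (e 1))" shows "Trm F \<Longrightarrow> Trm (\<lambda>e. vrec G (F e))"
proof -
  let ?T = "\<lambda>y. lam (tcl y) (vrec G)"
  \<comment> \<open>The attempts at the recursion. Only \<open>G\<close> occurs here, so the
    relation is definable before anything is known about \<open>vrec G\<close>.\<close>
  define att where "att y f \<longleftrightarrow> f = lam (tcl y) (\<lambda>z. G z (lam (tcl z) (\<lambda>w. app f w)))" for y f
  have G' [dfn]: "Trm F \<Longrightarrow> Trm H \<Longrightarrow> Trm (\<lambda>e. G (F e) (H e))" for F H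
    by (rule trm2[OF G])
  have att: "att y f \<longleftrightarrow> f = ?T y" for y f
  proof
    assume *: "att y f"
    have "app f z = G z (lam (tcl z) (app f))" if "z \<in> ext (tcl y)" for z
      using that by (subst *[unfolded att_def]) simp
    then have "app f z = vrec G z" if "z \<in> ext (tcl y)" for z
      using vrec_unique[of y "app f" G z] that by simp
    then have "lam (tcl z) (app f) = ?T z" if "z \<in> ext (tcl y)" for z
      using that tcl_subset by (intro lam_cong) auto
    then show "f = ?T y"
      by (subst *[unfolded att_def], intro lam_cong) (simp_all add: vrec[symmetric])
  next
    assume "f = ?T y"
    moreover have "lam (tcl z) (app (?T y)) = ?T z" if "z \<in> ext (tcl y)" for z
      by (rule lam_cong[OF refl], rule app_lam) (use that tcl_subset in blast)
    ultimately show "att y f"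
      unfolding att_def by (simp add: vrec[symmetric] cong: lam_cong)
  qed
  have def_att: "Def (\<lambda>e. att (e 0) (e 1))"
    unfolding att_def by (rule dfn)+
  have T_M: "?T x \<in> M" if "x \<in> M" for x
    using that
  proof (induction x rule: vmem_induct)
    case (step x)
    \<comment> \<open>The attempt on \<open>tcl y\<close> prolonged by the value at \<open>y\<close>
      itself; for \<open>y\<close> in \<open>x\<close> the domains of these have union
      \<open>tcl x\<close>.\<close>
    let ?S = "\<lambda>y. vset (insert (vpair y (G y (?T y))) (ext (?T y)))"
    have T: "?T u \<in> M" if "u \<in> ext x" for u
      using step that mem_M by blast
    have "vset (?S ` ext x) \<in> M"
    proof (rule replacement[where e = "\<lambda>_. x" and R =
          "\<lambda>u v e. \<exists>f\<in>M. att u f \<and> v = vset (insert (vpair u (G u f)) (ext f))"])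
      show "Def (\<lambda>e. \<exists>f\<in>M. att (e 0) f \<and> e 1 = vset (insert (vpair (e 0) (G (e 0) f)) (ext f)))"
        by (rule dfn definable2[OF def_att])+
      show "?S u \<in> M" if "u \<in> ext x" for u
        using T[OF that] mem_M[OF that step.prems] by (intro in_M) (rule dfn term_const | assumption)+
      show "(\<exists>f\<in>M. att u f \<and> v = vset (insert (vpair u (G u f)) (ext f))) \<longleftrightarrow> v = ?S u"
        if "u \<in> ext x" for u v
        using T[OF that] by (auto simp: att)
    qed (use step in auto)
    then have "vUnion (vset (?S ` ext x)) \<in> M" by (rule vUnion_M)
    also have "vUnion (vset (?S ` ext x)) = ?T x"
      by (rule ext_inject) (simp add: vrec[symmetric], subst (2) ext_tcl, auto)
    finally show ?case .
  qed
  have "Trm (\<lambda>e. ?T (e 0))"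
    unfolding definable_term_def
  proof
    show "Def (\<lambda>e. e 0 = ?T (e (Suc 0)))"
      using definable_ren[OF def_att, of "case_nat 1 (\<lambda>_. 0)"] by (simp add: att)
  qed (auto intro: T_M)
  then have [dfn]: "Trm F \<Longrightarrow> Trm (\<lambda>e. ?T (F e))" for F
    by (rule trm1)
  show "Trm F \<Longrightarrow> Trm (\<lambda>e. vrec G (F e))"
    by (subst vrec) (rule dfn | assumption)+
qed

end

section \<open>Ordinals\<close>

lemma ordinal_elem: "ordinal a \<Longrightarrow> x \<in> ext a \<Longrightarrow> ordinal x"
  unfolding ordinal_def by blast

lemma ordinal_trans: "ordinal a \<Longrightarrow> x \<in> ext a \<Longrightarrow> y \<in> ext x \<Longrightarrow> y \<in> ext a"
  unfolding ordinal_def by blast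

lemma ordinal_linear:
  "ordinal a \<Longrightarrow> ordinal b \<Longrightarrow> a \<in> ext b \<or> a = b \<or> b \<in> ext a"
proof (induction a arbitrary: b rule: vmem_induct)
  case (step a)
  note IHa = step.IH
  from \<open>ordinal b\<close> show ?case
  proof (induction b rule: vmem_induct)
    case (step b)
    have a: "x \<in> ext b \<or> x = b \<or> b \<in> ext x" if "x \<in> ext a" for x
      using IHa[OF that] ordinal_elem[OF \<open>ordinal a\<close> that] step.prems by blast
    have b: "a \<in> ext y \<or> a = y \<or> y \<in> ext a" if "y \<in> ext b" for y
      using step.IH[OF that] ordinal_elem[OF step.prems that] by blast
    show ?case
    proof (rule ccontr)
      assume neg: "\<not> (a \<in> ext b \<or> a = b \<or> b \<in> ext a)"
      have "a \<unlhd> b"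
        using a neg ordinal_trans[OF \<open>ordinal a\<close>] by blast
      moreover have "b \<unlhd> a"
        using b neg ordinal_trans[OF step.prems] by blast
      ultimately show False using neg ext_inject by blast
    qed
  qed
qed

lemma ext_empty_iff: "ext y = {} \<longleftrightarrow> y = vset {}"
  by (metis vset_ext ext_vset_small small_empty)

lemma vUnion_vnat_Suc [simp]: "vUnion (vnat (Suc n)) = vnat n"
  by (rule ext_inject) (auto simp: ext_vnat)

lemma vnat_0_iff [simp]: "vnat n = vset {} \<longleftrightarrow> n = 0"
  using vnat_inject[of n 0] by (simp del: vnat_inject)

section \<open>Choice and recursion on the natural numbers in a transitive model\<close>

context ctm
begin

section \<open>Comparison of cardinalities in the model\<close>

abbreviation card_le :: "'a \<Rightarrow> 'a \<Rightarrow> bool" (infix "\<lesssim>" 50) where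
  "a \<lesssim> b \<equiv> card_le_in M (ext a) (ext b)"

lemma coded_lam: "coded_in M (graph_on (ext a) f) \<longleftrightarrow> lam a f \<in> M"
  unfolding coded_in_def lam_def using vset_ext ext_lam[unfolded lam_def] graph_on_def by metis

lemma card_leI:
  "lam a f \<in> M \<Longrightarrow> inj_on f (ext a) \<Longrightarrow> f ` ext a \<subseteq> B \<Longrightarrow> card_le_in M (ext a) B"
  unfolding card_le_in_def coded_lam by blast

lemma card_leD:
  "card_le_in M (ext a) B \<Longrightarrow> \<exists>f. lam a f \<in> M \<and> inj_on f (ext a) \<and> (\<forall>x\<in>ext a. f x \<in> B)"
  unfolding card_le_in_def coded_lam by blast

lemma card_le_mono: "card_le_in M A B \<Longrightarrow> B \<subseteq> C \<Longrightarrow> card_le_in M A C"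
  unfolding card_le_in_def by blast

lemma lam_app_M: "a \<in> M \<Longrightarrow> g \<in> M \<Longrightarrow> lam a (app g) \<in> M"
  by (rule in_M) (rule dfn term_const | assumption)+

lemma lam_inj_app: "inj_on f (ext a) \<Longrightarrow> inj_on (app (lam a f)) (ext a)"
  by (auto simp: inj_on_def)

text \<open>Replacing the HOL injection by an element of \<open>M\<close> makes the comparison a
  first-order statement over \<open>M\<close>.\<close>

lemma card_le_iff:
  "a \<lesssim> b \<longleftrightarrow>
     (\<exists>f\<in>M. f = lam a (\<lambda>x. app f x) \<and> (\<forall>x\<in>ext a. app f x \<in> ext b) \<and>
        (\<forall>x\<in>ext a. \<forall>y\<in>ext a. app f x = app f y \<longrightarrow> x = y))" (is "?L = ?R")
proof
  assume ?L
  then obtain f where f: "lam a f \<in> M" "inj_on f (ext a)" "\<And>x. x \<in> ext a \<Longrightarrow> f x \<in> ext b"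
    using card_leD by blast
  then show ?R by (intro bexI[of _ "lam a f"]) (auto simp: inj_on_def)
next
  assume ?R
  then obtain f where "f \<in> M" "f = lam a (app f)" "\<forall>x\<in>ext a. app f x \<in> ext b"
      "\<forall>x\<in>ext a. \<forall>y\<in>ext a. app f x = app f y \<longrightarrow> x = y" by blast
  then show ?L by (intro card_leI[where f = "app f"]) (auto simp: inj_on_def)
qed

lemma def_card_le [dfn]:
  "Trm F \<Longrightarrow> Trm G \<Longrightarrow> Def (\<lambda>e. F e \<lesssim> G e)"
  by (rule definable2[where R = "\<lambda>x y. x \<lesssim> y"])
    (unfold card_le_iff, (rule dfn)+)

lemma card_le_subset:
  assumes "a \<in> M" "a \<unlhd> b" shows "a \<lesssim> b"
proof (rule card_leI[where f = "\<lambda>x. x"])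
  show "lam a (\<lambda>x. x) \<in> M" by (rule in_M) (rule dfn term_const assms)+
qed (use assms in auto)

lemma card_le_trans:
  assumes "a \<in> M" "a \<lesssim> b" "b \<lesssim> c"
  shows "a \<lesssim> c"
proof -
  obtain f where f: "lam a f \<in> M" "inj_on f (ext a)" "\<And>x. x \<in> ext a \<Longrightarrow> f x \<in> ext b"
    using card_leD[OF assms(2)] by blast
  obtain g where g: "lam b g \<in> M" "inj_on g (ext b)" "\<And>x. x \<in> ext b \<Longrightarrow> g x \<in> ext c"
    using card_leD[OF assms(3)] by blast
  have "lam a (\<lambda>x. app (lam b g) (app (lam a f) x)) \<in> M"
    by (rule in_M) (rule term_const[OF f(1)] term_const[OF g(1)] term_const[OF assms(1)] dfn)+
  also have "lam a (\<lambda>x. app (lam b g) (app (lam a f) x)) = lam a (\<lambda>x. g (f x))"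
    by (rule lam_cong) (use f in auto)
  finally show ?thesis
    by (rule card_leI) (use f g in \<open>auto simp: inj_on_def\<close>)
qed

text \<open>The axiom of infinity provides an inductive set, and \<open>c\<close> is the
  intersection of all inductive sets in \<open>M\<close>. A membership-minimal element of
  \<open>c\<close> that is not a standard number could be removed and would leave a smaller
  inductive set in \<open>M\<close>.\<close>

lemma omega: "vomega \<in> M \<and> ext (vomega :: 'a) = range vnat"
proof -
  define ind where "ind j \<longleftrightarrow> vset {} \<in> ext j \<and> (\<forall>y\<in>ext j. vset (insert y (ext y)) \<in> ext j)" for j :: 'a
  obtain W where W: "W \<in> M" "\<exists>e\<in>M. e \<in> ext W \<and> (\<forall>w\<in>M. w \<notin> ext e)"
      "\<forall>y\<in>M. y \<in> ext W \<longrightarrow> (\<exists>s\<in>M. s \<in> ext W \<and> (\<forall>w\<in>M. w \<in> ext s \<longleftrightarrow> w \<in> ext y \<or> w = y))"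
    using ZFC unfolding models_ZFC_def ax_infinity_def mem_ext by blast
  have "ind W"
    unfolding ind_def
  proof
    obtain e where "e \<in> M" "e \<in> ext W" "\<forall>w\<in>M. w \<notin> ext e" using W(2) by blast
    moreover then have "e = vset {}" using mem_M by (intro ext_inject) auto
    ultimately show "vset {} \<in> ext W" by simp
    show "\<forall>y\<in>ext W. vset (insert y (ext y)) \<in> ext W"
    proof
      fix y assume y: "y \<in> ext W"
      then have "y \<in> M" using W(1) mem_M by blast
      then obtain s where s: "s \<in> M" "s \<in> ext W" "\<forall>w\<in>M. w \<in> ext s \<longleftrightarrow> w \<in> ext y \<or> w = y"
        using W(3) y by blast
      have "ext s = ext (vset (insert y (ext y)))"
        using s mem_M \<open>y \<in> M\<close> by auto
      then show "vset (insert y (ext y)) \<in> ext W"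
        using s(2) ext_inject by metis
    qed
  qed
  have nat: "vnat n \<in> ext J" if "ind J" for J n
    using that by (induction n) (auto simp: ind_def vnat.simps)
  then have small: "small (range (vnat :: nat \<Rightarrow> 'a))"
    using \<open>ind W\<close> by (intro small_subset[OF small_ext, of _ W]) auto
  define c where "c = vset {x \<in> ext W. \<forall>J\<in>M. ind J \<longrightarrow> x \<in> ext J}"
  have ext_c: "ext c = {x \<in> ext W. \<forall>J\<in>M. ind J \<longrightarrow> x \<in> ext J}"
    by (simp add: c_def)
  have c: "c \<in> M"
    unfolding c_def ind_def by (rule in_M) (rule dfn term_const W(1) empty_M)+
  have ind_c: "ind c"
    using \<open>ind W\<close> unfolding ind_def ext_c by blast
  have "ext c = range vnat"
  proof (rule ccontr)
    assume "ext c \<noteq> range vnat"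
    then obtain x0 where "x0 \<in> ext c - range vnat" using nat[OF ind_c] by blast
    then obtain x where x: "x \<in> ext c - range vnat" "\<And>y. y \<in> ext x \<Longrightarrow> y \<notin> ext c - range vnat"
      using wfE_min[OF wf_vmem, of x0 "ext c - range vnat"] by (auto simp: mem_ext)
    let ?c = "vset {y \<in> ext c. y \<noteq> x}"
    have "?c \<in> M"
      by (rule in_M) (rule term_const[OF c] term_const[OF mem_M[OF _ c]] dfn | use x in blast)+
    moreover have "ind ?c"
      unfolding ind_def
    proof
      show "vset {} \<in> ext ?c"
        using ind_c x(1) rangeI[of vnat 0] by (auto simp: ind_def)
      show "\<forall>y\<in>ext ?c. vset (insert y (ext y)) \<in> ext ?c"
      proof
        fix y assume y: "y \<in> ext ?c"
        have "vset (insert y (ext y)) \<noteq> x"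
        proof
          assume eq: "vset (insert y (ext y)) = x"
          then have "y \<in> ext x" by auto
          then have "y \<in> range vnat" using x(2) y by auto
          then show False using x(1) eq vnat.simps(2) by (metis DiffD2 imageE rangeI)
        qed
        then show "vset (insert y (ext y)) \<in> ext ?c" using y ind_c by (auto simp: ind_def)
      qed
    qed
    ultimately have "x \<in> ext ?c" using x(1) ext_c by blast
    then show False by simp
  qed
  then have "c = vomega" unfolding vomega_def by (metis vset_ext)
  then show ?thesis using c \<open>ext c = range vnat\<close> by simp
qed

lemmas omega_M = omega[THEN conjunct1] and ext_omega [simp] = omega[THEN conjunct2]

lemma vnat_M: "vnat n \<in> M"
  using mem_M[OF _ omega_M] by simp

lemma choice_function:
  assumes x: "x \<in> M" "\<And>y. y \<in> ext x \<Longrightarrow> ext y \<noteq> {}"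
  shows "\<exists>f\<in>M. \<forall>y\<in>ext x. app f y \<in> ext y"
proof -
  \<comment> \<open>The axiom of choice speaks of disjoint families, so the elements of each
    \<open>y\<close> are tagged with \<open>y\<close>.\<close>
  let ?d = "\<lambda>y. vset ((\<lambda>w. vpair y w) ` ext y)"
  let ?D = "vset (?d ` ext x)"
  have D: "?D \<in> M" by (rule in_M) (rule dfn term_const x(1))+
  have ac: "ax_choice M" using ZFC by (simp add: models_ZFC_def)
  have "(\<forall>y\<in>M. y \<in> ext ?D \<longrightarrow> (\<exists>w\<in>M. w \<in> ext y)) \<and>
        (\<forall>y\<in>M. \<forall>z\<in>M. y \<in> ext ?D \<and> z \<in> ext ?D \<and> y \<noteq> z \<longrightarrow> \<not> (\<exists>w\<in>M. w \<in> ext y \<and> w \<in> ext z))"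
  proof (intro conjI ballI impI)
    fix y assume "y \<in> M" "y \<in> ext ?D"
    then show "\<exists>w\<in>M. w \<in> ext y" using x(2) mem_M[OF _ \<open>y \<in> M\<close>] by fastforce
  qed auto
  from mp[OF ac[unfolded ax_choice_def mem_ext, THEN bspec, OF D] this]
  obtain c where c: "c \<in> M"
      "\<forall>y\<in>M. y \<in> ext ?D \<longrightarrow> (\<exists>!w. w \<in> M \<and> w \<in> ext y \<and> w \<in> ext c)"
    by (elim bexE)
  let ?f = "\<lambda>y. vUnion (vset {w \<in> ext y. vpair y w \<in> ext c})"
  have "?f y \<in> ext y" if y: "y \<in> ext x" for y
  proof -
    have d: "?d y \<in> ext ?D" using y by simp
    have "\<exists>!w. w \<in> M \<and> w \<in> ext (?d y) \<and> w \<in> ext c"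
      by (rule c(2)[rule_format, OF mem_M[OF d D] d])
    then obtain z where z: "z \<in> ext (?d y)" "z \<in> ext c"
        "\<And>w. w \<in> M \<Longrightarrow> w \<in> ext (?d y) \<Longrightarrow> w \<in> ext c \<Longrightarrow> w = z"
      by (elim ex1E) blast
    obtain w where w: "z = vpair y w" "w \<in> ext y" using z(1) by auto
    have "w' = w" if "w' \<in> ext y" "vpair y w' \<in> ext c" for w'
      using z(3)[OF mem_M[OF that(2) c(1)]] that w(1) by simp
    moreover have "vpair y w \<in> ext c" using w z(2) by simp
    ultimately have "{v \<in> ext y. vpair y v \<in> ext c} = {w}"
      using w(2) by blast
    then show ?thesis using w(2) by (simp add: vUnion_def)
  qed
  moreover have "lam x ?f \<in> M"
    by (rule in_M) (rule dfn term_const x(1) c(1))+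
  ultimately show ?thesis by (intro bexI[of _ "lam x ?f"]) auto
qed

lemma choice_rel:
  assumes a: "a \<in> M" and b: "b \<in> M" and R: "Def (\<lambda>e. R (e 0) (e 1))"
    and ex: "\<And>x. x \<in> ext a \<Longrightarrow> \<exists>y\<in>ext b. R x y"
  obtains f where "lam a f \<in> M" "\<And>x. x \<in> ext a \<Longrightarrow> f x \<in> ext b \<and> R x (f x)"
proof -
  let ?s = "\<lambda>x. vset {y \<in> ext b. R x y}"
  have "vset (?s ` ext a) \<in> M"
    by (rule in_M) (rule dfn definable2[OF R] term_const a b)+
  moreover have "ext y \<noteq> {}" if "y \<in> ext (vset (?s ` ext a))" for y
  proof -
    from that obtain x where "x \<in> ext a" "y = ?s x" by auto
    then show ?thesis using ex by auto
  qed
  ultimately obtain g where g: "g \<in> M" "\<And>y. y \<in> ext (vset (?s ` ext a)) \<Longrightarrow> app g y \<in> ext y"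
    using choice_function by blast
  have "lam a (\<lambda>x. app g (?s x)) \<in> M"
    by (rule in_M) (rule dfn definable2[OF R] term_const a b g)+
  moreover have "app g (?s x) \<in> ext b \<and> R x (app g (?s x))" if "x \<in> ext a" for x
    using g(2)[of "?s x"] that by simp
  ultimately show ?thesis using that by blast
qed

lemma omega_rec:
  assumes a: "a \<in> M" and g: "Trm (\<lambda>e. g (e 0) (e 1))"
  shows "\<exists>F. (\<forall>T. Trm T \<longrightarrow> Trm (\<lambda>e. F (T e))) \<and> F (vnat 0) = a \<and>
    (\<forall>n. F (vnat (Suc n)) = g (vnat n) (F (vnat n)))"
proof -
  \<comment> \<open>On a successor number, \<open>vUnion\<close> is the predecessor.\<close>
  define G where "G x h = (if x = vset {} then a else g (vUnion x) (app h (vUnion x)))" for x h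
  have G: "Trm (\<lambda>e. G (e 0) (e 1))"
    unfolding G_def by (rule dfn term_const a trm2[OF g] empty_M)+
  show ?thesis
  proof (intro exI[of _ "vrec G"] conjI allI impI)
    show "Trm T \<Longrightarrow> Trm (\<lambda>e. vrec G (T e))" for T by (rule trm_vrec[OF G])
    show "vrec G (vnat 0) = a" by (subst vrec) (simp add: G_def)
    have "(vnat n :: 'a) \<in> ext (tcl (vnat (Suc n)))" for n
      by (rule subsetD[OF ext_subset_tcl]) simp
    then show "vrec G (vnat (Suc n)) = g (vnat n) (vrec G (vnat n))" for n
      by (subst vrec) (simp add: G_def)
  qed
qed

text \<open>A single choice function on all pairs of a number and a state turns the dependent
  choices into plain recursion.\<close>

lemma omega_choice:
  assumes Y: "Y \<in> M" and s: "s \<in> ext Y" and R: "Def (\<lambda>e. R (e 0) (e 1) (e 2))"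
    and ex: "\<And>n x. x \<in> ext Y \<Longrightarrow> \<exists>y\<in>ext Y. R (vnat n) x y"
  obtains F where "lam vomega F \<in> M" "F (vnat 0) = s"
    "\<And>n. F (vnat n) \<in> ext Y \<and> R (vnat n) (F (vnat n)) (F (vnat (Suc n)))"
proof -
  obtain c where c: "lam (cart vomega Y) c \<in> M"
    "\<And>z. z \<in> ext (cart vomega Y) \<Longrightarrow>
      c z \<in> ext Y \<and> (\<exists>n\<in>ext vomega. \<exists>x\<in>ext Y. z = vpair n x \<and> R n x (c z))"
  proof (rule choice_rel[where R = "\<lambda>z y. \<exists>n\<in>ext vomega. \<exists>x\<in>ext Y. z = vpair n x \<and> R n x y"])
    show "cart vomega Y \<in> M"
      by (rule in_M) (rule dfn term_const omega_M Y)+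
    show "Def (\<lambda>e. \<exists>n\<in>ext vomega. \<exists>x\<in>ext Y. e 0 = vpair n x \<and> R n x (e 1))"
      by (rule dfn definable3[OF R] term_const omega_M Y)+
    show "\<exists>y\<in>ext Y. \<exists>n\<in>ext vomega. \<exists>x\<in>ext Y. z = vpair n x \<and> R n x y"
      if "z \<in> ext (cart vomega Y)" for z
      using that ex by (fastforce simp: ext_cart)
  qed (rule Y, erule that, blast)
  let ?g = "\<lambda>n x. app (lam (cart vomega Y) c) (vpair n x)"
  have g: "Trm (\<lambda>e. ?g (e 0) (e 1))" by (rule term_const[OF c(1)] dfn)+
  obtain F where F: "\<And>T. Trm T \<Longrightarrow> Trm (\<lambda>e. F (T e))" "F (vnat 0) = s"
    "\<And>n. F (vnat (Suc n)) = ?g (vnat n) (F (vnat n))"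
    using omega_rec[OF mem_M[OF s Y] g] by blast
  have Y': "F (vnat n) \<in> ext Y" for n
    by (induction n) (use s F c(2) in \<open>simp_all\<close>)
  have "R (vnat n) (F (vnat n)) (F (vnat (Suc n)))" for n
    using c(2)[of "vpair (vnat n) (F (vnat n))"] Y' F(3)[of n] by auto
  moreover have "lam vomega F \<in> M"
    by (rule in_M) (rule dfn F(1) term_const omega_M)+
  ultimately show thesis using that Y' F(2) by blast
qed

text \<open>A choice function for the nonempty subsets of \<open>Y\<close> in \<open>M\<close> is
  fixed in advance, and the selection is then a recursion along the elements of \<open>k\<close>.
  The relation \<open>Q\<close> sees the whole history \<open>lam \<alpha> f\<close>.\<close>

lemma dependent_choice:
  assumes k: "k \<in> M" "\<And>\<alpha>. \<alpha> \<in> ext k \<Longrightarrow> \<alpha> \<unlhd> k" and Y: "Y \<in> M"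
    and Q: "Def (\<lambda>e. Q (e 0) (e 1) (e 2))"
    and ex: "\<And>\<alpha> f. \<alpha> \<in> ext k \<Longrightarrow> lam \<alpha> f \<in> M \<Longrightarrow>
      (\<And>\<beta>. \<beta> \<in> ext \<alpha> \<Longrightarrow> f \<beta> \<in> ext Y \<and> Q \<beta> (lam \<beta> f) (f \<beta>)) \<Longrightarrow> \<exists>y\<in>ext Y. Q \<alpha> (lam \<alpha> f) y"
  obtains f where "lam k f \<in> M" "\<And>\<alpha>. \<alpha> \<in> ext k \<Longrightarrow> f \<alpha> \<in> ext Y \<and> Q \<alpha> (lam \<alpha> f) (f \<alpha>)"
proof -
  let ?x = "vset {y \<in> ext (pow Y). y \<noteq> vset {}}"
  have "?x \<in> M" by (rule in_M) (rule dfn term_const Y empty_M)+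
  moreover have "ext y \<noteq> {}" if "y \<in> ext ?x" for y
    using that by (simp add: ext_empty_iff)
  ultimately obtain ch where ch: "ch \<in> M" "\<And>y. y \<in> ext ?x \<Longrightarrow> app ch y \<in> ext y"
    using choice_function by blast
  let ?s = "\<lambda>\<alpha> h. vset {y \<in> ext Y. Q \<alpha> h y}"
  \<comment> \<open>The recursion supplies the values on all of \<open>tcl \<alpha>\<close>; they
    are cut back to \<open>\<alpha>\<close>, the history that \<open>Q\<close> expects.\<close>
  define G where "G \<alpha> h = app ch (?s \<alpha> (lam \<alpha> (\<lambda>x. app h x)))" for \<alpha> h
  have "Trm (\<lambda>e. G (e 0) (e 1))"
    unfolding G_def by (rule dfn definable3[OF Q] term_const ch Y)+
  then have F: "Trm T \<Longrightarrow> Trm (\<lambda>e. vrec G (T e))" for T by (rule trm_vrec)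
  have lamF: "lam \<alpha> (vrec G) \<in> M" if "\<alpha> \<in> M" for \<alpha>
    by (rule in_M) (rule dfn F term_const that)+
  have "vrec G \<alpha> \<in> ext Y \<and> Q \<alpha> (lam \<alpha> (vrec G)) (vrec G \<alpha>)" if "\<alpha> \<in> ext k" for \<alpha>
    using that
  proof (induction \<alpha> rule: vmem_induct)
    case (step \<alpha>)
    have "\<alpha> \<in> M" using step k mem_M by blast
    have "lam \<alpha> (app (lam (tcl \<alpha>) (vrec G))) = lam \<alpha> (vrec G)"
      using ext_subset_tcl by (intro lam_cong refl app_lam) blast
    then have eq: "vrec G \<alpha> = app ch (?s \<alpha> (lam \<alpha> (vrec G)))"
      by (subst vrec) (simp add: G_def)
    obtain y where y: "y \<in> ext Y" "Q \<alpha> (lam \<alpha> (vrec G)) y"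
      using ex[OF step.prems lamF[OF \<open>\<alpha> \<in> M\<close>]] step k(2) by blast
    have "?s \<alpha> (lam \<alpha> (vrec G)) \<in> M"
      by (rule in_M) (rule dfn definable3[OF Q] term_const lamF Y \<open>\<alpha> \<in> M\<close>)+
    moreover have "ext (?s \<alpha> (lam \<alpha> (vrec G))) \<noteq> {}" using y by auto
    ultimately have "?s \<alpha> (lam \<alpha> (vrec G)) \<in> {y \<in> ext (pow Y). y \<noteq> vset {}}"
      by (auto simp: ext_pow[OF Y] simp flip: ext_empty_iff)
    then have "?s \<alpha> (lam \<alpha> (vrec G)) \<in> ext ?x"
      by (subst ext_vset_small) (rule small_Collect small_ext | assumption)+
    from ch(2)[OF this] show ?case unfolding eq by simp
  qed
  then show thesis using that lamF[OF k(1)] by blast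
qed

end

section \<open>Regular cardinals\<close>

locale regular = ctm +
  fixes k :: 'a
  assumes regular: "regular_in M k"
begin

lemma k_subset: "\<alpha> \<in> ext k \<Longrightarrow> \<alpha> \<unlhd> k"
  using regular by (auto simp: regular_in_def infinite_cardinal_in_def cardinal_in_def ordinal_def)

lemma k_M: "k \<in> M" and ordinal_k: "ordinal k" and vnat_k: "vnat n \<in> ext k"
  using regular by (auto simp: regular_in_def infinite_cardinal_in_def cardinal_in_def)

lemma bounded:
  assumes "c \<in> ext k" "lam c f \<in> M" "\<And>y. y \<in> ext c \<Longrightarrow> f y \<in> ext k"
  obtains x where "x \<in> ext k" "\<And>y. y \<in> ext c \<Longrightarrow> f y \<in> ext x"
proof -
  have "\<not> has_cofinal_map_in M c k"
    using regular assms(1) by (simp add: regular_in_def cofinality_in_def)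
  then have "\<not> (\<forall>x\<in>ext k. \<exists>y\<in>ext c. x = f y \<or> x \<in> ext (f y))"
    using assms(2,3) unfolding has_cofinal_map_in_def coded_lam mem_ext by blast
  then obtain x where "x \<in> ext k" "\<And>y. y \<in> ext c \<Longrightarrow> x \<noteq> f y \<and> x \<notin> ext (f y)" by blast
  then show thesis
    using that assms(3) ordinal_linear ordinal_elem[OF ordinal_k] by metis
qed

lemma no_surjection:
  assumes "c \<in> ext k" "lam c f \<in> M" shows "\<not> ext k \<subseteq> f ` ext c"
proof
  assume surj: "ext k \<subseteq> f ` ext c"
  \<comment> \<open>\<open>bounded\<close> asks for a map into \<open>k\<close>, so stray values are
    replaced by 0.\<close>
  let ?g = "\<lambda>y. if app (lam c f) y \<in> ext k then app (lam c f) y else vnat 0"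
  have "c \<in> M" using assms(1) k_M mem_M by blast
  then have g: "lam c ?g \<in> M"
    by (intro in_M) (rule term_const[OF assms(2)] dfn term_const vnat_M k_M | assumption)+
  have "?g y \<in> ext k" for y using vnat_k[of 0] by simp
  then obtain x where x: "x \<in> ext k" "\<And>y. y \<in> ext c \<Longrightarrow> ?g y \<in> ext x"
    using bounded[OF assms(1) g] by blast
  then obtain y where "y \<in> ext c" "x = f y" using surj by blast
  then show False using x vmem_irrefl[of x] by force
qed

text \<open>A strictly increasing map from \<open>k\<close> into \<open>E\<close> is chosen value by
  value: by regularity the earlier values are bounded in \<open>k\<close>, and \<open>E\<close> has
  an element beyond the bound.\<close>

lemma unbounded_card:
  assumes E: "E \<in> M" "E \<unlhd> k"
    and unbd: "\<And>x. x \<in> ext k \<Longrightarrow> \<exists>y\<in>ext E. y = x \<or> x \<in> ext y"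
  shows "k \<lesssim> E"
proof -
  obtain f where f: "lam k f \<in> M"
    "\<And>\<alpha>. \<alpha> \<in> ext k \<Longrightarrow> f \<alpha> \<in> ext E \<and> (\<forall>\<beta>\<in>ext \<alpha>. app (lam \<alpha> f) \<beta> \<in> ext (f \<alpha>))"
  proof (rule dependent_choice[where Q = "\<lambda>\<alpha> h y. \<forall>\<beta>\<in>ext \<alpha>. app h \<beta> \<in> ext y", OF k_M k_subset E(1)])
    show "Def (\<lambda>e. \<forall>\<beta>\<in>ext (e 0). app (e 1) \<beta> \<in> ext (e 2))" by (rule dfn)+
    fix \<alpha> f
    assume *: "\<alpha> \<in> ext k" "lam \<alpha> f \<in> M"
      "\<And>\<beta>. \<beta> \<in> ext \<alpha> \<Longrightarrow> f \<beta> \<in> ext E \<and> (\<forall>\<beta>'\<in>ext \<beta>. app (lam \<beta> f) \<beta>' \<in> ext (f \<beta>))"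
    then obtain x where x: "x \<in> ext k" "\<And>y. y \<in> ext \<alpha> \<Longrightarrow> f y \<in> ext x"
      using bounded[OF *(1,2)] E(2) by blast
    obtain y where y: "y \<in> ext E" "y = x \<or> x \<in> ext y" using unbd[OF x(1)] by blast
    then have "ordinal y" using E ordinal_elem[OF ordinal_k] by blast
    then show "\<exists>y\<in>ext E. \<forall>\<beta>\<in>ext \<alpha>. app (lam \<alpha> f) \<beta> \<in> ext y"
      using x(2) y ordinal_trans by (intro bexI[of _ y]) (auto; blast)
  qed (assumption, erule that, blast)
  have "f \<beta> \<in> ext (f \<alpha>)" if "\<alpha> \<in> ext k" "\<beta> \<in> ext \<alpha>" for \<alpha> \<beta>
    using f(2)[OF that(1)] that(2) by simp
  then have "inj_on f (ext k)"
    using ordinal_linear ordinal_elem[OF ordinal_k] vmem_irrefl by (metis inj_onI)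
  then show ?thesis using f by (intro card_leI) auto
qed

text \<open>Let \<open>e\<close> list \<open>k\<close> many elements of the union. If no
  \<open>B i\<close> is large, the positions that \<open>e\<close> sends into a given
  \<open>B i\<close> are bounded in \<open>k\<close>. These bounds, indexed by \<open>c\<close>
  through the injection \<open>j\<close>, have a common bound \<open>x\<close> by regularity, and
  then \<open>e x\<close> has no \<open>B i\<close> to belong to.\<close>

lemma pigeonhole:
  assumes I: "I \<in> M" "c \<in> ext k" "I \<lesssim> c"
    and B: "Trm (\<lambda>e. B (e 0))"
    and le: "card_le_in M (ext k) (\<Union>i\<in>ext I. ext (B i))"
  shows "\<exists>i\<in>ext I. k \<lesssim> B i"
proof (rule ccontr)
  assume neg: "\<not> ?thesis"
  obtain e where e: "lam k e \<in> M" "inj_on e (ext k)"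
      "\<And>x. x \<in> ext k \<Longrightarrow> e x \<in> (\<Union>i\<in>ext I. ext (B i))"
    using card_leD[OF le] by blast
  obtain j where j: "lam I j \<in> M" "inj_on j (ext I)" "\<And>i. i \<in> ext I \<Longrightarrow> j i \<in> ext c"
    using card_leD[OF I(3)] by blast
  let ?E = "\<lambda>i. vset {\<beta> \<in> ext k. app (lam k e) \<beta> \<in> ext (B i)}"
  have bound: "\<exists>x\<in>ext k. \<forall>y\<in>ext (?E i). y \<in> ext x" if i: "i \<in> ext I" for i
  proof (rule ccontr)
    assume unb: "\<not> ?thesis"
    have iM: "i \<in> M" using i I mem_M by blast
    have EM: "?E i \<in> M"
      by (rule in_M) (rule term_const[OF e(1)] dfn trm1[OF B] term_const k_M iM)+
    have "k \<lesssim> ?E i"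
    proof (rule unbounded_card[OF EM])
      show "\<exists>y\<in>ext (?E i). y = x \<or> x \<in> ext y" if "x \<in> ext k" for x
      proof -
        from unb that obtain y where "y \<in> ext (?E i)" "y \<notin> ext x" by blast
        moreover then have "y \<in> ext k" by simp
        ultimately show ?thesis
          using ordinal_linear[of x y] ordinal_elem[OF ordinal_k] that by blast
      qed
    qed auto
    moreover have "?E i \<lesssim> B i"
    proof (rule card_leI[where f = "app (lam k e)"])
      show "lam (?E i) (app (lam k e)) \<in> M" by (rule lam_app_M[OF EM e(1)])
    qed (use e(2) in \<open>auto simp: inj_on_def\<close>)
    ultimately show False using neg i card_le_trans[OF k_M] by blast
  qed
  have cM: "c \<in> M" using I(2) k_M mem_M by blast
  obtain f where f: "lam c f \<in> M" "\<And>d. d \<in> ext c \<Longrightarrow> f d \<in> ext k \<and>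
      (\<forall>i\<in>ext I. app (lam I j) i = d \<longrightarrow> (\<forall>y\<in>ext (?E i). y \<in> ext (f d)))"
  proof (rule choice_rel[OF cM k_M, where R =
        "\<lambda>d x. \<forall>i\<in>ext I. app (lam I j) i = d \<longrightarrow> (\<forall>y\<in>ext (?E i). y \<in> ext x)"])
    show "Def (\<lambda>ea. \<forall>i\<in>ext I. app (lam I j) i = ea 0 \<longrightarrow> (\<forall>y\<in>ext (?E i). y \<in> ext (ea 1)))"
      by (rule term_const[OF e(1)] term_const[OF j(1)] dfn trm1[OF B] term_const k_M I(1))+
    show "\<exists>x\<in>ext k. \<forall>i\<in>ext I. app (lam I j) i = d \<longrightarrow> (\<forall>y\<in>ext (?E i). y \<in> ext x)"
      if "d \<in> ext c" for d
    proof (cases "\<exists>i\<in>ext I. j i = d")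
      case True
      then obtain i where i: "i \<in> ext I" "j i = d" by blast
      then have "i' = i" if "i' \<in> ext I" "app (lam I j) i' = d" for i'
        using that j(2) by (auto simp: inj_on_def)
      then show ?thesis using bound[OF i(1)] by metis
    \<comment> \<open>A \<open>d\<close> outside the range of \<open>j\<close> has nothing to bound,
      so 0 will do.\<close>
    qed (use vnat_k[of 0] in auto)
  qed (erule that, blast)
  then obtain x where x: "x \<in> ext k" "\<And>d. d \<in> ext c \<Longrightarrow> f d \<in> ext x"
    using bounded[OF I(2) f(1)] by blast
  obtain i where i: "i \<in> ext I" "e x \<in> ext (B i)" using e(3)[OF x(1)] by blast
  then have "x \<in> ext (f (j i))" using f(2)[OF j(3)[OF i(1)]] x(1) by simp
  then have "x \<in> ext x"
    using x(2)[OF j(3)[OF i(1)]] ordinal_trans ordinal_elem[OF ordinal_k x(1)] by blast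
  then show False using vmem_irrefl by blast
qed

text \<open>Greedy choice: if at some \<open>\<alpha>\<close> every element of
  \<open>X \<alpha>\<close> were already taken, the earlier choices would yield a surjection from
  \<open>\<alpha>\<close> onto \<open>k\<close>.\<close>

lemma distinct_representatives:
  assumes Y: "Y \<in> M" and X: "Trm (\<lambda>e. X (e 0))"
    and sub: "\<And>\<alpha>. \<alpha> \<in> ext k \<Longrightarrow> X \<alpha> \<unlhd> Y"
    and le: "\<And>\<alpha>. \<alpha> \<in> ext k \<Longrightarrow> k \<lesssim> X \<alpha>"
  obtains f where "lam k f \<in> M" "inj_on f (ext k)" "\<And>\<alpha>. \<alpha> \<in> ext k \<Longrightarrow> f \<alpha> \<in> ext (X \<alpha>)"
proof -
  obtain f where f: "lam k f \<in> M" "\<And>\<alpha>. \<alpha> \<in> ext k \<Longrightarrow> f \<alpha> \<in> ext Y \<and>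
      (f \<alpha> \<in> ext (X \<alpha>) \<and> (\<forall>\<beta>\<in>ext \<alpha>. app (lam \<alpha> f) \<beta> \<noteq> f \<alpha>))"
  proof (rule dependent_choice[where
        Q = "\<lambda>\<alpha> h y. y \<in> ext (X \<alpha>) \<and> (\<forall>\<beta>\<in>ext \<alpha>. app h \<beta> \<noteq> y)", OF k_M k_subset Y])
    show "Def (\<lambda>e. e 2 \<in> ext (X (e 0)) \<and> (\<forall>\<beta>\<in>ext (e 0). app (e 1) \<beta> \<noteq> e 2))"
      by (rule dfn trm1[OF X])+
    fix \<alpha> f assume *: "\<alpha> \<in> ext k" "lam \<alpha> f \<in> M"
    show "\<exists>y\<in>ext Y. y \<in> ext (X \<alpha>) \<and> (\<forall>\<beta>\<in>ext \<alpha>. app (lam \<alpha> f) \<beta> \<noteq> y)"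
    proof (rule ccontr)
      assume neg: "\<not> ?thesis"
      obtain e where e: "lam k e \<in> M" "inj_on e (ext k)" "\<And>x. x \<in> ext k \<Longrightarrow> e x \<in> ext (X \<alpha>)"
        using card_leD[OF le[OF *(1)]] by blast
      \<comment> \<open>Sends \<open>\<beta>\<close> to the position of its representative in the
        list \<open>e\<close>; the union extracts the element of a singleton.\<close>
      let ?g = "\<lambda>\<beta>. vUnion (vset {\<gamma> \<in> ext k. app (lam k e) \<gamma> = app (lam \<alpha> f) \<beta>})"
      have "\<alpha> \<in> M" using *(1) k_M mem_M by blast
      have "lam \<alpha> ?g \<in> M"
        by (rule in_M) (rule term_const[OF e(1)] term_const[OF *(2)] dfn term_const k_M \<open>\<alpha> \<in> M\<close>)+
      moreover have "\<gamma> \<in> ?g ` ext \<alpha>" if \<gamma>: "\<gamma> \<in> ext k" for \<gamma>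
      proof -
        from neg e(3)[OF \<gamma>] sub[OF *(1)] obtain \<beta> where \<beta>: "\<beta> \<in> ext \<alpha>" "f \<beta> = e \<gamma>" by force
        then have "{\<gamma> \<in> ext k. app (lam k e) \<gamma> = app (lam \<alpha> f) \<beta>} = {\<gamma>}"
          using \<gamma> e(2) by (auto simp: inj_on_def)
        then have "?g \<beta> = \<gamma>" by (simp add: vUnion_def)
        then show ?thesis using \<beta>(1) by force
      qed
      ultimately show False using no_surjection[OF *(1)] by blast
    qed
  qed (assumption, erule that, blast)
  have "f \<beta> \<noteq> f \<alpha>" if "\<alpha> \<in> ext k" "\<beta> \<in> ext \<alpha>" for \<alpha> \<beta>
    using f(2)[OF that(1)] that(2) by auto
  then have "inj_on f (ext k)"
    using ordinal_linear ordinal_elem[OF ordinal_k] by (metis inj_onI)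
  then show thesis using that f by blast
qed

text \<open>List elements of \<open>X\<close> along \<open>k\<close> without repetition, with
  \<open>X\<close> itself, which is not an element of \<open>X\<close>, as the signal that nothing
  is left. If the signal never comes, \<open>k\<close> injects into \<open>X\<close>; otherwise
  every element of \<open>X\<close> has been listed, and a choice of positions injects
  \<open>X\<close> into \<open>k\<close>.\<close>

lemma comparable:
  assumes X: "X \<in> M" and nle: "\<not> k \<lesssim> X"
  shows "X \<lesssim> k"
proof -
  let ?Y = "vset (insert X (ext X))"
  have Y: "?Y \<in> M" by (rule in_M) (rule dfn term_const X)+
  obtain f where f: "lam k f \<in> M" "\<And>\<alpha>. \<alpha> \<in> ext k \<Longrightarrow> f \<alpha> \<in> ext ?Y \<and>
      (f \<alpha> \<in> ext X \<and> (\<forall>\<beta>\<in>ext \<alpha>. app (lam \<alpha> f) \<beta> \<noteq> f \<alpha>) \<or>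
       f \<alpha> = X \<and> (\<forall>x\<in>ext X. \<exists>\<beta>\<in>ext \<alpha>. app (lam \<alpha> f) \<beta> = x))"
  proof (rule dependent_choice[OF k_M k_subset Y, where
        Q = "\<lambda>\<alpha> h y. y \<in> ext X \<and> (\<forall>\<beta>\<in>ext \<alpha>. app h \<beta> \<noteq> y) \<or>
          y = X \<and> (\<forall>x\<in>ext X. \<exists>\<beta>\<in>ext \<alpha>. app h \<beta> = x)"])
    show "Def (\<lambda>e. e 2 \<in> ext X \<and> (\<forall>\<beta>\<in>ext (e 0). app (e 1) \<beta> \<noteq> e 2) \<or>
          e 2 = X \<and> (\<forall>x\<in>ext X. \<exists>\<beta>\<in>ext (e 0). app (e 1) \<beta> = x))"
      by (rule dfn term_const X)+
    show "\<exists>y\<in>ext ?Y. y \<in> ext X \<and> (\<forall>\<beta>\<in>ext \<alpha>. app (lam \<alpha> f) \<beta> \<noteq> y) \<or>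
          y = X \<and> (\<forall>x\<in>ext X. \<exists>\<beta>\<in>ext \<alpha>. app (lam \<alpha> f) \<beta> = x)" for \<alpha> f
      by auto
  qed (assumption, erule that, blast)
  have "\<exists>\<alpha>\<in>ext k. f \<alpha> = X"
  proof (rule ccontr)
    assume "\<not> ?thesis"
    then have *: "f \<alpha> \<in> ext X \<and> (\<forall>\<beta>\<in>ext \<alpha>. f \<beta> \<noteq> f \<alpha>)" if "\<alpha> \<in> ext k" for \<alpha>
      using f(2)[OF that] that by auto
    then have "inj_on f (ext k)"
      using ordinal_linear ordinal_elem[OF ordinal_k] by (metis inj_onI)
    then show False using nle card_leI[OF f(1), of "ext X"] * by blast
  qed
  then obtain \<alpha> where \<alpha>: "\<alpha> \<in> ext k" "f \<alpha> = X" by blast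
  then have *: "\<exists>\<beta>\<in>ext k. app (lam k f) \<beta> = x" if "x \<in> ext X" for x
    using f(2)[OF \<alpha>(1)] that vmem_irrefl[of X] ordinal_trans[OF ordinal_k \<alpha>(1)] by fastforce
  obtain g where g: "lam X g \<in> M" "\<And>x. x \<in> ext X \<Longrightarrow> g x \<in> ext k \<and> app (lam k f) (g x) = x"
  proof (rule choice_rel[OF X k_M, where R = "\<lambda>x \<beta>. app (lam k f) \<beta> = x"])
    show "Def (\<lambda>e. app (lam k f) (e 1) = e 0)" by (rule term_const[OF f(1)] dfn)+
  qed (use * in blast, erule that, blast)
  then show ?thesis by (intro card_leI[OF g(1)] inj_onI) (metis, blast)
qed

end

section \<open>Forcing atomic statements\<close>

lemma small_name_domain: "small {s. \<exists>r\<in>G. vpair s r \<in>\<^sub>V t}"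
  by (rule small_subset[OF small_ext[of "tcl t"]]) (auto simp: mem_ext dest: vpair_mem_tcl)

lemma ext_name_val: "ext (name_val G t) = name_val G ` {s. \<exists>r\<in>G. vpair s r \<in> ext t}"
  by (subst name_val.simps) (use small_name_domain[of G t] in \<open>simp add: mem_ext\<close>)

locale forcing = ctm +
  fixes P :: 'a
  assumes P_M: "P \<in> M"
begin

abbreviation "Gen \<equiv> generic M (ext P) tree_le"

lemma genericD:
  assumes "Gen G"
  shows "G \<subseteq> ext P" "\<And>p q. q \<in> G \<Longrightarrow> p \<in> ext P \<Longrightarrow> q \<unlhd> p \<Longrightarrow> p \<in> G"
    "\<And>p q. p \<in> G \<Longrightarrow> q \<in> G \<Longrightarrow> \<exists>r\<in>G. r \<unlhd> p \<and> r \<unlhd> q" "G \<noteq> {}"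
  using assms by (auto simp: generic_def forcing_filter_def tree_le_def)

text \<open>Adding all conditions without a common extension with \<open>p\<close> makes the set
  dense everywhere, and a filter that contains \<open>p\<close> meets none of the added ones.
  Definability of \<open>R\<close> puts the dense set into \<open>M\<close>.\<close>

lemma generic_dense_below:
  assumes G: "Gen G" and p: "p \<in> G" and R: "Def (\<lambda>e. R (e 0))"
    and dense: "\<And>q. q \<in> ext P \<Longrightarrow> q \<unlhd> p \<Longrightarrow> \<exists>q'\<in>ext P. q' \<unlhd> q \<and> R q'"
  shows "\<exists>q\<in>G. R q"
proof -
  have p': "p \<in> ext P" using genericD(1)[OF G] p by blast
  let ?R = "\<lambda>q. R q \<or> \<not> (\<exists>q'\<in>ext P. q' \<unlhd> q \<and> q' \<unlhd> p)"
  have "vset {q \<in> ext P. ?R q} \<in> M"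
    by (rule in_M) (rule dfn definable1[OF R] term_const P_M mem_M[OF p'])+
  then have "coded_in M {q \<in> ext P. ?R q}" 
    unfolding coded_in_def by (rule rev_bexI) (rule ext_vset_small small_Collect small_ext)+
  moreover have "dense_in (ext P) tree_le {q \<in> ext P. ?R q}"
    unfolding dense_in_def tree_le_def
  proof (intro conjI ballI)
    fix q assume q: "q \<in> ext P"
    show "\<exists>q'\<in>{q \<in> ext P. ?R q}. q' \<unlhd> q"
    proof (cases "\<exists>q'\<in>ext P. q' \<unlhd> q \<and> q' \<unlhd> p")
      case True
      then obtain q1 where q1: "q1 \<in> ext P" "q1 \<unlhd> q" "q1 \<unlhd> p" by blast
      obtain q2 where "q2 \<in> ext P" "q2 \<unlhd> q1" "R q2" using dense[OF q1(1,3)] by blast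
      then show ?thesis using q1(2) by (intro bexI[of _ q2]) auto
    qed (use q in blast)
  qed blast
  ultimately have "G \<inter> {q \<in> ext P. ?R q} \<noteq> {}"
    using G unfolding generic_def by simp
  then obtain q where q: "q \<in> G" "?R q" by blast
  obtain r where "r \<in> G" "r \<unlhd> q" "r \<unlhd> p"
    using genericD(3)[OF G q(1) p] by blast
  then have "R q" using q(2) genericD(1)[OF G] by blast
  then show ?thesis using q(1) by blast
qed

text \<open>The two clauses say that \<open>q\<close> forces the name \<open>s\<close> to be a subset, respectively a superset,
  of \<open>y\<close>, given the values of the forcing relation \<open>h\<close> on the constituents of \<open>s\<close>.\<close>
definition forces_eq_step :: "'a \<Rightarrow> 'a \<Rightarrow> 'a \<Rightarrow> 'a \<Rightarrow> bool" where
  "forces_eq_step s h q y \<longleftrightarrow>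
     (\<forall>s'\<in>ext (tcl s). \<forall>r'\<in>ext P. vpair s' r' \<in> ext s \<longrightarrow>
        (\<forall>q'\<in>ext P. q' \<unlhd> q \<and> q' \<unlhd> r' \<longrightarrow>
           (\<exists>q''\<in>ext P. q'' \<unlhd> q' \<and> (\<exists>z\<in>ext y. vpair q'' z \<in> ext (app h s'))))) \<and>
     (\<forall>z\<in>ext y. \<forall>q'\<in>ext P. q' \<unlhd> q \<longrightarrow>
        (\<exists>q''\<in>ext P. q'' \<unlhd> q' \<and> (\<exists>s'\<in>ext (tcl s). \<exists>r'\<in>ext P.
           vpair s' r' \<in> ext s \<and> q'' \<unlhd> r' \<and> vpair q'' z \<in> ext (app h s'))))"

lemma def_forces_eq_step: "Def (\<lambda>e. forces_eq_step (e 0) (e 1) (e 2) (e 3))"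
  unfolding forces_eq_step_def by (rule term_const[OF P_M] dfn)+

text \<open>The relations below \<open>s\<close> are sets of pairs of a condition and a value. One
  union collects these pairs and two more reach their components, so every possible value of a
  constituent of \<open>s\<close> is an element, and every possible value of \<open>s\<close> a
  subset.\<close>

definition value_bound :: "'a \<Rightarrow> 'a \<Rightarrow> 'a" where
  "value_bound s h = vUnion (vUnion (vUnion (vset ((\<lambda>x. app h x) ` ext (tcl s)))))"

text \<open>Equality is treated between a name and a set of the ground model, so that the recursion
  runs over a single name. The bound makes each value of the recursion a set.\<close>

definition forces_eq_rec :: "'a \<Rightarrow> 'a \<Rightarrow> 'a" where
  "forces_eq_rec s h = vset {z \<in> ext (cart P (pow (value_bound s h))).
     \<exists>q\<in>M. \<exists>y\<in>M. z = vpair q y \<and> forces_eq_step s h q y}"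

definition forces_eq :: "'a \<Rightarrow> 'a" where "forces_eq = vrec forces_eq_rec"

lemma trm_value_bound [dfn]: "Trm F \<Longrightarrow> Trm H \<Longrightarrow> Trm (\<lambda>e. value_bound (F e) (H e))"
  by (rule trm2[where G = value_bound]) (unfold value_bound_def, (rule dfn)+)

lemma trm_forces_eq [dfn]: "Trm F \<Longrightarrow> Trm (\<lambda>e. forces_eq (F e))"
  unfolding forces_eq_def
  by (rule trm_vrec) (unfold forces_eq_rec_def, (rule term_const[OF P_M] dfn definable4[OF def_forces_eq_step])+)

abbreviation rel_below :: "'a \<Rightarrow> 'a" where
  "rel_below s \<equiv> lam (tcl s) forces_eq"

lemma rel_below_M: "s \<in> M \<Longrightarrow> rel_below s \<in> M"
  by (rule in_M) (rule term_const dfn | assumption)+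

lemma value_bound_M: "s \<in> M \<Longrightarrow> value_bound s (rel_below s) \<in> M"
  by (rule in_M) (rule term_const[OF rel_below_M] term_const dfn | assumption)+

lemma mem_forces_eq:
  assumes "s \<in> M"
  shows "vpair q y \<in> ext (forces_eq s) \<longleftrightarrow> q \<in> ext P \<and> y \<in> M \<and>
    y \<unlhd> value_bound s (rel_below s) \<and> forces_eq_step s (rel_below s) q y"
proof -
  have "forces_eq s = forces_eq_rec s (rel_below s)"
    unfolding forces_eq_def by (rule vrec)
  then show ?thesis
    using mem_M[OF _ P_M] by (auto simp: forces_eq_rec_def ext_pow[OF value_bound_M[OF assms]])
qed

lemma forces_eq_mono:
  assumes "s \<in> M" "vpair q y \<in> ext (forces_eq s)" "q' \<in> ext P" "q' \<unlhd> q"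
  shows "vpair q' y \<in> ext (forces_eq s)"
  using assms(2-4) unfolding mem_forces_eq[OF assms(1)] forces_eq_step_def
  by (meson order_trans)

lemma mem_value_bound:
  assumes "s' \<in> ext (tcl s)" "vpair q z \<in> ext (forces_eq s')"
  shows "z \<in> ext (value_bound s (rel_below s))"
proof -
  obtain w where w: "w \<in> ext (vUnion (forces_eq s'))" "z \<in> ext w"
    using fst_snd_mem_vUnion2[OF assms(2)] unfolding ext_vUnion[of "vUnion _"] by blast
  obtain v where v: "v \<in> ext (forces_eq s')" "w \<in> ext v"
    using w(1) unfolding ext_vUnion by blast
  let ?X = "vset ((\<lambda>x. app (rel_below s) x) ` ext (tcl s))"
  have "forces_eq s' \<in> ext ?X" using assms(1) by (simp add: image_iff) (metis app_lam)
  then have "v \<in> ext (vUnion ?X)" using v(1) unfolding ext_vUnion by blast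
  then have "w \<in> ext (vUnion (vUnion ?X))" using v(2) unfolding ext_vUnion[of "vUnion _"] by blast
  then show ?thesis
    using w(2) unfolding value_bound_def ext_vUnion[of "vUnion (vUnion _)"] by blast
qed

text \<open>Both directions are density arguments. Below a condition that forces the equality,
  \<open>G\<close> meets the dense sets described by \<open>forces_eq_step\<close>; conversely,
  \<open>G\<close> meets the set of conditions that force or refute the equality, and a refutation
  would be false in the extension.\<close>

lemma truth_eq:
  assumes G: "Gen G"
  shows "s \<in> M \<Longrightarrow> y \<in> M \<Longrightarrow>
    (\<exists>q\<in>G. vpair q y \<in> ext (forces_eq s)) \<longleftrightarrow> name_val G s = y"
proof (induction s arbitrary: y rule: tcl_induct)
  case (step s)
  have M': "s' \<in> M" if "s' \<in> ext (tcl s)" for s'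
    using that step.prems(1) tcl_M mem_M by blast
  have IH: "(\<exists>q\<in>G. vpair q z \<in> ext (forces_eq s')) \<longleftrightarrow> name_val G s' = z"
    if "s' \<in> ext (tcl s)" "z \<in> M" for s' z
    using step.IH[OF that(1) M'[OF that(1)] that(2)] .
  have app: "app (rel_below s) s' = forces_eq s'" if "s' \<in> ext (tcl s)" for s'
    using that by simp
  have GP: "G \<subseteq> ext P" by (rule genericD(1)[OF G])
  have PM: "q \<in> M" if "q \<in> ext P" for q using that P_M mem_M by blast
  have yM: "z \<in> M" if "z \<in> ext y" for z using that step.prems(2) mem_M by blast
  show ?case
  proof
    assume "\<exists>q\<in>G. vpair q y \<in> ext (forces_eq s)"
    then obtain q where q: "q \<in> G" "vpair q y \<in> ext (forces_eq s)" by blast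
    from q(2) have q1: "\<exists>q''\<in>ext P. q'' \<unlhd> q' \<and> (\<exists>z\<in>ext y. vpair q'' z \<in> ext (forces_eq s'))"
      if "vpair s' r' \<in> ext s" "r' \<in> ext P" "q' \<in> ext P" "q' \<unlhd> q" "q' \<unlhd> r'" for s' r' q'
      using that app vpair_mem_tcl[OF that(1)]
      unfolding mem_forces_eq[OF step.prems(1)] forces_eq_step_def by metis
    from q(2) have q2: "\<exists>q''\<in>ext P. q'' \<unlhd> q' \<and> (\<exists>s'\<in>ext (tcl s). \<exists>r'\<in>ext P.
           vpair s' r' \<in> ext s \<and> q'' \<unlhd> r' \<and> vpair q'' z \<in> ext (forces_eq s'))"
      if "z \<in> ext y" "q' \<in> ext P" "q' \<unlhd> q" for z q'
      using that app unfolding mem_forces_eq[OF step.prems(1)] forces_eq_step_def by metis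
    have "w \<in> ext y" if "w \<in> ext (name_val G s)" for w
    proof -
      from that obtain s' r' where w: "w = name_val G s'" "r' \<in> G" "vpair s' r' \<in> ext s"
        unfolding ext_name_val by blast
      note s' = vpair_mem_tcl[OF w(3)]
      obtain p where p: "p \<in> G" "p \<unlhd> q" "p \<unlhd> r'"
        using genericD(3)[OF G q(1) w(2)] by blast
      have "\<exists>q''\<in>G. \<exists>z\<in>ext y. vpair q'' z \<in> ext (forces_eq s')"
      proof (rule generic_dense_below[OF G p(1)])
        show "Def (\<lambda>e. \<exists>z\<in>ext y. vpair (e 0) z \<in> ext (forces_eq s'))"
          by (rule dfn term_const M'[OF s'] step.prems(2))+
        show "\<exists>q''\<in>ext P. q'' \<unlhd> q' \<and> (\<exists>z\<in>ext y. vpair q'' z \<in> ext (forces_eq s'))"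
          if "q' \<in> ext P" "q' \<unlhd> p" for q'
          by (rule q1[OF w(3)]) (use that p w(2) GP in auto)
      qed
      then show ?thesis using IH[OF s'] yM w(1) by metis
    qed
    moreover have "z \<in> ext (name_val G s)" if z: "z \<in> ext y" for z
    proof -
      have "\<exists>q''\<in>G. \<exists>s'\<in>ext (tcl s). \<exists>r'\<in>ext P.
           vpair s' r' \<in> ext s \<and> q'' \<unlhd> r' \<and> vpair q'' z \<in> ext (forces_eq s')"
      proof (rule generic_dense_below[OF G q(1)])
        show "Def (\<lambda>e. \<exists>s'\<in>ext (tcl s). \<exists>r'\<in>ext P.
           vpair s' r' \<in> ext s \<and> e 0 \<unlhd> r' \<and> vpair (e 0) z \<in> ext (forces_eq s'))"
          by (rule dfn term_const P_M step.prems(1) yM[OF z])+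
      qed (rule q2[OF z])
      then obtain q'' s' r' where *: "q'' \<in> G" "s' \<in> ext (tcl s)" "r' \<in> ext P"
        "vpair s' r' \<in> ext s" "q'' \<unlhd> r'" "vpair q'' z \<in> ext (forces_eq s')" by blast
      then have "name_val G s' = z" using IH[OF *(2) yM[OF z]] by blast
      moreover have "r' \<in> G" by (rule genericD(2)[OF G *(1,3,5)])
      ultimately show ?thesis using *(4) unfolding ext_name_val by blast
    qed
    ultimately show "name_val G s = y" by (intro ext_eqI) blast
  next
    assume val: "name_val G s = y"
    have mem: "name_val G s' \<in> ext y" if "vpair s' r' \<in> ext s" "r' \<in> G" for s' r'
      using that unfolding val[symmetric] ext_name_val by blast
    have mem': "\<exists>s' r'. vpair s' r' \<in> ext s \<and> r' \<in> G \<and> z = name_val G s'" if "z \<in> ext y" for z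
      using that unfolding val[symmetric] ext_name_val by blast
    have ybound: "y \<unlhd> value_bound s (rel_below s)"
    proof
      fix z assume z: "z \<in> ext y"
      then obtain s' r' where s': "vpair s' r' \<in> ext s" "r' \<in> G" "z = name_val G s'"
        using mem' by blast
      note s'' = vpair_mem_tcl[OF s'(1)]
      obtain q where "vpair q z \<in> ext (forces_eq s')"
        using IH[OF s'' yM[OF z]] s'(3) by blast
      then show "z \<in> ext (value_bound s (rel_below s))" by (rule mem_value_bound[OF s''])
    qed
    \<comment> \<open>The two refutations of equality with \<open>y\<close>: in \<open>D1\<close> a
      constituent that is present has no value in \<open>y\<close>, in \<open>D2\<close> an element
      of \<open>y\<close> is attained by no constituent. \<open>forces_eq_step\<close> holds at any
      condition without a refuting extension.\<close>
    define D1 where "D1 q \<longleftrightarrow> (\<exists>s'\<in>ext (tcl s). \<exists>r'\<in>ext P. vpair s' r' \<in> ext s \<and> q \<unlhd> r' \<and>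
        (\<forall>q''\<in>ext P. q'' \<unlhd> q \<longrightarrow> (\<forall>z\<in>ext y. vpair q'' z \<notin> ext (forces_eq s'))))" for q
    define D2 where "D2 q \<longleftrightarrow> (\<exists>z\<in>ext y. \<forall>q''\<in>ext P. q'' \<unlhd> q \<longrightarrow>
        (\<forall>s'\<in>ext (tcl s). \<forall>r'\<in>ext P. vpair s' r' \<in> ext s \<and> q'' \<unlhd> r' \<longrightarrow>
          vpair q'' z \<notin> ext (forces_eq s')))" for q
    obtain p0 where p0: "p0 \<in> G" using genericD(4)[OF G] by blast
    have "\<exists>q\<in>G. vpair q y \<in> ext (forces_eq s) \<or> D1 q \<or> D2 q"
    proof (rule generic_dense_below[OF G p0])
      show "Def (\<lambda>e. vpair (e 0) y \<in> ext (forces_eq s) \<or> D1 (e 0) \<or> D2 (e 0))"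
        unfolding D1_def D2_def by (rule dfn term_const P_M step.prems)+
      fix q assume q: "q \<in> ext P"
      show "\<exists>q'\<in>ext P. q' \<unlhd> q \<and> (vpair q' y \<in> ext (forces_eq s) \<or> D1 q' \<or> D2 q')"
      proof (cases "\<exists>q'\<in>ext P. q' \<unlhd> q \<and> (D1 q' \<or> D2 q')")
        case False
        have "forces_eq_step s (rel_below s) q y"
          unfolding forces_eq_step_def
        proof (intro conjI ballI impI)
          fix s' r' q' assume *: "s' \<in> ext (tcl s)" "r' \<in> ext P" "vpair s' r' \<in> ext s"
            "q' \<in> ext P" "q' \<unlhd> q \<and> q' \<unlhd> r'"
          then have "\<not> D1 q'" using False by blast
          then show "\<exists>q''\<in>ext P. q'' \<unlhd> q' \<and> (\<exists>z\<in>ext y. vpair q'' z \<in> ext (app (rel_below s) s'))"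
            using * unfolding D1_def app[OF *(1)] by blast
        next
          fix z q' assume *: "z \<in> ext y" "q' \<in> ext P" "q' \<unlhd> q"
          then have "\<not> D2 q'" using False by blast
          then show "\<exists>q''\<in>ext P. q'' \<unlhd> q' \<and> (\<exists>s'\<in>ext (tcl s). \<exists>r'\<in>ext P.
             vpair s' r' \<in> ext s \<and> q'' \<unlhd> r' \<and> vpair q'' z \<in> ext (app (rel_below s) s'))"
            using *(1) app unfolding D2_def by metis
        qed
        then have "vpair q y \<in> ext (forces_eq s)"
          using q step.prems ybound by (simp add: mem_forces_eq)
        then show ?thesis using q by blast
      qed blast
    qed
    then obtain q where q: "q \<in> G" "vpair q y \<in> ext (forces_eq s) \<or> D1 q \<or> D2 q" by blast
    have "\<not> D1 q"
    proof
      assume "D1 q"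
      then obtain s' r' where *: "s' \<in> ext (tcl s)" "r' \<in> ext P" "vpair s' r' \<in> ext s" "q \<unlhd> r'"
        "\<And>q'' z. q'' \<in> ext P \<Longrightarrow> q'' \<unlhd> q \<Longrightarrow> z \<in> ext y \<Longrightarrow> vpair q'' z \<notin> ext (forces_eq s')"
        unfolding D1_def by blast
      have z: "name_val G s' \<in> ext y"
        by (rule mem[OF *(3)], rule genericD(2)[OF G q(1) *(2,4)])
      obtain q1 where q1: "q1 \<in> G" "vpair q1 (name_val G s') \<in> ext (forces_eq s')"
        using IH[OF *(1) yM[OF z]] by blast
      obtain r where r: "r \<in> G" "r \<unlhd> q" "r \<unlhd> q1"
        using genericD(3)[OF G q(1) q1(1)] by blast
      then show False
        using *(5)[OF _ r(2) z] forces_eq_mono[OF M'[OF *(1)] q1(2) _ r(3)] GP by blast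
    qed
    moreover have "\<not> D2 q"
    proof
      assume "D2 q"
      then obtain z where z: "z \<in> ext y" and *: "\<And>q'' s' r'. q'' \<in> ext P \<Longrightarrow> q'' \<unlhd> q \<Longrightarrow>
          s' \<in> ext (tcl s) \<Longrightarrow> r' \<in> ext P \<Longrightarrow> vpair s' r' \<in> ext s \<Longrightarrow> q'' \<unlhd> r' \<Longrightarrow>
          vpair q'' z \<notin> ext (forces_eq s')"
        unfolding D2_def by blast
      obtain s' r' where s': "vpair s' r' \<in> ext s" "r' \<in> G" "z = name_val G s'"
        using mem'[OF z] by blast
      note s'' = vpair_mem_tcl[OF s'(1)]
      obtain q1 where q1: "q1 \<in> G" "vpair q1 z \<in> ext (forces_eq s')"
        using IH[OF s'' yM[OF z]] s'(3) by blast
      obtain r where r: "r \<in> G" "r \<unlhd> q" "r \<unlhd> q1"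
        using genericD(3)[OF G q(1) q1(1)] by blast
      obtain t where t: "t \<in> G" "t \<unlhd> r" "t \<unlhd> r'"
        using genericD(3)[OF G r(1) s'(2)] by blast
      have "vpair t z \<in> ext (forces_eq s')"
        by (rule forces_eq_mono[OF M'[OF s''] q1(2)]) (use t r GP in auto)
      moreover have "vpair t z \<notin> ext (forces_eq s')"
        by (rule *[OF _ _ s'' _ s'(1)]) (use t r s' GP in auto)
      ultimately show False by blast
    qed
    ultimately show "\<exists>q\<in>G. vpair q y \<in> ext (forces_eq s)" using q by blast
  qed
qed

section \<open>Forcing that a ground-model set belongs to the value of a name\<close>

definition forces_mem :: "'a \<Rightarrow> 'a \<Rightarrow> 'a \<Rightarrow> bool" where
  "forces_mem A q x \<longleftrightarrow> q \<in> ext P \<and> (\<exists>s\<in>ext (tcl A). \<exists>r\<in>ext P.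
     vpair s r \<in> ext A \<and> q \<unlhd> r \<and> vpair q x \<in> ext (forces_eq s))"

lemma def_forces_mem: "Def (\<lambda>e. forces_mem (e 0) (e 1) (e 2))"
  unfolding forces_mem_def by (rule term_const[OF P_M] dfn)+

lemma forces_mem_bound:
  assumes "forces_mem A q x" shows "x \<in> ext (value_bound A (rel_below A))"
  using assms mem_value_bound unfolding forces_mem_def by blast

lemma forces_mem_mono:
  assumes "A \<in> M" "forces_mem A q x" "q' \<in> ext P" "q' \<unlhd> q"
  shows "forces_mem A q' x"
proof -
  have "s \<in> M" if "s \<in> ext (tcl A)" for s using that assms(1) tcl_M mem_M by blast
  then show ?thesis
    using assms(2-4) forces_eq_mono unfolding forces_mem_def by (meson order_trans)
qed

lemma truth_mem:
  assumes G: "Gen G" and A: "A \<in> M" and x: "x \<in> M"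
  shows "x \<in> ext (name_val G A) \<longleftrightarrow> (\<exists>q\<in>G. forces_mem A q x)"
proof
  assume "x \<in> ext (name_val G A)"
  then obtain s r where s: "x = name_val G s" "r \<in> G" "vpair s r \<in> ext A"
    unfolding ext_name_val by blast
  note s' = vpair_mem_tcl[OF s(3)]
  have sM: "s \<in> M" using s' A tcl_M mem_M by blast
  obtain q where q: "q \<in> G" "vpair q x \<in> ext (forces_eq s)"
    using truth_eq[OF G sM x] s(1) by blast
  obtain t where t: "t \<in> G" "t \<unlhd> q" "t \<unlhd> r"
    using genericD(3)[OF G q(1) s(2)] by blast
  have P: "t \<in> ext P" "r \<in> ext P" using t(1) s(2) genericD(1)[OF G] by auto
  have "forces_mem A t x"
    unfolding forces_mem_def using P s' s(3) t(3) forces_eq_mono[OF sM q(2) P(1) t(2)] by blast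
  then show "\<exists>q\<in>G. forces_mem A q x" using t(1) by blast
next
  assume "\<exists>q\<in>G. forces_mem A q x"
  then obtain q s r where q: "q \<in> G" "s \<in> ext (tcl A)" "r \<in> ext P" "vpair s r \<in> ext A"
    "q \<unlhd> r" "vpair q x \<in> ext (forces_eq s)"
    unfolding forces_mem_def by blast
  have "s \<in> M" using q(2) A tcl_M mem_M by blast
  then have "name_val G s = x" using truth_eq[OF G _ x] q(1,6) by blast
  moreover have "r \<in> G" by (rule genericD(2)[OF G q(1,3,5)])
  ultimately show "x \<in> ext (name_val G A)" using q(4) unfolding ext_name_val by blast
qed

end

section \<open>Perfect trees\<close>

lemma mem_vset_Collect: "x \<in> ext (vset {y \<in> ext a. R y}) \<longleftrightarrow> x \<in> ext a \<and> R x"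
  by simp

lemma mem_vset_image: "x \<in> ext (vset (f ` ext a)) \<longleftrightarrow> (\<exists>y\<in>ext a. x = f y)"
  for f :: "'a::set_universe \<Rightarrow> 'a"
  by (simp add: image_iff)

lemma mem_vset_UN: "x \<in> ext (vset (\<Union>y\<in>ext a. ext (f y))) \<longleftrightarrow> (\<exists>y\<in>ext a. x \<in> ext (f y))"
  for f :: "'a::set_universe \<Rightarrow> 'a"
  by simp

locale trees = ctm +
  fixes K :: "nat \<Rightarrow> 'a"
  assumes K_coded: "coded_in M (seq_graph K)"
    and K_regular: "\<And>n. regular_in M (K n)"
    and K_increasing: "\<And>m n. m < n \<Longrightarrow> K m \<in>\<^sub>V K n"
begin

lemma regular_K: "regular M (K n)"
  by unfold_locales (rule K_regular)

lemmas K_M = regular.k_M[OF regular_K]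

lemma vnat_K: "vnat m \<in> ext (K n)"
  by (rule regular.vnat_k[OF regular_K])

lemma K_mono: "m \<le> n \<Longrightarrow> K m \<unlhd> K n"
  using K_increasing[of m n] regular.k_subset[OF regular_K, of "K m" n]
  by (cases "m = n") (auto simp: mem_ext)

lemma card_le_K_mono:
  "m \<le> n \<Longrightarrow> K n \<lesssim> x \<Longrightarrow> K m \<lesssim> x"
  using card_le_trans[OF K_M card_le_subset[OF K_M K_mono]] by blast

lemma two_elements:
  assumes "card_le_in M (ext (K n)) X"
  obtains u v where "u \<in> X" "v \<in> X" "u \<noteq> v"
proof -
  obtain f where "inj_on f (ext (K n))" "\<forall>x\<in>ext (K n). f x \<in> X"
    using card_leD[OF assms] by blast
  moreover have "(vnat 0 :: 'a) \<noteq> vnat 1" by (simp only: vnat_inject)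
  ultimately show thesis
    using that[of "f (vnat 0)" "f (vnat 1)"] vnat_K unfolding inj_on_def by blast
qed

section \<open>Coded nodes, their successors, and restriction of trees\<close>

definition Kc :: 'a where "Kc = vset (seq_graph K)"

lemma Kc: "Kc \<in> M" "ext Kc = seq_graph K"
  using K_coded vset_ext unfolding Kc_def coded_in_def by metis+

lemma app_Kc [simp]: "app Kc (vnat n) = K n"
  by (rule app_eqI) (auto simp: Kc(2) seq_graph_def)

lemma nodes_snoc: "t @ [a] \<in> nodes K \<longleftrightarrow> t \<in> nodes K \<and> a \<in> ext (K (length t))"
  by (auto simp: nodes_def nth_append less_Suc_eq mem_ext)

lemma nodes_prefix: "t \<in> nodes K \<Longrightarrow> prefix s t \<Longrightarrow> s \<in> nodes K"
proof -
  assume t: "t \<in> nodes K" and "prefix s t"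
  then obtain w where w: "t = s @ w" by (auto simp: prefix_def)
  have "m < length t \<and> t ! m = s ! m" if "m < length s" for m
    using that by (simp add: w nth_append)
  then show "s \<in> nodes K" using t unfolding nodes_def mem_Collect_eq by metis
qed

text \<open>The levels are produced by recursion inside \<open>M\<close>: a node of length n is
  prolonged by adding a pair of n and an element of \<kappa>_n.\<close>

lemma ex_nodes: "\<exists>N\<in>M. ext N = vlist ` nodes K"
proof -
  let ?g = "\<lambda>n L. vset (\<Union>t\<in>ext L. ext (vset ((\<lambda>a. vset (insert (vpair n a) (ext t))) ` ext (app Kc n))))"
  have g: "Trm (\<lambda>e. ?g (e 0) (e 1))" by (rule term_const[OF Kc(1)] dfn)+
  have "vset {vset {}} \<in> M" by (rule in_M) (rule dfn term_const empty_M)+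
  then obtain F where F: "\<And>T. Trm T \<Longrightarrow> Trm (\<lambda>e. F (T e))" "F (vnat 0) = vset {vset {}}"
    "\<And>n. F (vnat (Suc n)) = ?g (vnat n) (F (vnat n))"
    using omega_rec[OF _ g] by blast
  have snoc: "vset (insert (vpair (vnat (length t)) a) (ext (vlist t))) = vlist (t @ [a])" for a :: 'a and t
    by (rule ext_inject) (simp add: vlist_append1)
  have ext_F: "ext (F (vnat n)) = vlist ` {t \<in> nodes K. length t = n}" for n
  proof (induction n)
    case 0
    have "{t \<in> nodes K. length t = 0} = {[]}" by (auto simp: nodes_def)
    then show ?case using F(2) by (simp add: vlist_Nil)
  next
    case (Suc n)
    have "x \<in> ext (F (vnat (Suc n))) \<longleftrightarrow> x \<in> vlist ` {t \<in> nodes K. length t = Suc n}" for x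
    proof -
      have "x \<in> ext (F (vnat (Suc n))) \<longleftrightarrow>
          (\<exists>t\<in>nodes K. length t = n \<and> (\<exists>a\<in>ext (K n). x = vlist (t @ [a])))"
        unfolding F(3) unfolding mem_vset_UN mem_vset_image unfolding Suc app_Kc by (auto simp: snoc[symmetric])
      also have "\<dots> \<longleftrightarrow> (\<exists>u\<in>nodes K. length u = Suc n \<and> x = vlist u)"
      proof
        assume "\<exists>t\<in>nodes K. length t = n \<and> (\<exists>a\<in>ext (K n). x = vlist (t @ [a]))"
        then obtain t a where "t \<in> nodes K" "length t = n" "a \<in> ext (K n)" "x = vlist (t @ [a])" by blast
        then show "\<exists>u\<in>nodes K. length u = Suc n \<and> x = vlist u"
          by (intro bexI[of _ "t @ [a]"]) (auto simp: nodes_snoc)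
      next
        assume "\<exists>u\<in>nodes K. length u = Suc n \<and> x = vlist u"
        then obtain u where u: "u \<in> nodes K" "length u = Suc n" "x = vlist u" by blast
        then obtain t a where "u = t @ [a]" by (metis length_Suc_conv_rev)
        then show "\<exists>t\<in>nodes K. length t = n \<and> (\<exists>a\<in>ext (K n). x = vlist (t @ [a]))"
          using u by (auto simp: nodes_snoc)
      qed
      finally show ?thesis by blast
    qed
    then show ?case by blast
  qed
  let ?N = "vset (\<Union>n\<in>ext vomega. ext (F n))"
  have "?N \<in> M" by (rule in_M) (rule dfn F(1) term_const omega_M)+
  moreover have "ext ?N = vlist ` nodes K" unfolding set_eq_iff mem_vset_UN by (auto simp: ext_F)
  ultimately show ?thesis by blast
qed

definition Nd :: 'a where "Nd = vset (vlist ` nodes K)"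

lemma Nd: "Nd \<in> M" "ext Nd = vlist ` nodes K"
  using ex_nodes vset_ext unfolding Nd_def by metis+

lemma node_M: "t \<in> ext Nd \<Longrightarrow> t \<in> M"
  using mem_M Nd(1) by blast

text \<open>Immediate successors in terms of inclusion of coded nodes only, which makes the relation
  visibly definable over \<open>M\<close>.\<close>
definition isucc :: "'a \<Rightarrow> 'a \<Rightarrow> bool" where
  "isucc t u \<longleftrightarrow> t \<in> ext Nd \<and> u \<in> ext Nd \<and> t \<unlhd> u \<and> t \<noteq> u \<and>
     (\<forall>s\<in>ext Nd. t \<unlhd> s \<and> s \<unlhd> u \<longrightarrow> s = t \<or> s = u)"

lemma isucc_vlist:
  assumes "t \<in> nodes K" "u \<in> nodes K"
  shows "isucc (vlist t) (vlist u) \<longleftrightarrow> (\<exists>a. u = t @ [a])"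
proof
  assume *: "isucc (vlist t) (vlist u)"
  then have "prefix t u" "t \<noteq> u" by (auto simp: isucc_def)
  then obtain a w where u: "u = t @ a # w" by (metis prefix_def append_Nil2 list.exhaust)
  then have "t @ [a] \<in> nodes K" using assms(2) nodes_prefix[of u "t @ [a]"] by (simp add: prefix_def)
  then have "vlist (t @ [a]) \<in> ext Nd" using Nd(2) by blast
  moreover have "prefix t (t @ [a])" "prefix (t @ [a]) u" by (simp_all add: u)
  ultimately have "vlist (t @ [a]) = vlist t \<or> vlist (t @ [a]) = vlist u"
    using * vlist_le_iff unfolding isucc_def by metis
  then show "\<exists>a. u = t @ [a]" using u by auto
next
  assume "\<exists>a. u = t @ [a]"
  then obtain a where "u = t @ [a]" by blast
  then show "isucc (vlist t) (vlist u)"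
    using assms by (auto simp: isucc_def Nd(2) dest: prefix_order.antisym)
qed

lemma nodes_comparable:
  assumes "z \<in> ext Nd" "x \<in> ext Nd" "y \<in> ext Nd" "x \<unlhd> z" "y \<unlhd> z"
  shows "x \<unlhd> y \<or> y \<unlhd> x"
proof -
  obtain a b c where "z = vlist a" "x = vlist b" "y = vlist c"
    using assms(1-3) unfolding Nd(2) by blast
  then show ?thesis using assms(4,5) prefix_same_cases[of b a c] by (simp only: vlist_le_iff)
qed

lemma isuccD:
  assumes "isucc t u" shows "t \<in> ext Nd" "u \<in> ext Nd" "t \<unlhd> u" "\<not> u \<unlhd> t"
  using assms ext_inject[of t u] unfolding isucc_def by blast+

lemma below_isucc:
  assumes "isucc t u" "s \<in> ext Nd" "s \<unlhd> u" shows "s \<unlhd> t \<or> s = u"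
proof -
  have "s \<unlhd> t \<or> t \<unlhd> s"
    using nodes_comparable[OF _ assms(2) _ assms(3)] isuccD[OF assms(1)] by blast
  then show ?thesis using assms unfolding isucc_def by blast
qed

lemma isucc_unique:
  assumes "isucc t u" "isucc t v" "w \<in> ext Nd" "u \<unlhd> w" "v \<unlhd> w" shows "u = v"
proof -
  note u = isuccD[OF assms(1)] and v = isuccD[OF assms(2)]
  have "u \<unlhd> v \<or> v \<unlhd> u"
    by (rule nodes_comparable[OF assms(3) u(2) v(2) assms(4,5)])
  then show ?thesis
    using below_isucc[OF assms(1) v(2)] below_isucc[OF assms(2) u(2)] u(4) v(4) by blast
qed

lemma node_induct [consumes 1, case_names root succ]:
  assumes "s \<in> ext Nd" "P (vset {})" "\<And>t u. isucc t u \<Longrightarrow> P t \<Longrightarrow> P u" shows "P s"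
proof -
  have "l \<in> nodes K \<Longrightarrow> P (vlist l)" for l
  proof (induction l rule: rev_induct)
    case Nil
    show ?case using assms(2) by (simp add: vlist_Nil)
  next
    case (snoc a l)
    then have "l \<in> nodes K" by (simp add: nodes_snoc)
    then show ?case
      using assms(3)[of "vlist l" "vlist (l @ [a])"] snoc isucc_vlist[of l "l @ [a]"] by blast
  qed
  moreover obtain l where "l \<in> nodes K" "s = vlist l" using assms(1) Nd(2) by blast
  ultimately show ?thesis by simp
qed

definition succs :: "'a \<Rightarrow> 'a \<Rightarrow> 'a" where
  "succs q t = vset {u \<in> ext q. isucc t u}"

lemma ext_succs [simp]: "ext (succs q t) = {u \<in> ext q. isucc t u}"
  by (simp add: succs_def)

definition restr :: "'a \<Rightarrow> 'a \<Rightarrow> 'a" where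
  "restr q s = vset {t \<in> ext q. t \<unlhd> s \<or> s \<unlhd> t}"

lemma ext_restr [simp]: "ext (restr q s) = {t \<in> ext q. t \<unlhd> s \<or> s \<unlhd> t}"
  by (simp add: restr_def)

lemma def_isucc [dfn]: "Trm F \<Longrightarrow> Trm G \<Longrightarrow> Def (\<lambda>e. isucc (F e) (G e))"
  by (rule definable2[where R = isucc]) (unfold isucc_def, (rule term_const[OF Nd(1)] dfn)+)

lemma trm_succs [dfn]: "Trm F \<Longrightarrow> Trm G \<Longrightarrow> Trm (\<lambda>e. succs (F e) (G e))"
  by (rule trm2[where G = succs]) (unfold succs_def, (rule dfn)+)

lemma trm_restr [dfn]: "Trm F \<Longrightarrow> Trm G \<Longrightarrow> Trm (\<lambda>e. restr (F e) (G e))"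
  by (rule trm2[where G = restr]) (unfold restr_def, (rule dfn)+)

section \<open>The set of conditions\<close>

definition perfect :: "'a \<Rightarrow> bool" where
  "perfect q \<longleftrightarrow> q \<unlhd> Nd \<and> q \<noteq> vset {} \<and>
     (\<forall>t\<in>ext q. \<forall>s\<in>ext Nd. s \<unlhd> t \<longrightarrow> s \<in> ext q) \<and>
     (\<forall>s\<in>ext q. \<forall>n\<in>ext vomega. \<exists>t\<in>ext q. s \<unlhd> t \<and>
        app Kc n \<lesssim> succs q t)"

text \<open>All clauses of \<open>perfect\<close>, including the comparison
  \<open>\<lesssim>\<close>, are first-order over \<open>M\<close>, which makes the conditions a set
  of the model.\<close>

definition PP :: 'a where "PP = vset {q \<in> ext (pow Nd). perfect q}"

lemma PP_M: "PP \<in> M"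
  unfolding PP_def perfect_def
  by (rule in_M) (rule term_const[OF Nd(1)] term_const[OF Kc(1)] dfn term_const omega_M empty_M)+

lemma mem_PP: "q \<in> ext PP \<longleftrightarrow> q \<in> M \<and> perfect q"
  unfolding PP_def mem_vset_Collect unfolding ext_pow[OF Nd(1)] by (auto simp: perfect_def)

lemma perfect_iff:
  assumes "q \<in> M"
  shows "(\<exists>T. ext q = vlist ` T \<and> perfect_tree_in M K T) \<longleftrightarrow> perfect q"
proof
  assume "\<exists>T. ext q = vlist ` T \<and> perfect_tree_in M K T"
  then obtain T where T: "ext q = vlist ` T" "perfect_tree_in M K T" by blast
  then have T': "T \<noteq> {}" "T \<subseteq> nodes K" "\<And>s t. t \<in> T \<Longrightarrow> prefix s t \<Longrightarrow> s \<in> T"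
    "\<And>s n. s \<in> T \<Longrightarrow> \<exists>t\<in>T. prefix s t \<and> card_le_in M (ext (K n)) (vlist ` tree_succ T t)"
    unfolding perfect_tree_in_def tree_def by blast+
  have succ: "vlist ` tree_succ T t = ext (succs q (vlist t))" if "t \<in> T" for t
  proof -
    have "tree_succ T t = {u \<in> T. isucc (vlist t) (vlist u)}"
      using that T'(2) isucc_vlist unfolding tree_succ_def by blast
    then show ?thesis by (auto simp: T(1))
  qed
  show "perfect q"
    unfolding perfect_def
  proof (intro conjI ballI impI)
    show "q \<unlhd> Nd" using T'(2) unfolding T(1) Nd(2) by blast
    show "q \<noteq> vset {}" using T'(1) unfolding ext_empty_iff[symmetric] T(1) by blast
    show "s \<in> ext q" if "t \<in> ext q" "s \<in> ext Nd" "s \<unlhd> t" for s t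
      using that T'(3) unfolding T(1) Nd(2) by auto
    show "\<exists>t\<in>ext q. s \<unlhd> t \<and> app Kc n \<lesssim> succs q t"
      if s: "s \<in> ext q" and n: "n \<in> ext vomega" for s n
    proof -
      obtain l where l: "l \<in> T" "s = vlist l" using s T(1) by blast
      obtain m where m: "n = vnat m" using n by auto
      obtain t where t: "t \<in> T" "prefix l t" "card_le_in M (ext (K m)) (vlist ` tree_succ T t)"
        using T'(4)[OF l(1)] by blast
      then show ?thesis
        using l m succ[OF t(1)] by (intro bexI[of _ "vlist t"]) (simp_all add: T(1) del: ext_succs)
    qed
  qed
next
  assume q: "perfect q"
  define T where "T = {t \<in> nodes K. vlist t \<in> ext q}"
  have T: "ext q = vlist ` T"
    using q unfolding T_def perfect_def Nd(2) by blast
  have succ: "vlist ` tree_succ T t = ext (succs q (vlist t))" if "t \<in> T" for t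
  proof -
    have "tree_succ T t = {u \<in> T. isucc (vlist t) (vlist u)}"
      using that isucc_vlist unfolding tree_succ_def T_def by blast
    then show ?thesis by (auto simp: T)
  qed
  have split: "\<exists>t\<in>T. prefix s t \<and> card_le_in M (ext (K n)) (vlist ` tree_succ T t)" if "s \<in> T" for s n
  proof -
    have "vlist s \<in> ext q" "(vnat n :: 'a) \<in> ext vomega" using that T by auto
    then obtain t where t: "t \<in> ext q" "vlist s \<unlhd> t"
        "app Kc (vnat n) \<lesssim> succs q t"
      using q unfolding perfect_def by blast
    then obtain l where "l \<in> T" "t = vlist l" using T by blast
    then show ?thesis using t(2,3) succ by (intro bexI[of _ l]) (simp_all del: ext_succs)
  qed
  have "perfect_tree_in M K T"
    unfolding perfect_tree_in_def tree_def
  proof (intro conjI ballI allI impI)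
    show "T \<noteq> {}" using q T unfolding perfect_def ext_empty_iff[symmetric] by blast
    show "T \<subseteq> nodes K" unfolding T_def by blast
    show "s \<in> T" if "t \<in> T" "prefix s t" for s t
      using that q nodes_prefix unfolding T_def perfect_def Nd(2) by auto
    show "\<exists>t\<in>T. strict_prefix s t" if s: "s \<in> T" for s
    proof -
      obtain t where t: "t \<in> T" "prefix s t" "card_le_in M (ext (K 0)) (vlist ` tree_succ T t)"
        using split[OF s] by blast
      obtain u where "u \<in> tree_succ T t" using two_elements[OF t(3)] by blast
      then obtain a where "u \<in> T" "u = t @ [a]" by (auto simp: tree_succ_def)
      then show ?thesis using t(2) by (intro bexI[of _ u]) (auto simp: strict_prefix_def)
    qed
  qed (rule split)
  then show "\<exists>T. ext q = vlist ` T \<and> perfect_tree_in M K T" using T by blast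
qed

lemma ext_PP: "ext PP = perfect_trees M K"
  using perfect_iff by (intro set_eqI) (simp only: perfect_trees_def mem_PP mem_Collect_eq, blast)

lemma PP_nodes: "q \<in> ext PP \<Longrightarrow> s \<in> ext q \<Longrightarrow> s \<in> ext Nd"
  unfolding mem_PP perfect_def by blast

lemma PP_closed: "q \<in> ext PP \<Longrightarrow> t \<in> ext q \<Longrightarrow> s \<in> ext Nd \<Longrightarrow> s \<unlhd> t \<Longrightarrow> s \<in> ext q"
  unfolding mem_PP perfect_def by blast

lemma PP_split:
  assumes "q \<in> ext PP" "s \<in> ext q"
  shows "\<exists>t\<in>ext q. s \<unlhd> t \<and> K n \<lesssim> succs q t"
  using assms unfolding mem_PP perfect_def by (metis app_Kc ext_omega rangeI)

lemma PP_ex: "q \<in> ext PP \<Longrightarrow> \<exists>s. s \<in> ext q"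
  unfolding mem_PP perfect_def ext_empty_iff[symmetric] by blast

lemma PP_I:
  assumes "q \<in> M" "q \<unlhd> Nd" "s0 \<in> ext q"
    "\<And>s t. t \<in> ext q \<Longrightarrow> s \<in> ext Nd \<Longrightarrow> s \<unlhd> t \<Longrightarrow> s \<in> ext q"
    "\<And>s n. s \<in> ext q \<Longrightarrow> \<exists>t\<in>ext q. s \<unlhd> t \<and> K n \<lesssim> succs q t"
  shows "q \<in> ext PP"
proof -
  have "q \<noteq> vset {}" using assms(3) by auto
  moreover have "\<exists>t\<in>ext q. s \<unlhd> t \<and> app Kc n \<lesssim> succs q t"
    if "s \<in> ext q" "n \<in> ext vomega" for s n
    using assms(5)[OF that(1)] that(2) by (auto simp del: ext_succs)
  ultimately show ?thesis using assms(1,2,4) unfolding mem_PP perfect_def by blast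
qed

lemma PP_elem_M: "q \<in> ext PP \<Longrightarrow> q \<in> M"
  by (simp add: mem_PP)

lemma restr_PP:
  assumes q: "q \<in> ext PP" and s: "s \<in> ext q" shows "restr q s \<in> ext PP"
proof (rule PP_I)
  show "restr q s \<in> M"
    by (rule in_M) (rule dfn term_const PP_elem_M[OF q] mem_M[OF s])+
  show "s \<in> ext (restr q s)" using s by simp
  show "restr q s \<unlhd> Nd" using PP_nodes[OF q] by auto
  show "s' \<in> ext (restr q s)" if t: "t \<in> ext (restr q s)" and s': "s' \<in> ext Nd" "s' \<unlhd> t" for s' t
  proof -
    have "s' \<in> ext q" using PP_closed[OF q _ s'] t by simp
    moreover have "s' \<unlhd> s \<or> s \<unlhd> s'"
      using t s' nodes_comparable[of t s' s] PP_nodes[OF q] s by auto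
    ultimately show ?thesis by simp
  qed
  show "\<exists>t\<in>ext (restr q s). s' \<unlhd> t \<and> K n \<lesssim> succs (restr q s) t"
    if s': "s' \<in> ext (restr q s)" for s' n
  proof -
    \<comment> \<open>Restriction to \<open>s\<close> destroys splitting at nodes properly below
      \<open>s\<close>, so the search starts at the longer of \<open>s\<close> and
      \<open>s'\<close>.\<close>
    obtain s1 where s1: "s1 \<in> ext q" "s \<unlhd> s1" "s' \<unlhd> s1"
      using s' s by auto
    obtain t where t: "t \<in> ext q" "s1 \<unlhd> t" "K n \<lesssim> succs q t"
      using PP_split[OF q s1(1)] by blast
    have "succs q t \<unlhd> succs (restr q s) t"
      using s1(2) t(2) isuccD(3) by fastforce
    then show ?thesis
      using t s1 card_le_mono[OF t(3)] by (intro bexI[of _ t]) (auto simp del: ext_succs)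
  qed
qed

end

section \<open>Fusion\<close>

text \<open>At a condition \<open>r\<close> of stage \<open>n\<close> the node \<open>\<tau> n r\<close> is made to split into the successors
  in \<open>U n r\<close>, and the tree above \<open>u\<close> is shrunk to \<open>\<rho> n r u\<close>, a condition of stage \<open>n + 1\<close>.\<close>

locale fusion_scheme = trees +
  fixes Inv :: "'a \<Rightarrow> bool" and q0 :: 'a
    and \<tau> U :: "nat \<Rightarrow> 'a \<Rightarrow> 'a" and \<rho> :: "nat \<Rightarrow> 'a \<Rightarrow> 'a \<Rightarrow> 'a"
  assumes q0: "q0 \<in> ext PP" "Inv q0"
    and \<tau>: "\<And>n r. r \<in> ext PP \<Longrightarrow> Inv r \<Longrightarrow> \<tau> n r \<in> ext r"
    and U: "\<And>n r u. r \<in> ext PP \<Longrightarrow> Inv r \<Longrightarrow> u \<in> ext (U n r) \<Longrightarrow> u \<in> ext r \<and> isucc (\<tau> n r) u"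
    and U_card: "\<And>n r. r \<in> ext PP \<Longrightarrow> Inv r \<Longrightarrow> K n \<lesssim> U n r"
    and \<rho>: "\<And>n r u. r \<in> ext PP \<Longrightarrow> Inv r \<Longrightarrow> u \<in> ext (U n r) \<Longrightarrow>
        \<rho> n r u \<in> ext PP \<and> Inv (\<rho> n r u) \<and> \<rho> n r u \<unlhd> restr r u"
begin

section \<open>States of the construction and their tree order\<close>

definition root :: "nat \<times> 'a \<times> 'a" where "root = (0, vset {}, q0)"

definition good :: "nat \<times> 'a \<times> 'a \<Rightarrow> bool" where
  "good x \<longleftrightarrow> (case x of (n, v, r) \<Rightarrow> r \<in> ext PP \<and> Inv r)"

abbreviation tau :: "nat \<times> 'a \<times> 'a \<Rightarrow> 'a" where "tau x \<equiv> \<tau> (fst x) (snd (snd x))"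
abbreviation label :: "nat \<times> 'a \<times> 'a \<Rightarrow> 'a" where "label x \<equiv> fst (snd x)"
abbreviation tree_of :: "nat \<times> 'a \<times> 'a \<Rightarrow> 'a" where "tree_of x \<equiv> snd (snd x)"
abbreviation splits :: "nat \<times> 'a \<times> 'a \<Rightarrow> 'a" where "splits x \<equiv> U (fst x) (snd (snd x))"
abbreviation child :: "nat \<times> 'a \<times> 'a \<Rightarrow> 'a \<Rightarrow> nat \<times> 'a \<times> 'a" where
  "child x u \<equiv> (Suc (fst x), u, \<rho> (fst x) (snd (snd x)) u)"

text \<open>The stage and the label \<open>u\<close> from which a condition arose belong to the state, since the
  condition alone does not determine them.\<close>
definition step :: "((nat \<times> 'a \<times> 'a) \<times> nat \<times> 'a \<times> 'a) set" where
  "step = {(x, y). \<exists>u\<in>ext (splits x). y = child x u}"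

lemma step_iff: "(x, y) \<in> step \<longleftrightarrow> (\<exists>u\<in>ext (splits x). y = child x u)"
  by (simp add: step_def)

lemma step_child: "u \<in> ext (splits x) \<Longrightarrow> (x, child x u) \<in> step"
  unfolding step_iff by blast

lemma good_tree: "good x \<Longrightarrow> tree_of x \<in> ext PP \<and> Inv (tree_of x)"
  by (cases x) (simp add: good_def)

lemma good_child:
  assumes "good x" "u \<in> ext (splits x)"
  shows "good (child x u)" "tree_of (child x u) \<unlhd> restr (tree_of x) u"
  using \<rho>[of "tree_of x" u "fst x"] good_tree[OF assms(1)] assms(2) by (simp_all add: good_def)

lemma good_path:
  assumes "(x, y) \<in> step\<^sup>*" "good x" shows "good y \<and> tree_of y \<unlhd> tree_of x"
  using assms(1)
proof induction
  case (step y z)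
  then obtain u where u: "u \<in> ext (splits y)" "z = child y u" unfolding step_iff by blast
  have "good z" unfolding u(2) using good_child(1)[OF _ u(1)] step.IH by blast
  moreover have "tree_of z \<unlhd> tree_of y"
    using good_child(2)[OF _ u(1)] step.IH unfolding u(2) by auto
  ultimately show ?case using step.IH by blast
qed (use assms(2) in simp)

lemma tau_mem: "good x \<Longrightarrow> tau x \<in> ext (tree_of x)"
  using \<tau> good_tree by blast

lemma tau_node: "good x \<Longrightarrow> tau x \<in> ext Nd"
  using tau_mem PP_nodes good_tree by blast

lemma split_succ: "good x \<Longrightarrow> u \<in> ext (splits x) \<Longrightarrow> u \<in> ext (tree_of x) \<and> isucc (tau x) u"
  using U good_tree by blast

lemma two_splits:
  assumes "good x" obtains u v where "u \<in> ext (splits x)" "v \<in> ext (splits x)" "u \<noteq> v"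
  using two_elements[OF U_card] good_tree[OF assms] by blast

text \<open>All later trees lie inside \<open>restr (tree_of x) u\<close>, so their nodes are
  comparable with \<open>u\<close>. If \<open>u\<close> were not below \<open>tau z\<close>, the two
  successors into which \<open>tau z\<close> splits would both be below \<open>u\<close>, which is
  impossible for distinct successors of a node.\<close>

lemma label_below_tau:
  assumes x: "good x" and u: "u \<in> ext (splits x)" and y: "(child x u, y) \<in> step\<^sup>*"
  shows "u \<unlhd> tau y" "u \<unlhd> label y" "good y"
proof -
  have *: "good z \<and> u \<unlhd> tau z" if z: "(child x u, z) \<in> step\<^sup>*" for z
  proof -
    have gz: "good z" using good_path[OF z good_child(1)[OF x u]] by blast
    have sub: "tree_of z \<unlhd> restr (tree_of x) u"
      using good_path[OF z good_child(1)[OF x u]] good_child(2)[OF x u] by auto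
    have uN: "u \<in> ext Nd" using split_succ[OF x u] isuccD(2) by blast
    have "u \<unlhd> tau z"
    proof (rule ccontr)
      assume neg: "\<not> u \<unlhd> tau z"
      obtain v w where vw: "v \<in> ext (splits z)" "w \<in> ext (splits z)" "v \<noteq> w"
        by (rule two_splits[OF gz])
      have below: "v' \<unlhd> u" if v': "v' \<in> ext (splits z)" for v'
      proof -
        note s = split_succ[OF gz v']
        have "v' \<unlhd> u \<or> u \<unlhd> v'" using s sub by auto
        then show ?thesis
          using below_isucc[OF conjunct2[OF s] uN] neg by blast
      qed
      have "v = w"
        using isucc_unique[OF _ _ uN below[OF vw(1)] below[OF vw(2)]] split_succ[OF gz] vw by blast
      then show False using vw(3) by blast
    qed
    then show ?thesis using gz by blast
  qed
  from *[OF y] show "u \<unlhd> tau y" "good y" by blast+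
  from y show "u \<unlhd> label y"
  proof (cases rule: rtranclE)
    case (step z)
    then obtain w where w: "w \<in> ext (splits z)" "y = child z w" unfolding step_iff by blast
    have "tau z \<unlhd> w"
      using split_succ[OF _ w(1)] *[OF step(1)] isuccD(3) by blast
    then show ?thesis using *[OF step(1)] w(2) by auto
  qed auto
qed

lemma tau_mono:
  assumes "(x, y) \<in> step\<^sup>*" "good x" shows "tau x \<unlhd> tau y"
  using assms(1)
proof (cases rule: converse_rtranclE)
  case (step z)
  then obtain u where u: "u \<in> ext (splits x)" "z = child x u" unfolding step_iff by blast
  have "tau x \<unlhd> u" using split_succ[OF assms(2) u(1)] isuccD(3) by blast
  then show ?thesis using label_below_tau(1)[OF assms(2) u(1)] step(2) u(2) by blast
qed auto

text \<open>A child is determined by its label, so two paths that part at \<open>z\<close> do so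
  through different labels.\<close>

lemma paths_compare:
  assumes "(x0, x) \<in> step\<^sup>*" "(x0, y) \<in> step\<^sup>*"
  shows "(x, y) \<in> step\<^sup>* \<or> (y, x) \<in> step\<^sup>* \<or>
    (\<exists>z u w. (x0, z) \<in> step\<^sup>* \<and> u \<in> ext (splits z) \<and> w \<in> ext (splits z) \<and> u \<noteq> w \<and>
      (child z u, x) \<in> step\<^sup>* \<and> (child z w, y) \<in> step\<^sup>*)"
  using assms(2)
proof induction
  case base
  then show ?case using assms(1) by blast
next
  case (step y y')
  then obtain w where w: "w \<in> ext (splits y)" "y' = child y w" unfolding step_iff by blast
  from step.IH consider "(x, y) \<in> step\<^sup>*" | "(y, x) \<in> step\<^sup>*" |
    z u v where "(x0, z) \<in> step\<^sup>*" "u \<in> ext (splits z)" "v \<in> ext (splits z)" "u \<noteq> v"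
      "(child z u, x) \<in> step\<^sup>*" "(child z v, y) \<in> step\<^sup>*" by blast
  then show ?case
  proof cases
    case 1
    then show ?thesis using step.hyps(2) by (meson rtrancl.rtrancl_into_rtrancl)
  next
    case 2
    then show ?thesis
    proof (cases rule: converse_rtranclE)
      case base
      then show ?thesis using step.hyps(2) by blast
    next
      case (step y1)
      then obtain u where u: "u \<in> ext (splits y)" "y1 = child y u" unfolding step_iff by blast
      show ?thesis
      proof (cases "u = w")
        case True
        then show ?thesis using step(2) u(2) w(2) by blast
      next
        case False
        have "(child y u, x) \<in> step\<^sup>*" "(child y w, y') \<in> step\<^sup>*"
          using step(2) unfolding u(2) w(2) by auto
        then show ?thesis using \<open>(x0, y) \<in> step\<^sup>*\<close> u(1) w(1) False by blast
      qed
    qed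
  next
    case 3
    have "(child z v, y') \<in> step\<^sup>*" using 3(6) step.hyps(2) by (rule rtrancl_into_rtrancl)
    then show ?thesis using 3 by blast
  qed
qed

lemma good_root: "good root"
  using q0 by (simp add: good_def root_def)

definition reach :: "nat \<times> 'a \<times> 'a \<Rightarrow> bool" where "reach x \<longleftrightarrow> (root, x) \<in> step\<^sup>*"

lemma reach_good: "reach x \<Longrightarrow> good x"
  using good_path good_root unfolding reach_def by blast

lemma reach_step: "reach x \<Longrightarrow> (x, y) \<in> step\<^sup>* \<Longrightarrow> reach y"
  unfolding reach_def by (rule rtrancl_trans)

lemma reach_child: "reach x \<Longrightarrow> u \<in> ext (splits x) \<Longrightarrow> reach (child x u)"
  by (rule reach_step[OF _ r_into_rtrancl[OF step_child]])

lemma reach_compare: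
  assumes "reach x" "reach y"
  obtains "(x, y) \<in> step\<^sup>*" | "(y, x) \<in> step\<^sup>*" |
    z u w where "reach z" "u \<in> ext (splits z)" "w \<in> ext (splits z)" "u \<noteq> w"
      "(child z u, x) \<in> step\<^sup>*" "(child z w, y) \<in> step\<^sup>*"
  using paths_compare[of root x y] assms unfolding reach_def by blast

text \<open>A converse of \<open>label_below_tau\<close>. If \<open>y\<close> came earlier, a
  successor of \<open>tau y\<close> would be below \<open>tau y\<close>; if it branched off
  elsewhere, two distinct successors of one node would be below \<open>tau y\<close>.\<close>

lemma label_below_reach:
  assumes x: "reach x" "u \<in> ext (splits x)" and y: "reach y" "u \<unlhd> tau y"
  shows "(child x u, y) \<in> step\<^sup>*"
proof -
  note gx = reach_good[OF x(1)] and gy = reach_good[OF y(1)]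
  show ?thesis
  proof (rule reach_compare[OF reach_child[OF x] y(1)])
    assume "(y, child x u) \<in> step\<^sup>*"
    then show ?thesis
    proof (cases rule: converse_rtranclE)
      case (step y1)
      then obtain w where w: "w \<in> ext (splits y)" "y1 = child y w" unfolding step_iff by blast
      have "w \<unlhd> u"
        using label_below_tau(2)[OF gy w(1)] step(2) unfolding w(2) by fastforce
      then have "w \<unlhd> tau y" using y(2) by blast
      then show ?thesis using isuccD(4) split_succ[OF gy w(1)] by blast
    qed auto
  next
    fix z v w assume z: "reach z" "v \<in> ext (splits z)" "w \<in> ext (splits z)" "v \<noteq> w"
      "(child z v, child x u) \<in> step\<^sup>*" "(child z w, y) \<in> step\<^sup>*"
    note gz = reach_good[OF z(1)]
    have "v \<unlhd> u" using label_below_tau(2)[OF gz z(2,5)] by simp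
    then have "v \<unlhd> tau y" using y(2) by blast
    moreover have "w \<unlhd> tau y" by (rule label_below_tau(1)[OF gz z(3,6)])
    ultimately have "v = w"
      using isucc_unique[OF _ _ tau_node[OF gy]] split_succ[OF gz] z(2,3) by blast
    then show ?thesis using z(4) by blast
  qed blast
qed

text \<open>The fusion is generated by the splitting nodes rather than defined as an intersection of
  levels. That it splits often is then immediate; its relation to the trees of the stages is the
  content of \<open>fused_restr\<close> and \<open>fused_cover\<close>.\<close>

definition fused :: "'a set" where
  "fused = {s \<in> ext Nd. \<exists>x. reach x \<and> s \<unlhd> tau x}"

lemma label_mem_tree:
  assumes "good x" "u \<in> ext (splits x)" shows "u \<in> ext (tree_of (child x u))"
proof -
  note g = good_child(1)[OF assms]
  have "u \<unlhd> tau (child x u)" by (rule label_below_tau(1)[OF assms rtrancl_refl])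
  moreover have "u \<in> ext Nd" using split_succ[OF assms] isuccD(2) by blast
  ultimately show ?thesis using PP_closed[OF _ tau_mem[OF g]] good_tree[OF g] by blast
qed

lemma split_mem_fused:
  assumes "reach x" "u \<in> ext (splits x)" shows "u \<in> fused"
proof -
  have "u \<unlhd> tau (child x u)"
    by (rule label_below_tau(1)[OF reach_good[OF assms(1)] assms(2) rtrancl_refl])
  moreover have "u \<in> ext Nd" using split_succ[OF reach_good[OF assms(1)] assms(2)] isuccD(2) by blast
  ultimately show ?thesis using reach_child[OF assms] unfolding fused_def by blast
qed

lemma fused_closed: "t \<in> fused \<Longrightarrow> s \<in> ext Nd \<Longrightarrow> s \<unlhd> t \<Longrightarrow> s \<in> fused"
  unfolding fused_def by blast

lemma fused_subset: "fused \<subseteq> ext q0"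
proof
  fix s assume "s \<in> fused"
  then obtain x where x: "s \<in> ext Nd" "reach x" "s \<unlhd> tau x" unfolding fused_def by blast
  have "tau x \<in> ext q0"
    using tau_mem[OF reach_good[OF x(2)]] good_path[OF _ good_root, of x] x(2)
    unfolding reach_def root_def by auto
  then show "s \<in> ext q0" using PP_closed[OF q0(1) _ x(1,3)] by blast
qed

lemma reach_level: assumes "reach x" shows "\<exists>y. (x, y) \<in> step\<^sup>* \<and> fst y = fst x + n"
proof (induction n)
  case 0
  show ?case by (intro exI[of _ x]) simp
next
  case (Suc n)
  then obtain y where y: "(x, y) \<in> step\<^sup>*" "fst y = fst x + n" by blast
  obtain u where "u \<in> ext (splits y)"
    using two_splits[OF reach_good[OF reach_step[OF assms y(1)]]] by blast
  then have "(x, child y u) \<in> step\<^sup>*"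
    using y(1) step_child by (meson rtrancl.rtrancl_into_rtrancl)
  then show ?case using y(2) by (intro exI[of _ "child y u"]) simp
qed

lemma fused_split:
  assumes "s \<in> fused"
  shows "\<exists>t\<in>fused. s \<unlhd> t \<and> card_le_in M (ext (K n)) {u \<in> fused. isucc t u}"
proof -
  obtain x where x: "s \<in> ext Nd" "reach x" "s \<unlhd> tau x" using assms unfolding fused_def by blast
  obtain y where y: "(x, y) \<in> step\<^sup>*" "fst y = fst x + n" using reach_level[OF x(2)] by blast
  note ry = reach_step[OF x(2) y(1)]
  note gy = reach_good[OF ry]
  have "K n \<lesssim> splits y"
    by (rule card_le_K_mono[of _ "fst y"]) (use y(2) U_card good_tree[OF gy] in auto)
  moreover have "ext (splits y) \<subseteq> {u \<in> fused. isucc (tau y) u}"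
    using split_mem_fused[OF ry] split_succ[OF gy] by blast
  ultimately have "card_le_in M (ext (K n)) {u \<in> fused. isucc (tau y) u}" by (rule card_le_mono)
  moreover have "tau y \<in> fused" using tau_node[OF gy] ry unfolding fused_def by blast
  moreover have "s \<unlhd> tau y"
    using x(3) tau_mono[OF y(1) reach_good[OF x(2)]] by blast
  ultimately show ?thesis by blast
qed

text \<open>Nodes of the fusion above \<open>u\<close> come from states after
  \<open>child x u\<close> only, by \<open>label_below_reach\<close>; nodes below \<open>u\<close>
  belong to every condition that contains \<open>u\<close>.\<close>

lemma fused_restr:
  assumes x: "reach x" "u \<in> ext (splits x)"
    and s: "s \<in> fused" "s \<unlhd> u \<or> u \<unlhd> s"
  shows "s \<in> ext (tree_of (child x u))"
proof -
  note gx = reach_good[OF x(1)]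
  note gc = good_child(1)[OF gx x(2)]
  have sN: "s \<in> ext Nd" using s(1) unfolding fused_def by blast
  from s(2) show ?thesis
  proof
    assume "s \<unlhd> u"
    then show ?thesis
      using PP_closed[OF _ label_mem_tree[OF gx x(2)] sN] good_tree[OF gc] by blast
  next
    assume us: "u \<unlhd> s"
    obtain y where y: "reach y" "s \<unlhd> tau y" using s(1) unfolding fused_def by blast
    have "(child x u, y) \<in> step\<^sup>*"
      by (rule label_below_reach[OF x y(1)]) (use us y(2) in blast)
    then have "tau y \<in> ext (tree_of (child x u))"
      using good_path[OF _ gc] tau_mem[OF reach_good[OF y(1)]] by blast
    then show ?thesis using PP_closed[OF _ _ sN y(2)] good_tree[OF gc] by blast
  qed
qed

text \<open>The fusion branches only where a state was made to split: the states responsible for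
  \<open>u\<close> and \<open>v\<close> part somewhere, and the two labels there must be
  \<open>u\<close> and \<open>v\<close>.\<close>

lemma fused_succs:
  assumes u: "u \<in> fused" "isucc t u" and v: "v \<in> fused" "isucc t v" and ne: "u \<noteq> v"
  shows "\<exists>x. reach x \<and> u \<in> ext (splits x) \<and> v \<in> ext (splits x)"
proof -
  obtain x where x: "reach x" "u \<unlhd> tau x" using u(1) unfolding fused_def by blast
  obtain y where y: "reach y" "v \<unlhd> tau y" using v(1) unfolding fused_def by blast
  note gx = reach_good[OF x(1)] and gy = reach_good[OF y(1)]
  note Nx = tau_node[OF gx] and Ny = tau_node[OF gy]
  note nu = isuccD[OF u(2)] and nv = isuccD[OF v(2)]
  have no: "\<not> (u \<unlhd> w \<and> v \<unlhd> w)" if "w \<in> ext Nd" for w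
    using isucc_unique[OF u(2) v(2) that] ne by blast
  show ?thesis
  proof (rule reach_compare[OF x(1) y(1)])
    assume "(x, y) \<in> step\<^sup>*"
    then show ?thesis using tau_mono[OF _ gx] x(2) y(2) no[OF Ny] by blast
  next
    assume "(y, x) \<in> step\<^sup>*"
    then show ?thesis using tau_mono[OF _ gy] x(2) y(2) no[OF Nx] by blast
  next
    fix z u0 w0 assume z: "reach z" "u0 \<in> ext (splits z)" "w0 \<in> ext (splits z)" "u0 \<noteq> w0"
      "(child z u0, x) \<in> step\<^sup>*" "(child z w0, y) \<in> step\<^sup>*"
    note gz = reach_good[OF z(1)]
    note su = split_succ[OF gz z(2), THEN conjunct2] and sw = split_succ[OF gz z(3), THEN conjunct2]
    note ux = label_below_tau(1)[OF gz z(2,5)] and wy = label_below_tau(1)[OF gz z(3,6)]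
    note mu = isuccD[OF su] and mw = isuccD[OF sw]
    have no': "\<not> (u0 \<unlhd> w \<and> w0 \<unlhd> w)" if "w \<in> ext Nd" for w
      using isucc_unique[OF su sw that] z(4) by blast
    \<comment> \<open>Both are below \<open>tau x\<close>, hence comparable. If \<open>u\<close>
      were the shorter one, it would be below \<open>tau z\<close> and so below
      \<open>tau y\<close>, together with \<open>v\<close>; if \<open>u0\<close> were, it would be
      below \<open>t\<close> and so below \<open>tau y\<close>, together with
      \<open>w0\<close>.\<close>
    have "u = u0"
    proof -
      have "u \<unlhd> u0 \<or> u0 \<unlhd> u"
        by (rule nodes_comparable[OF Nx nu(2) mu(2) x(2) ux])
      then show ?thesis
      proof
        assume "u \<unlhd> u0"
        then consider "u \<unlhd> tau z" | "u = u0" using below_isucc[OF su nu(2)] by blast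
        then show ?thesis
        proof cases
          case 1
          then have "u \<unlhd> tau y" using mw(3) wy by blast
          then show ?thesis using no[OF Ny] y(2) by blast
        qed
      next
        assume "u0 \<unlhd> u"
        then consider "u0 \<unlhd> t" | "u0 = u" using below_isucc[OF u(2) mu(2)] by blast
        then show ?thesis
        proof cases
          case 1
          then have "u0 \<unlhd> tau y" using nv(3) y(2) by blast
          then show ?thesis using no'[OF Ny] wy by blast
        qed simp
      qed
    qed
    moreover have "v = w0"
    proof -
      have "v \<unlhd> w0 \<or> w0 \<unlhd> v"
        by (rule nodes_comparable[OF Ny nv(2) mw(2) y(2) wy])
      then show ?thesis
      proof
        assume "v \<unlhd> w0"
        then consider "v \<unlhd> tau z" | "v = w0" using below_isucc[OF sw nv(2)] by blast
        then show ?thesis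
        proof cases
          case 1
          then have "v \<unlhd> tau x" using mu(3) ux by blast
          then show ?thesis using no[OF Nx] x(2) by blast
        qed
      next
        assume "w0 \<unlhd> v"
        then consider "w0 \<unlhd> t" | "w0 = v" using below_isucc[OF v(2) mw(2)] by blast
        then show ?thesis
        proof cases
          case 1
          then have "w0 \<unlhd> tau x" using nu(3) x(2) by blast
          then show ?thesis using no'[OF Nx] ux by blast
        qed simp
      qed
    qed
    ultimately show ?thesis using z by blast
  qed
qed

text \<open>Since \<open>q\<close> contains two successors of one node, some \<open>s\<close> in
  \<open>q\<close> is not below \<open>tau x\<close>. The state that put \<open>s\<close> into the
  fusion must lie beyond \<open>x\<close>, behind a child whose label is below
  \<open>s\<close>.\<close>

lemma fused_enter:
  assumes q: "q \<in> ext PP" "ext q \<subseteq> fused" and x: "reach x" "q \<unlhd> tree_of x"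
  shows "\<exists>u\<in>ext (splits x). u \<in> ext q \<and> restr q u \<unlhd> tree_of (child x u)"
proof -
  note gx = reach_good[OF x(1)]
  note Nx = tau_node[OF gx]
  obtain s0 where "s0 \<in> ext q" using PP_ex[OF q(1)] by blast
  then obtain t where t: "t \<in> ext q" "K 0 \<lesssim> succs q t"
    using PP_split[OF q(1)] by blast
  obtain s where s: "s \<in> ext q" "\<not> s \<unlhd> tau x"
  proof -
    obtain u v where "u \<in> ext (succs q t)" "v \<in> ext (succs q t)" "u \<noteq> v"
      by (rule two_elements[OF t(2)])
    then show thesis using isucc_unique[of t u v, OF _ _ Nx] that by auto
  qed
  have sN: "s \<in> ext Nd" by (rule PP_nodes[OF q(1) s(1)])
  obtain y where y: "reach y" "s \<unlhd> tau y" using s(1) q(2) unfolding fused_def by blast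
  note gy = reach_good[OF y(1)]
  note Ny = tau_node[OF gy]
  have "\<exists>u\<in>ext (splits x). u \<unlhd> s"
  proof (rule reach_compare[OF x(1) y(1)])
    assume "(x, y) \<in> step\<^sup>*"
    then show ?thesis
    proof (cases rule: converse_rtranclE)
      case base
      then show ?thesis using y(2) s(2) by blast
    next
      case (step x1)
      then obtain u where u: "u \<in> ext (splits x)" "x1 = child x u" unfolding step_iff by blast
      note su = split_succ[OF gx u(1), THEN conjunct2]
      have "u \<unlhd> tau y" using label_below_tau(1)[OF gx u(1)] step(2) u(2) by blast
      then have "u \<unlhd> s \<or> s \<unlhd> u"
        by (rule nodes_comparable[OF Ny isuccD(2)[OF su] sN _ y(2)])
      then have "u \<unlhd> s" using below_isucc[OF su sN] s(2) by blast
      then show ?thesis using u(1) by blast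
    qed
  next
    assume "(y, x) \<in> step\<^sup>*"
    then show ?thesis using tau_mono[OF _ gy] y(2) s(2) by blast
  next
    fix z v w assume z: "reach z" "v \<in> ext (splits z)" "w \<in> ext (splits z)" "v \<noteq> w"
      "(child z v, x) \<in> step\<^sup>*" "(child z w, y) \<in> step\<^sup>*"
    note gz = reach_good[OF z(1)]
    note sv = split_succ[OF gz z(2), THEN conjunct2] and sw = split_succ[OF gz z(3), THEN conjunct2]
    have "q \<unlhd> restr (tree_of z) v"
      using x(2) good_path[OF z(5) good_child(1)[OF gz z(2)]] good_child(2)[OF gz z(2)] by blast
    then have "s \<unlhd> v \<or> v \<unlhd> s" using s(1) by auto
    moreover have "\<not> s \<unlhd> v" using label_below_tau(1)[OF gz z(2,5)] s(2) by blast
    ultimately have "v \<unlhd> tau y" using y(2) by blast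
    moreover have "w \<unlhd> tau y" by (rule label_below_tau(1)[OF gz z(3,6)])
    ultimately show ?thesis using isucc_unique[OF sv sw Ny] z(4) by blast
  qed
  then obtain u where u: "u \<in> ext (splits x)" "u \<unlhd> s" by blast
  have "u \<in> ext q"
    using PP_closed[OF q(1) s(1) _ u(2)] split_succ[OF gx u(1)] isuccD(2) by blast
  moreover have "restr q u \<unlhd> tree_of (child x u)"
    using fused_restr[OF x(1) u(1)] q(2) by auto
  ultimately show ?thesis using u(1) by blast
qed

text \<open>The trees of each stage are predense below the fusion. This is how decisions made at the
  stages reach arbitrary conditions below it.\<close>

lemma fused_cover:
  assumes q: "q \<in> ext PP" "ext q \<subseteq> fused"
  shows "\<exists>q'\<in>ext PP. q' \<unlhd> q \<and> (\<exists>x. reach x \<and> fst x = n \<and> q' \<unlhd> tree_of x)"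
proof (induction n)
  case 0
  have "q \<unlhd> tree_of root" using q(2) fused_subset by (simp add: root_def)
  moreover have "reach root" "fst root = 0" by (simp_all add: reach_def root_def)
  ultimately show ?case using q(1) by blast
next
  case (Suc n)
  then obtain q' x where q': "q' \<in> ext PP" "q' \<unlhd> q" "reach x" "fst x = n"
    "q' \<unlhd> tree_of x" by blast
  then obtain u where u: "u \<in> ext (splits x)" "u \<in> ext q'" "restr q' u \<unlhd> tree_of (child x u)"
    using fused_enter[OF q'(1) _ q'(3,5)] q(2) by blast
  have "restr q' u \<in> ext PP" by (rule restr_PP[OF q'(1) u(2)])
  moreover have "restr q' u \<unlhd> q" using q'(2) by auto
  moreover have "fst (child x u) = Suc n" using q'(4) by simp
  ultimately show ?case using reach_child[OF q'(3) u(1)] u(3) by blast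
qed

end

lemma vpair_components: "vset {x, y} \<in> ext (vpair x y)"
  by (simp add: vpair_def)

context ctm begin

lemma vpair_M: assumes "vpair x y \<in> M" shows "x \<in> M" "y \<in> M"
  using mem_M[OF _ mem_M[OF vpair_components assms]] by simp_all

end

context fusion_scheme begin

lemma reach_0: "reach (0, v, r) \<longleftrightarrow> v = vset {} \<and> r = q0"
proof
  assume "reach (0, v, r)"
  then have "(root, (0, v, r)) \<in> step\<^sup>*" by (simp add: reach_def)
  then show "v = vset {} \<and> r = q0"
    by (cases rule: rtranclE) (auto simp: root_def step_iff)
qed (simp add: reach_def root_def)

text \<open>Reachability is defined by paths outside the model; this form is the one that recursion
  on omega can reproduce inside \<open>M\<close>.\<close>

lemma reach_Suc:
  "reach (Suc n, u, r') \<longleftrightarrow> (\<exists>v r. reach (n, v, r) \<and> u \<in> ext (U n r) \<and> r' = \<rho> n r u)"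
proof
  assume "reach (Suc n, u, r')"
  then have "(root, (Suc n, u, r')) \<in> step\<^sup>*" by (simp add: reach_def)
  then show "\<exists>v r. reach (n, v, r) \<and> u \<in> ext (U n r) \<and> r' = \<rho> n r u"
  proof (cases rule: rtranclE)
    case (step y)
    obtain m v r where "y = (m, v, r)" by (cases y)
    then show ?thesis using step by (auto simp: step_iff reach_def)
  qed (simp add: root_def)
next
  assume "\<exists>v r. reach (n, v, r) \<and> u \<in> ext (U n r) \<and> r' = \<rho> n r u"
  then obtain v r where *: "reach (n, v, r)" "u \<in> ext (U n r)" "r' = \<rho> n r u" by blast
  then show "reach (Suc n, u, r')" using reach_child[of "(n, v, r)" u] by simp
qed

end

context trees begin

text \<open>\<open>J\<close> records what each splitting step achieves. It is handed back in two
  forms: every condition below \<open>Q\<close> is compatible with an outcome of each stage, and any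
  two distinct successors in \<open>Q\<close> were treated by a common step.\<close>

lemma fusion:
  assumes q0: "q0 \<in> ext PP" "Inv q0" and Inv: "Def (\<lambda>e. Inv (e 0))"
    and J: "Def (\<lambda>e. J (e 0) (e 1) (e 2))"
    and step: "\<And>n r. r \<in> ext PP \<Longrightarrow> Inv r \<Longrightarrow> \<exists>t\<in>ext r. \<exists>U\<in>M. \<exists>f. lam U f \<in> M \<and>
      U \<unlhd> succs r t \<and> K n \<lesssim> U \<and>
      (\<forall>u\<in>ext U. f u \<in> ext PP \<and> Inv (f u) \<and> f u \<unlhd> restr r u) \<and>
      J (vnat n) U (lam U f)"
  obtains Q where "Q \<in> ext PP" "Q \<unlhd> q0"
    "\<forall>q n. q \<in> ext PP \<and> q \<unlhd> Q \<longrightarrow> (\<exists>U h u q'. J (vnat n) U h \<and> u \<in> ext U \<and>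
       q' \<in> ext PP \<and> q' \<unlhd> q \<and> q' \<unlhd> app h u)"
    "\<forall>t u v. u \<in> ext (succs Q t) \<and> v \<in> ext (succs Q t) \<and> u \<noteq> v \<longrightarrow>
       (\<exists>n U h. J (vnat n) U h \<and> u \<in> ext U \<and> v \<in> ext U \<and>
         restr Q u \<unlhd> app h u \<and> restr Q v \<unlhd> app h v)"
proof -
  define SC where "SC i r t U h \<longleftrightarrow> t \<in> ext r \<and> U \<unlhd> succs r t \<and>
      app Kc i \<lesssim> U \<and>
      (\<forall>u\<in>ext U. app h u \<in> ext PP \<and> Inv (app h u) \<and> app h u \<unlhd> restr r u) \<and>
      J i U h" for i r t U h
  define D where "D = vset {r \<in> ext PP. Inv r}"
  have D: "D \<in> M" unfolding D_def by (rule in_M) (rule term_const[OF PP_M] dfn definable1[OF Inv])+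
  have mem_D: "r \<in> ext D \<longleftrightarrow> r \<in> ext PP \<and> Inv r" for r
    unfolding D_def by (rule mem_vset_Collect)
  define a where "a = cart vomega D"
  \<comment> \<open>The range of the choice function: the node, the set of chosen successors and the
    function giving the new trees, as a coded triple.\<close>
  define b where "b = cart Nd (cart (pow Nd) (pow (cart Nd PP)))"
  define R where "R z y \<longleftrightarrow> (\<exists>i\<in>M. \<exists>r\<in>M. \<exists>t\<in>M. \<exists>U\<in>M. \<exists>h\<in>M.
      z = vpair i r \<and> y = vpair t (vpair U h) \<and> SC i r t U h)" for z y
  have aM: "a \<in> M" unfolding a_def by (rule in_M) (rule dfn term_const omega_M D)+
  have bM: "b \<in> M" unfolding b_def by (rule in_M) (rule dfn term_const Nd(1) PP_M)+
  obtain c where c: "lam a c \<in> M" "\<And>z. z \<in> ext a \<Longrightarrow> c z \<in> ext b \<and> R z (c z)"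
  proof (rule choice_rel[OF aM bM, of R])
    show "Def (\<lambda>e. R (e 0) (e 1))"
      unfolding R_def SC_def
      by (rule term_const[OF PP_M] term_const[OF Kc(1)] dfn definable1[OF Inv] definable3[OF J])+
    fix z assume "z \<in> ext a"
    then obtain n r where z: "z = vpair (vnat n) r" "r \<in> ext PP" "Inv r"
      unfolding a_def ext_cart by (auto simp: mem_D)
    obtain t U f where *: "t \<in> ext r" "U \<in> M" "lam U f \<in> M" "U \<unlhd> succs r t"
      "K n \<lesssim> U" "J (vnat n) U (lam U f)"
      "\<And>u. u \<in> ext U \<Longrightarrow> f u \<in> ext PP \<and> Inv (f u) \<and> f u \<unlhd> restr r u"
      using step[OF z(2,3), of n] by blast
    have UN: "U \<unlhd> Nd" using *(4) PP_nodes[OF z(2)] by auto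
    have SC: "SC (vnat n) r t U (lam U f)"
      unfolding SC_def using * by (auto simp del: ext_succs ext_restr)
    have rM: "r \<in> M" "t \<in> M" using PP_elem_M[OF z(2)] mem_M[OF *(1)] by blast+
    have "cart Nd PP \<in> M" by (rule in_M) (rule dfn term_const Nd(1) PP_M)+
    then have "lam U f \<in> ext (pow (cart Nd PP))"
      using *(3,7) UN by (auto simp: ext_pow)
    moreover have "U \<in> ext (pow Nd)" using *(2) UN by (simp add: ext_pow[OF Nd(1)])
    moreover have "t \<in> ext Nd" using PP_nodes[OF z(2) *(1)] .
    ultimately have "vpair t (vpair U (lam U f)) \<in> ext b" by (simp add: b_def)
    moreover have "R z (vpair t (vpair U (lam U f)))"
      unfolding R_def z(1) using SC rM *(2,3) vnat_M by blast
    ultimately show "\<exists>y\<in>ext b. R z y" by blast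
  qed (erule that, blast)
  define C where "C = lam a c"
  \<comment> \<open>\<open>SOME\<close> unpacks the coded triple, which is unique because pairing is
    injective; values at other \<open>r\<close> do not matter.\<close>
  define pick where "pick n r = (SOME y. c (vpair (vnat n) r) = vpair (fst y) (vpair (fst (snd y)) (snd (snd y))) \<and>
      SC (vnat n) r (fst y) (fst (snd y)) (snd (snd y)))" for n r
  define \<tau> where "\<tau> n r = fst (pick n r)" for n r
  define U where "U n r = fst (snd (pick n r))" for n r
  define h where "h n r = snd (snd (pick n r))" for n r
  have *: "c (vpair (vnat n) r) = vpair (\<tau> n r) (vpair (U n r) (h n r)) \<and>
      SC (vnat n) r (\<tau> n r) (U n r) (h n r)" if r: "r \<in> ext PP" "Inv r" for n r
  proof -
    have "vpair (vnat n) r \<in> ext a" using r by (simp add: a_def mem_D)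
    then have "R (vpair (vnat n) r) (c (vpair (vnat n) r))" using c(2) by blast
    then obtain i r' t V g where eq: "vpair (vnat n) r = vpair i r'"
        "c (vpair (vnat n) r) = vpair t (vpair V g)" "SC i r' t V g"
      unfolding R_def by blast
    have "i = vnat n" "r' = r" using eq(1) by (simp_all only: vpair_inject)
    then have "c (vpair (vnat n) r) = vpair (fst (t, V, g)) (vpair (fst (snd (t, V, g))) (snd (snd (t, V, g)))) \<and>
      SC (vnat n) r (fst (t, V, g)) (fst (snd (t, V, g))) (snd (snd (t, V, g)))"
      using eq(2,3) by (simp only: fst_conv snd_conv simp_thms)
    then show ?thesis
      unfolding \<tau>_def U_def h_def pick_def by (rule someI)
  qed
  have SC: "SC (vnat n) r (\<tau> n r) (U n r) (h n r)" if "r \<in> ext PP" "Inv r" for n r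
    using *[OF that] by blast
  have C_mem: "vpair (vpair (vnat n) r) (vpair t (vpair V g)) \<in> ext C \<longleftrightarrow>
      t = \<tau> n r \<and> V = U n r \<and> g = h n r" if "r \<in> ext PP" "Inv r" for n r t V g
    using *[OF that, of n] that unfolding C_def ext_lam by (auto simp: a_def mem_D image_iff)
  interpret S: fusion_scheme M K Inv q0 \<tau> U "\<lambda>n r u. app (h n r) u"
  proof
    show "q0 \<in> ext PP" "Inv q0" by (fact q0)+
    fix n r assume r: "r \<in> ext PP" "Inv r"
    note sc = SC[OF r, of n, unfolded SC_def]
    show "\<tau> n r \<in> ext r" using sc by blast
    show "K n \<lesssim> U n r" using sc by simp
    show "u \<in> ext r \<and> isucc (\<tau> n r) u" if "u \<in> ext (U n r)" for u
      using sc that by auto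
    show "app (h n r) u \<in> ext PP \<and> Inv (app (h n r) u) \<and> app (h n r) u \<unlhd> restr r u"
      if "u \<in> ext (U n r)" for u
      using sc that by blast
  qed
  have comp_M: "t \<in> M \<and> V \<in> M \<and> g \<in> M"
    if "vpair (vpair i r) (vpair t (vpair V g)) \<in> ext C" for i r t V g
  proof -
    have "vpair (vpair i r) (vpair t (vpair V g)) \<in> M" using that c(1) mem_M unfolding C_def by blast
    from vpair_M(2)[OF this] show ?thesis using vpair_M by blast
  qed
  \<comment> \<open>From the labelled conditions of stage n to those of the next stage;
    \<open>cart Nd PP\<close> serves only as a bound for separation.\<close>
  let ?g = "\<lambda>n X. vset {z \<in> ext (cart Nd PP). \<exists>v\<in>M. \<exists>r\<in>M. \<exists>t\<in>M. \<exists>V\<in>M. \<exists>g\<in>M. vpair v r \<in> ext X \<and>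
      vpair (vpair n r) (vpair t (vpair V g)) \<in> ext C \<and> (\<exists>u\<in>ext V. z = vpair u (app g u))}"
  have g: "Trm (\<lambda>e. ?g (e 0) (e 1))"
    by (rule term_const[OF c(1), folded C_def] dfn term_const Nd(1) PP_M)+
  have q0M: "q0 \<in> M" using PP_elem_M[OF q0(1)] .
  have "vset {vpair (vset {}) q0} \<in> M" by (rule in_M) (rule dfn term_const empty_M q0M)+
  then obtain F where F: "\<And>T. Trm T \<Longrightarrow> Trm (\<lambda>e. F (T e))" "F (vnat 0) = vset {vpair (vset {}) q0}"
    "\<And>n. F (vnat (Suc n)) = ?g (vnat n) (F (vnat n))"
    using omega_rec[OF _ g] by blast
  have FM: "F (vnat n) \<in> M" for n by (rule in_M) (rule F(1) dfn term_const vnat_M)+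
  have reach_F: "z \<in> ext (F (vnat n)) \<longleftrightarrow> (\<exists>v r. z = vpair v r \<and> S.reach (n, v, r))" for n z
  proof (induction n arbitrary: z)
    case 0
    show ?case unfolding F(2) by (auto simp: S.reach_0)
  next
    case (Suc n)
    show ?case
    proof
      assume "z \<in> ext (F (vnat (Suc n)))"
      then obtain v r t V g u where *: "vpair v r \<in> ext (F (vnat n))"
        "vpair (vpair (vnat n) r) (vpair t (vpair V g)) \<in> ext C" "u \<in> ext V" "z = vpair u (app g u)"
        unfolding F(3) mem_vset_Collect by blast
      have reach: "S.reach (n, v, r)" using Suc *(1) by auto
      then have "r \<in> ext PP" "Inv r" using S.reach_good S.good_tree by fastforce+
      then have "V = U n r" "g = h n r" using C_mem *(2) by blast+
      then show "\<exists>v r. z = vpair v r \<and> S.reach (Suc n, v, r)"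
        unfolding S.reach_Suc using reach *(3,4) by blast
    next
      assume "\<exists>v r. z = vpair v r \<and> S.reach (Suc n, v, r)"
      then obtain u v r where *: "S.reach (n, v, r)" "u \<in> ext (U n r)" "z = vpair u (app (h n r) u)"
        unfolding S.reach_Suc by blast
      have r: "r \<in> ext PP" "Inv r" using S.reach_good[OF *(1)] S.good_tree by fastforce+
      have vr: "vpair v r \<in> ext (F (vnat n))" using Suc *(1) by blast
      have vM: "v \<in> M" "r \<in> M" using vpair_M[OF mem_M[OF vr FM]] by blast+
      have C: "vpair (vpair (vnat n) r) (vpair (\<tau> n r) (vpair (U n r) (h n r))) \<in> ext C"
        using C_mem[OF r] by blast
      have "u \<in> ext Nd" "app (h n r) u \<in> ext PP"
        using S.U[OF r *(2)] PP_nodes[OF r(1)] S.\<rho>[OF r *(2)] by blast+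
      then have "z \<in> ext (cart Nd PP)" using *(3) by simp
      then show "z \<in> ext (F (vnat (Suc n)))"
        unfolding F(3) mem_vset_Collect using vM vr C comp_M[OF C] *(2,3) by blast
    qed
  qed
  define Q where "Q = vset {s \<in> ext Nd. \<exists>i\<in>ext vomega. \<exists>v\<in>M. \<exists>r\<in>M. \<exists>t\<in>M. \<exists>V\<in>M. \<exists>g\<in>M.
      vpair v r \<in> ext (F i) \<and> vpair (vpair i r) (vpair t (vpair V g)) \<in> ext C \<and> s \<unlhd> t}"
  have QM: "Q \<in> M"
    unfolding Q_def by (rule in_M) (rule term_const[OF c(1), folded C_def] dfn F(1) term_const Nd(1) omega_M)+
  have Q: "ext Q = S.fused"
  proof (intro set_eqI iffI)
    fix s assume "s \<in> ext Q"
    then obtain i v r t V g where *: "s \<in> ext Nd" "i \<in> ext vomega" "vpair v r \<in> ext (F i)"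
      "vpair (vpair i r) (vpair t (vpair V g)) \<in> ext C" "s \<unlhd> t"
      unfolding Q_def mem_vset_Collect by blast
    obtain n where n: "i = vnat n" using *(2) by auto
    have reach: "S.reach (n, v, r)" using reach_F *(3) n by auto
    then have "r \<in> ext PP" "Inv r" using S.reach_good S.good_tree by fastforce+
    then have "t = \<tau> n r" using C_mem *(4) n by blast
    then show "s \<in> S.fused" unfolding S.fused_def using *(1,5) reach by force
  next
    fix s assume "s \<in> S.fused"
    then obtain x where "s \<in> ext Nd" "S.reach x" "s \<unlhd> S.tau x"
      unfolding S.fused_def by blast
    moreover obtain n v r where "x = (n, v, r)" by (cases x)
    ultimately have *: "s \<in> ext Nd" "S.reach (n, v, r)" "s \<unlhd> \<tau> n r" by simp_all
    have r: "r \<in> ext PP" "Inv r" using S.reach_good[OF *(2)] S.good_tree by fastforce+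
    have vr: "vpair v r \<in> ext (F (vnat n))" using reach_F *(2) by blast
    have vM: "v \<in> M" "r \<in> M" using vpair_M[OF mem_M[OF vr FM]] by blast+
    have C: "vpair (vpair (vnat n) r) (vpair (\<tau> n r) (vpair (U n r) (h n r))) \<in> ext C"
      using C_mem[OF r] by blast
    have n: "(vnat n :: 'a) \<in> ext vomega" by simp
    show "s \<in> ext Q"
      unfolding Q_def mem_vset_Collect using *(1,3) vM vr C comp_M[OF C] n by blast
  qed
  obtain s0 where s0: "s0 \<in> ext Q"
    using S.tau_node[OF S.good_root] unfolding Q S.fused_def S.reach_def by blast
  have QP: "Q \<in> ext PP"
  proof (rule PP_I[OF QM _ s0])
    show "Q \<unlhd> Nd" unfolding Q S.fused_def by blast
    show "s \<in> ext Q" if "t \<in> ext Q" "s \<in> ext Nd" "s \<unlhd> t" for s t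
      using that S.fused_closed unfolding Q by blast
    show "\<exists>t\<in>ext Q. s \<unlhd> t \<and> K n \<lesssim> succs Q t" if "s \<in> ext Q" for s n
      using S.fused_split that unfolding ext_succs Q by blast
  qed
  show thesis
  proof (rule that[OF QP]; (intro allI impI)?)
    show "Q \<unlhd> q0" unfolding Q by (rule S.fused_subset)
  next
    fix q n assume q: "q \<in> ext PP \<and> q \<unlhd> Q"
    \<comment> \<open>A state of stage \<open>Suc n\<close> is a child, and remembers the step
      carried out at stage \<open>n\<close>.\<close>
    then obtain q' x where q': "q' \<in> ext PP" "q' \<unlhd> q" "S.reach x" "fst x = Suc n"
      "q' \<unlhd> S.tree_of x"
      using S.fused_cover[of q "Suc n"] unfolding Q by blast
    obtain u r1 where x: "x = (Suc n, u, r1)" using q'(4) by (cases x) auto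
    obtain v r where vr: "S.reach (n, v, r)" "u \<in> ext (U n r)" "r1 = app (h n r) u"
      using q'(3) unfolding x S.reach_Suc by blast
    have "r \<in> ext PP" "Inv r" using S.reach_good[OF vr(1)] S.good_tree by fastforce+
    then have "J (vnat n) (U n r) (h n r)" using SC unfolding SC_def by blast
    then show "\<exists>U h u q'. J (vnat n) U h \<and> u \<in> ext U \<and>
       q' \<in> ext PP \<and> q' \<unlhd> q \<and> q' \<unlhd> app h u"
      using q' vr(2) unfolding x vr(3) by auto
  next
    fix t u v assume uv: "u \<in> ext (succs Q t) \<and> v \<in> ext (succs Q t) \<and> u \<noteq> v"
    then obtain x where x: "S.reach x" "u \<in> ext (S.splits x)" "v \<in> ext (S.splits x)"
      using S.fused_succs[of u t v] unfolding ext_succs Q by blast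
    obtain n w r where x': "x = (n, w, r)" by (cases x)
    have "r \<in> ext PP" "Inv r" using S.reach_good[OF x(1)] S.good_tree x' by fastforce+
    then have "J (vnat n) (U n r) (h n r)" using SC unfolding SC_def by blast
    moreover have "restr Q u \<unlhd> app (h n r) u" "restr Q v \<unlhd> app (h n r) v"
      using S.fused_restr[OF x(1,2)] S.fused_restr[OF x(1,3)] unfolding ext_restr Q x' by auto
    ultimately show "\<exists>n U h. J (vnat n) U h \<and> u \<in> ext U \<and> v \<in> ext U \<and>
         restr Q u \<unlhd> app h u \<and> restr Q v \<unlhd> app h v"
      using x(2,3) unfolding x' by auto
  qed
qed

end

section \<open>Names for new sequences\<close>

text \<open>The combinatorics sees the name only through \<open>Fo\<close>, where
  \<open>Fo q i x\<close> stands for: \<open>q\<close> forces the sequence to take the value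
  \<open>x\<close> at \<open>i\<close>. Below \<open>p0\<close> the sequence is single-valued, total
  and new. \<open>X\<close> bounds values and indices alike, and \<open>omega_power\<close> is the
  cardinal hypothesis in terms of the \<kappa>_n.\<close>

locale decision = trees +
  fixes p0 X :: 'a and Fo :: "'a \<Rightarrow> 'a \<Rightarrow> 'a \<Rightarrow> bool"
  assumes def_Fo: "Def (\<lambda>e. Fo (e 0) (e 1) (e 2))"
    and X: "X \<in> M" and p0: "p0 \<in> ext PP"
    and Fo_X: "\<And>q i x. Fo q i x \<Longrightarrow> x \<in> ext X"
    and Fo_i: "\<And>q i x. Fo q i x \<Longrightarrow> i \<in> ext X"
    and Fo_mono: "\<And>q q' i x. Fo q i x \<Longrightarrow> q' \<in> ext PP \<Longrightarrow> q' \<unlhd> q \<Longrightarrow> Fo q' i x"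
    and Fo_unique: "\<And>q i x y. q \<in> ext PP \<Longrightarrow> q \<unlhd> p0 \<Longrightarrow> Fo q i x \<Longrightarrow> Fo q i y \<Longrightarrow> x = y"
    and Fo_total: "\<And>q n. q \<in> ext PP \<Longrightarrow> q \<unlhd> p0 \<Longrightarrow>
        \<exists>q'\<in>ext PP. q' \<unlhd> q \<and> (\<exists>x. Fo q' (vnat n) x)"
    and Fo_new: "\<And>q f. q \<in> ext PP \<Longrightarrow> q \<unlhd> p0 \<Longrightarrow> f \<in> M \<Longrightarrow>
        \<exists>n. \<exists>q'\<in>ext PP. q' \<unlhd> q \<and>
          (\<forall>q''\<in>ext PP. q'' \<unlhd> q' \<longrightarrow> \<not> Fo q'' (vnat n) (app f (vnat n)))"
    and omega_power: "\<And>m. \<exists>j. \<exists>c\<in>ext (K j). card_le_in M (omega_seqs_in M (K m)) (ext c)"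
begin

lemma def_Fo' [dfn]: "Trm F \<Longrightarrow> Trm G \<Longrightarrow> Trm H \<Longrightarrow> Def (\<lambda>e. Fo (F e) (G e) (H e))"
  by (rule definable3[OF def_Fo])

text \<open>The number \<open>m\<close> is read as the set of smaller numbers, so that
  \<open>agrees r (vnat n) f\<close> concerns the indices below n.\<close>

definition agrees :: "'a \<Rightarrow> 'a \<Rightarrow> 'a \<Rightarrow> bool" where
  "agrees r m f \<longleftrightarrow> (\<forall>i\<in>ext m. Fo r i (app f i))"

lemma def_agrees [dfn]: "Trm F \<Longrightarrow> Trm G \<Longrightarrow> Trm H \<Longrightarrow> Def (\<lambda>e. agrees (F e) (G e) (H e))"
  by (rule definable3[where R = agrees]) (unfold agrees_def, (rule dfn)+)

text \<open>If a set of conditions reproduces itself under the derivative, a fusion inside it gives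
  a \<open>Q\<close> whose stages agree with \<open>f\<close> on longer and longer initial segments.
  Newness gives an extension of \<open>Q\<close> that rules out one value of \<open>f\<close>, yet
  it is compatible with a stage that forces that value.\<close>

lemma no_postfixed:
  assumes S: "Def (\<lambda>e. S (e 0))" and f: "f \<in> M"
    and sub: "\<And>r. S r \<Longrightarrow> r \<in> ext PP \<and> r \<unlhd> p0"
    and post: "\<And>r n. S r \<Longrightarrow> \<exists>t\<in>ext r. card_le_in M (ext (K n))
      {u \<in> ext (succs r t). \<exists>r'\<in>ext PP. r' \<unlhd> restr r u \<and> agrees r' (vnat n) f \<and> S r'}"
  shows "\<not> S r"
proof
  assume r: "S r"
  obtain Q where Q: "Q \<in> ext PP" "Q \<unlhd> r"
    "\<forall>q n. q \<in> ext PP \<and> q \<unlhd> Q \<longrightarrow> (\<exists>U h u q'. (\<forall>u\<in>ext U. agrees (app h u) (vnat n) f) \<and> u \<in> ext U \<and>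
       q' \<in> ext PP \<and> q' \<unlhd> q \<and> q' \<unlhd> app h u)"
  proof (rule fusion[where Inv = S and J = "\<lambda>n U h. \<forall>u\<in>ext U. agrees (app h u) n f"])
    show "r \<in> ext PP" "S r" using r sub by blast+
    show "Def (\<lambda>e. S (e 0))" by (rule S)
    show "Def (\<lambda>e. \<forall>u\<in>ext (e 1). agrees (app (e 2) u) (e 0) f)"
      by (rule dfn term_const f)+
    fix n r assume r: "r \<in> ext PP" "S r"
    obtain t where t: "t \<in> ext r" "card_le_in M (ext (K n))
      {u \<in> ext (succs r t). \<exists>r'\<in>ext PP. r' \<unlhd> restr r u \<and> agrees r' (vnat n) f \<and> S r'}"
      using post[OF r(2), of n] by blast
    have rM: "r \<in> M" "t \<in> M" using PP_elem_M[OF r(1)] mem_M[OF t(1)] by blast+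
    define U where "U = vset {u \<in> ext (succs r t). \<exists>r'\<in>ext PP. r' \<unlhd> restr r u \<and>
        agrees r' (vnat n) f \<and> S r'}"
    have U: "u \<in> ext U \<longleftrightarrow> u \<in> ext (succs r t) \<and> (\<exists>r'\<in>ext PP. r' \<unlhd> restr r u \<and>
        agrees r' (vnat n) f \<and> S r')" for u
      unfolding U_def by (rule mem_vset_Collect)
    have UM: "U \<in> M"
      unfolding U_def by (rule in_M) (rule dfn definable1[OF S] term_const PP_M vnat_M f rM)+
    obtain g where g: "lam U g \<in> M" "\<And>u. u \<in> ext U \<Longrightarrow> g u \<in> ext PP \<and>
        g u \<unlhd> restr r u \<and> agrees (g u) (vnat n) f \<and> S (g u)"
    proof (rule choice_rel[OF UM PP_M, where
          R = "\<lambda>u r'. r' \<unlhd> restr r u \<and> agrees r' (vnat n) f \<and> S r'"])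
      show "Def (\<lambda>e. e 1 \<unlhd> restr r (e 0) \<and> agrees (e 1) (vnat n) f \<and> S (e 1))"
        by (rule dfn definable1[OF S] term_const vnat_M f rM)+
      show "\<exists>y\<in>ext PP. y \<unlhd> restr r u \<and> agrees y (vnat n) f \<and> S y" if "u \<in> ext U" for u
        using that unfolding U by blast
    qed (erule that, blast)
    have "K n \<lesssim> U"
      using t(2) unfolding U_def by (simp del: ext_succs ext_restr)
    moreover have "U \<unlhd> succs r t" using U by blast
    moreover have "\<forall>u\<in>ext U. agrees (app (lam U g) u) (vnat n) f" using g(2) by simp
    ultimately show "\<exists>t\<in>ext r. \<exists>U\<in>M. \<exists>f'. lam U f' \<in> M \<and>
      U \<unlhd> succs r t \<and> K n \<lesssim> U \<and>
      (\<forall>u\<in>ext U. f' u \<in> ext PP \<and> S (f' u) \<and> f' u \<unlhd> restr r u) \<and>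
      (\<forall>u\<in>ext U. agrees (app (lam U f') u) (vnat n) f)"
      using t(1) UM g by blast
  qed (rule that)
  have "Q \<unlhd> p0" using Q(2) sub[OF r] by blast
  then obtain n q where q: "q \<in> ext PP" "q \<unlhd> Q"
    "\<And>q'. q' \<in> ext PP \<Longrightarrow> q' \<unlhd> q \<Longrightarrow> \<not> Fo q' (vnat n) (app f (vnat n))"
    using Fo_new[OF Q(1) _ f] by blast
  \<comment> \<open>Stage \<open>Suc n\<close>, since agreement up to \<open>vnat n\<close> stops
    short of the index \<open>vnat n\<close>.\<close>
  obtain U h u q' where *: "\<forall>u\<in>ext U. agrees (app h u) (vnat (Suc n)) f" "u \<in> ext U"
       "q' \<in> ext PP" "q' \<unlhd> q" "q' \<unlhd> app h u"
    using Q(3)[rule_format, OF conjI[OF q(1,2)], of "Suc n"] by blast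
  then have "Fo (app h u) (vnat n) (app f (vnat n))" unfolding agrees_def by simp
  then show False using q(3)[OF *(3,4)] Fo_mono *(3,5) by blast
qed

end

context decision begin

definition below :: "'a \<Rightarrow> 'a" where
  "below r0 = vset {r \<in> ext PP. r \<unlhd> r0}"

lemma mem_below: "r \<in> ext (below r0) \<longleftrightarrow> r \<in> ext PP \<and> r \<unlhd> r0"
  unfolding below_def by (rule mem_vset_Collect)

lemma below_M: "r0 \<in> M \<Longrightarrow> below r0 \<in> M"
  unfolding below_def by (rule in_M) (rule dfn term_const PP_M | assumption)+

definition vals :: "'a \<Rightarrow> 'a \<Rightarrow> 'a" where
  "vals r i = vset {x \<in> ext X. \<exists>r'\<in>ext PP. r' \<unlhd> r \<and> Fo r' i x}"

lemma mem_vals: "x \<in> ext (vals r i) \<longleftrightarrow> (\<exists>r'\<in>ext PP. r' \<unlhd> r \<and> Fo r' i x)"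
  unfolding vals_def mem_vset_Collect using Fo_X by blast

lemma trm_vals [dfn]: "Trm F \<Longrightarrow> Trm G \<Longrightarrow> Trm (\<lambda>e. vals (F e) (G e))"
  by (rule trm2[where G = vals]) (unfold vals_def, (rule term_const[OF PP_M] term_const[OF X] dfn)+)

end

text \<open>Contradictory assumptions, for an argument by contradiction that takes several lemmas.\<close>

locale few_values = decision +
  fixes r0 :: 'a and m0 :: nat
  assumes r0: "r0 \<in> ext PP" "r0 \<unlhd> p0"
    and few: "\<And>n. \<not> K m0 \<lesssim> vals r0 (vnat n)"
begin

section \<open>The family of candidate functions and its size\<close>

lemma r0_M: "r0 \<in> M"
  by (rule PP_elem_M[OF r0(1)])

text \<open>The functions that \<open>r0\<close> leaves possible coordinate by coordinate. The
  normal form \<open>lam vomega\<close> makes such a function determined by its values.\<close>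

definition Fam :: 'a where
  "Fam = vset {f \<in> ext (pow (cart vomega X)). f = lam vomega (\<lambda>i. app f i) \<and>
     (\<forall>i\<in>ext vomega. app f i \<in> ext (vals r0 i))}"

lemma cart_X_M: "cart vomega X \<in> M"
  by (rule in_M) (rule dfn term_const omega_M X)+

lemma Fam_M: "Fam \<in> M"
  unfolding Fam_def by (rule in_M) (rule dfn term_const omega_M X r0_M)+

lemma mem_Fam: "f \<in> ext Fam \<longleftrightarrow> f \<in> M \<and> f = lam vomega (app f) \<and>
    (\<forall>n. app f (vnat n) \<in> ext (vals r0 (vnat n)))"
proof -
  have "f \<unlhd> cart vomega X"
    if f: "f = lam vomega (app f)" and v: "\<forall>n. app f (vnat n) \<in> ext (vals r0 (vnat n))"
  proof -
    have "app f (vnat n) \<in> ext X" for n using v Fo_X unfolding mem_vals by blast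
    then have "lam vomega (app f) \<unlhd> cart vomega X" by auto
    then show ?thesis by (simp only: f[symmetric])
  qed
  moreover have "(\<forall>i\<in>ext vomega. app f i \<in> ext (vals r0 i)) \<longleftrightarrow>
      (\<forall>n. app f (vnat n) \<in> ext (vals r0 (vnat n)))" by simp
  ultimately show ?thesis
    unfolding Fam_def mem_vset_Collect unfolding ext_pow[OF cart_X_M] mem_Collect_eq by blast
qed

text \<open>By \<open>comparable\<close> each set of possible values injects into \<kappa>_m for
  \<open>m = m0\<close>. Injections chosen simultaneously for all coordinates embed the family into
  the omega-sequences in that cardinal, and these are fewer than some \<kappa>_j.\<close>

lemma Fam_card: "\<exists>j. \<exists>c\<in>ext (K j). Fam \<lesssim> c"
proof -
  have "\<exists>g\<in>ext (pow (cart X (K m0))). (\<forall>x\<in>ext (vals r0 i). app g x \<in> ext (K m0)) \<and>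
      (\<forall>x\<in>ext (vals r0 i). \<forall>y\<in>ext (vals r0 i). app g x = app g y \<longrightarrow> x = y)"
    if iw: "i \<in> ext vomega" for i
  proof -
    obtain n where i: "i = vnat n" using iw by auto
    have VM: "vals r0 i \<in> M" unfolding i by (rule in_M) (rule dfn term_const vnat_M r0_M)+
    have "vals r0 i \<lesssim> K m0"
      unfolding i by (rule regular.comparable[OF regular_K VM[unfolded i] few])
    then obtain g where g: "g \<in> M" "g = lam (vals r0 i) (app g)"
      "\<forall>x\<in>ext (vals r0 i). app g x \<in> ext (K m0)"
      "\<forall>x\<in>ext (vals r0 i). \<forall>y\<in>ext (vals r0 i). app g x = app g y \<longrightarrow> x = y"
      unfolding card_le_iff by blast
    have "lam (vals r0 i) (app g) \<unlhd> cart X (K m0)"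
      using g(3) Fo_X by (auto simp: mem_vals)
    moreover have "cart X (K m0) \<in> M" by (rule in_M) (rule dfn term_const X K_M)+
    ultimately have "g \<in> ext (pow (cart X (K m0)))" using g(1,2) by (simp add: ext_pow)
    then show ?thesis using g(3,4) by blast
  qed
  note ex = this
  have bM: "pow (cart X (K m0)) \<in> M" by (rule in_M) (rule dfn term_const X K_M)+
  obtain G where G: "lam vomega G \<in> M" "\<And>i. i \<in> ext vomega \<Longrightarrow> G i \<in> ext (pow (cart X (K m0))) \<and>
      (\<forall>x\<in>ext (vals r0 i). app (G i) x \<in> ext (K m0)) \<and>
      (\<forall>x\<in>ext (vals r0 i). \<forall>y\<in>ext (vals r0 i). app (G i) x = app (G i) y \<longrightarrow> x = y)"
  proof (rule choice_rel[OF omega_M bM, where R = "\<lambda>i g. (\<forall>x\<in>ext (vals r0 i). app g x \<in> ext (K m0)) \<and>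
      (\<forall>x\<in>ext (vals r0 i). \<forall>y\<in>ext (vals r0 i). app g x = app g y \<longrightarrow> x = y)"])
    show "Def (\<lambda>e. (\<forall>x\<in>ext (vals r0 (e 0)). app (e 1) x \<in> ext (K m0)) \<and>
      (\<forall>x\<in>ext (vals r0 (e 0)). \<forall>y\<in>ext (vals r0 (e 0)). app (e 1) x = app (e 1) y \<longrightarrow> x = y))"
      by (rule dfn term_const r0_M K_M)+
  qed (erule ex, erule that, blast)
  obtain j c where c: "c \<in> ext (K j)" "card_le_in M (omega_seqs_in M (K m0)) (ext c)"
    using omega_power by blast
  then obtain b where b: "inj_on b (omega_seqs_in M (K m0))" "b ` omega_seqs_in M (K m0) \<subseteq> ext c"
    "coded_in M (graph_on (omega_seqs_in M (K m0)) b)"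
    unfolding card_le_in_def by blast
  obtain bc where bc: "bc \<in> M" "ext bc = graph_on (omega_seqs_in M (K m0)) b"
    using b(3) unfolding coded_in_def by blast
  have app_bc: "app bc x = b x" if "x \<in> omega_seqs_in M (K m0)" for x
    by (rule app_eqI) (use that in \<open>auto simp: bc(2) graph_on_def\<close>)
  \<comment> \<open>Applies the chosen injection of each coordinate to the value there.\<close>
  let ?\<Phi> = "\<lambda>f. lam vomega (\<lambda>i. app (app (lam vomega G) i) (app f i))"
  have \<Phi>: "?\<Phi> f \<in> omega_seqs_in M (K m0)" if f: "f \<in> ext Fam" for f
  proof -
    have fM: "f \<in> M" using f mem_Fam by blast
    have "?\<Phi> f \<in> M" by (rule in_M) (rule term_const[OF G(1)] dfn term_const omega_M fM)+
    moreover have "range (\<lambda>n. app (G (vnat n)) (app f (vnat n))) \<subseteq> ext (K m0)"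
      using G(2) f unfolding mem_Fam by auto
    moreover have "ext (?\<Phi> f) = seq_graph (\<lambda>n. app (G (vnat n)) (app f (vnat n)))"
      by (simp add: seq_graph_def image_image)
    ultimately show ?thesis unfolding omega_seqs_in_def by blast
  qed
  have "Fam \<lesssim> c"
  proof (rule card_leI[where f = "\<lambda>f. app bc (?\<Phi> f)"])
    show "lam Fam (\<lambda>f. app bc (?\<Phi> f)) \<in> M"
      by (rule in_M) (rule term_const[OF G(1)] term_const[OF bc(1)] dfn term_const omega_M Fam_M)+
    show "(\<lambda>f. app bc (?\<Phi> f)) ` ext Fam \<subseteq> ext c"
      using b(2) \<Phi> app_bc by auto
    show "inj_on (\<lambda>f. app bc (?\<Phi> f)) (ext Fam)"
    proof (rule inj_onI)
      fix f g assume fg: "f \<in> ext Fam" "g \<in> ext Fam" "app bc (?\<Phi> f) = app bc (?\<Phi> g)"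
      then have "b (?\<Phi> f) = b (?\<Phi> g)" using app_bc[OF \<Phi>] by simp
      then have eq: "?\<Phi> f = ?\<Phi> g" using inj_onD[OF b(1) _ \<Phi>[OF fg(1)] \<Phi>[OF fg(2)]] by blast
      have "app f i = app g i" if i: "i \<in> ext vomega" for i
      proof -
        have "app (?\<Phi> f) i = app (?\<Phi> g) i" using eq by (rule arg_cong)
        then have "app (G i) (app f i) = app (G i) (app g i)" using i by (simp only: app_lam)
        moreover have "app f i \<in> ext (vals r0 i)" "app g i \<in> ext (vals r0 i)"
          using fg(1,2) i unfolding mem_Fam by auto
        ultimately show ?thesis using G(2)[OF i] by blast
      qed
      then have "lam vomega (app f) = lam vomega (app g)" by (intro lam_cong refl)
      then show "f = g" using fg(1,2) unfolding mem_Fam by metis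
    qed
  qed
  then show ?thesis using c(1) by blast
qed

section \<open>The Cantor--Bendixson derivative and its stages\<close>

definition extendible :: "'a \<Rightarrow> 'a \<Rightarrow> 'a \<Rightarrow> 'a \<Rightarrow> 'a \<Rightarrow> 'a" where
  "extendible s k f r t = vset {u \<in> ext (succs r t). \<exists>r'\<in>ext (below r0).
     r' \<unlhd> restr r u \<and> agrees r' k f \<and> vpair f r' \<in> ext s}"

lemma mem_extendible: "u \<in> ext (extendible s k f r t) \<longleftrightarrow> u \<in> ext (succs r t) \<and> (\<exists>r'\<in>ext (below r0).
    r' \<unlhd> restr r u \<and> agrees r' k f \<and> vpair f r' \<in> ext s)"
  unfolding extendible_def by (rule mem_vset_Collect)

text \<open>The condition of the Cantor--Bendixson derivative, where \<open>s\<close> is the set of pairs that have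
  survived so far.\<close>
definition many :: "'a \<Rightarrow> 'a \<Rightarrow> 'a \<Rightarrow> 'a \<Rightarrow> bool" where
  "many s k f r \<longleftrightarrow> (\<exists>t\<in>ext r. app Kc k \<lesssim> extendible s k f r t)"

lemma def_many: "Def (\<lambda>e. many (e 0) (e 1) (e 2) (e 3))"
  unfolding many_def extendible_def
  by (rule term_const[OF Kc(1)] term_const[OF below_M[OF r0_M]] dfn)+

lemmas def_many' = definable4[OF def_many]

text \<open>Read contrapositively: a failure persists when the precision \<open>k\<close> grows and
  when the condition shrinks. This allows a failure to be moved along a decreasing sequence of
  conditions.\<close>

lemma many_mono:
  assumes "many s (vnat k') f r'" "k \<le> k'" "r' \<unlhd> r" "r' \<in> M" "r \<in> M"
  shows "many s (vnat k) f r"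
proof -
  obtain t where t: "t \<in> ext r'" "K k' \<lesssim> extendible s (vnat k') f r' t"
    using assms(1) unfolding many_def app_Kc by blast
  have "K k \<lesssim> extendible s (vnat k') f r' t"
    by (rule card_le_K_mono[OF assms(2) t(2)])
  moreover have "extendible s (vnat k') f r' t \<unlhd> extendible s (vnat k) f r t"
  proof
    fix u assume "u \<in> ext (extendible s (vnat k') f r' t)"
    then obtain q where q: "u \<in> ext (succs r' t)" "q \<in> ext (below r0)" "q \<unlhd> restr r' u"
      "agrees q (vnat k') f" "vpair f q \<in> ext s"
      unfolding mem_extendible by blast
    have "u \<in> ext (succs r t)" using q(1) assms(3) by auto
    moreover have "q \<unlhd> restr r u" using q(3) assms(3) by auto
    moreover have "agrees q (vnat k) f" using q(4) assms(2) by (auto simp: agrees_def ext_vnat)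
    ultimately show "u \<in> ext (extendible s (vnat k) f r t)"
      unfolding mem_extendible using q(2,5) by blast
  qed
  ultimately show ?thesis
    unfolding many_def app_Kc using t(1) assms(3) card_le_mono by blast
qed

text \<open>One clause for all ordinals: stage 0 contains all pairs, and a later stage keeps those
  that pass the test against every earlier stage.\<close>

definition stage_rec :: "'a \<Rightarrow> 'a \<Rightarrow> 'a" where
  "stage_rec x h = vset {z \<in> ext (cart Fam (below r0)). \<forall>y\<in>ext x. \<exists>f\<in>M. \<exists>r\<in>M. z = vpair f r \<and>
     (\<forall>k\<in>ext vomega. many (app h y) k f r)}"

definition stage :: "'a \<Rightarrow> 'a" where "stage = vrec stage_rec"

lemma trm_stage [dfn]: "Trm F \<Longrightarrow> Trm (\<lambda>e. stage (F e))"
  unfolding stage_def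
proof (rule trm_vrec)
  show "Trm (\<lambda>e. stage_rec (e 0) (e 1))"
    unfolding stage_rec_def
    by (rule term_const[OF Fam_M] term_const[OF below_M[OF r0_M]] term_const[OF omega_M] dfn def_many')+
qed

lemma below_elem_M: "r \<in> ext (below r0) \<Longrightarrow> r \<in> M"
  using PP_elem_M mem_below by blast

lemma mem_stage: "vpair f r \<in> ext (stage \<alpha>) \<longleftrightarrow>
    f \<in> ext Fam \<and> r \<in> ext (below r0) \<and> (\<forall>\<beta>\<in>ext \<alpha>. \<forall>n. many (stage \<beta>) (vnat n) f r)"
proof -
  have app: "app (lam (tcl \<alpha>) stage) y = stage y" if "y \<in> ext \<alpha>" for y
    using that ext_subset_tcl by (intro app_lam) blast
  have "f \<in> ext Fam \<Longrightarrow> f \<in> M" using mem_Fam by blast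
  then show ?thesis
    unfolding stage_def vrec[of stage_rec \<alpha>] unfolding stage_def[symmetric]
    unfolding stage_rec_def mem_vset_Collect mem_cart vpair_inject
    using below_elem_M by (auto simp: app)
qed

lemma mem_stageE:
  assumes "z \<in> ext (stage \<alpha>)"
  obtains f r where "z = vpair f r" "f \<in> ext Fam" "r \<in> ext (below r0)"
proof -
  have "z \<in> ext (cart Fam (below r0))"
    using assms unfolding stage_def vrec[of stage_rec \<alpha>] unfolding stage_rec_def mem_vset_Collect by blast
  then show thesis using that by (auto simp: ext_cart)
qed

lemma stage_antimono:
  assumes "\<alpha> \<unlhd> \<beta>" shows "stage \<beta> \<unlhd> stage \<alpha>"
proof
  fix z assume z: "z \<in> ext (stage \<beta>)"
  then obtain f r where fr: "z = vpair f r" by (rule mem_stageE)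
  show "z \<in> ext (stage \<alpha>)" using z assms unfolding fr mem_stage by blast
qed

text \<open>A pair that ever disappears does so at exactly one ordinal. By replacement the exit
  ordinals form a set in \<open>M\<close>, and any ordinal above all of them will do.\<close>

lemma stage_stabilises:
  obtains \<Lambda> where "\<Lambda> \<in> M" "ordinal \<Lambda>" "\<And>\<alpha>. \<alpha> \<in> M \<Longrightarrow> ordinal \<alpha> \<Longrightarrow> stage \<Lambda> \<unlhd> stage \<alpha>"
proof -
  define leaves where "leaves z \<alpha> \<longleftrightarrow> ordinal \<alpha> \<and> z \<notin> ext (stage \<alpha>) \<and> (\<forall>\<beta>\<in>ext \<alpha>. z \<in> ext (stage \<beta>))" for z \<alpha>
  define D where "D = vset {z \<in> ext (cart Fam (below r0)). \<exists>\<alpha>\<in>M. leaves z \<alpha>}"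
  have def_ord: "Def (\<lambda>e. ordinal (e 0))" unfolding ordinal_def by (rule dfn)+
  have def_leaves: "Def (\<lambda>e. leaves (e 0) (e 1))"
    unfolding leaves_def by (rule dfn definable1[OF def_ord])+
  have DM: "D \<in> M"
    unfolding D_def
    by (rule in_M) (rule dfn definable2[OF def_leaves] term_const Fam_M below_M r0_M)+
  have uniq: "\<alpha> = \<beta>" if "leaves z \<alpha>" "leaves z \<beta>" for z \<alpha> \<beta>
    using that ordinal_linear[of \<alpha> \<beta>] unfolding leaves_def by blast
  define T where "T z = (SOME \<alpha>. \<alpha> \<in> M \<and> leaves z \<alpha>)" for z
  have T: "T z \<in> M \<and> leaves z (T z)" if "z \<in> ext D" for z
  proof -
    have "\<exists>\<alpha>. \<alpha> \<in> M \<and> leaves z \<alpha>" using that unfolding D_def mem_vset_Collect by blast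
    then show ?thesis unfolding T_def by (rule someI_ex)
  qed
  have AM: "vset (T ` ext D) \<in> M"
  proof (rule replacement[where R = "\<lambda>u v e. leaves u v" and e = "\<lambda>_. D"])
    show "Def (\<lambda>e. leaves (e 0) (e 1))" by (rule def_leaves)
    show "T u \<in> M" if "u \<in> ext D" for u using T[OF that] by blast
    show "leaves u v \<longleftrightarrow> v = T u" if "u \<in> ext D" for u v
      using T[OF that] uniq by blast
  qed (use DM in auto)
  \<comment> \<open>The successors of the exit ordinals are united, so that each exit ordinal is
    strictly below \<Lambda>.\<close>
  define \<Lambda> where "\<Lambda> = vset (\<Union>\<alpha>\<in>ext (vset (T ` ext D)). ext (vset (insert \<alpha> (ext \<alpha>))))"
  have \<Lambda>: "x \<in> ext \<Lambda> \<longleftrightarrow> (\<exists>z\<in>ext D. x = T z \<or> x \<in> ext (T z))" for x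
    unfolding \<Lambda>_def mem_vset_UN by auto
  have ordT: "ordinal (T z)" if "z \<in> ext D" for z using T[OF that] leaves_def by blast
  have "\<Lambda> \<in> M" unfolding \<Lambda>_def by (rule in_M) (rule term_const[OF AM] dfn)+
  moreover have "ordinal \<Lambda>"
    unfolding ordinal_def
  proof (intro conjI ballI)
    fix x assume "x \<in> ext \<Lambda>"
    then obtain z where z: "z \<in> ext D" "x = T z \<or> x \<in> ext (T z)" unfolding \<Lambda> by blast
    then show "x \<unlhd> \<Lambda>" using ordinal_trans[OF ordT[OF z(1)]] \<Lambda> by blast
    have "ordinal x" using z ordT ordinal_elem by blast
    then show "y \<unlhd> x" if "y \<in> ext x" for y
      using ordinal_trans that by blast
  qed
  moreover have "stage \<Lambda> \<unlhd> stage \<alpha>" if \<alpha>: "\<alpha> \<in> M" "ordinal \<alpha>" for \<alpha>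
  proof
    fix z assume z: "z \<in> ext (stage \<Lambda>)"
    show "z \<in> ext (stage \<alpha>)"
    proof (rule ccontr)
      assume "z \<notin> ext (stage \<alpha>)"
      then have "\<alpha> \<in> {\<alpha>. ordinal \<alpha> \<and> \<alpha> \<in> M \<and> z \<notin> ext (stage \<alpha>)}" using \<alpha> by blast
      then obtain \<beta> where \<beta>: "ordinal \<beta>" "\<beta> \<in> M" "z \<notin> ext (stage \<beta>)"
        "\<And>\<gamma>. \<gamma> \<in> ext \<beta> \<Longrightarrow> \<gamma> \<notin> {\<alpha>. ordinal \<alpha> \<and> \<alpha> \<in> M \<and> z \<notin> ext (stage \<alpha>)}"
        by (rule wfE_min[OF wf_vmem]) (auto simp: mem_ext)
      have "leaves z \<beta>"
        unfolding leaves_def using \<beta> ordinal_elem mem_M by blast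
      moreover obtain f r where fr: "z = vpair f r" "f \<in> ext Fam" "r \<in> ext (below r0)"
        using z by (rule mem_stageE)
      ultimately have "z \<in> ext D" unfolding D_def mem_vset_Collect using \<beta>(2) by auto
      then have "T z \<unlhd> \<Lambda>" "z \<notin> ext (stage (T z))"
        using \<Lambda> T leaves_def by blast+
      then show False using stage_antimono z by blast
    qed
  qed
  ultimately show thesis by (rule that)
qed

text \<open>What survives to the stable stage also survives the next one, so the survivors of a
  fixed \<open>f\<close> pass the test against themselves, and \<open>no_postfixed\<close>
  applies.\<close>

lemma stage_empty:
  obtains \<Lambda> where "\<Lambda> \<in> M" "ordinal \<Lambda>" "\<And>f r. vpair f r \<notin> ext (stage \<Lambda>)"
proof -
  obtain \<Lambda> where \<Lambda>: "\<Lambda> \<in> M" "ordinal \<Lambda>"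
    "\<And>\<alpha>. \<alpha> \<in> M \<Longrightarrow> ordinal \<alpha> \<Longrightarrow> stage \<Lambda> \<unlhd> stage \<alpha>"
    by (rule stage_stabilises) blast
  let ?S = "vset (insert \<Lambda> (ext \<Lambda>))"
  have SM: "?S \<in> M" by (rule in_M) (rule dfn term_const \<Lambda>(1))+
  have "ordinal ?S" using \<Lambda>(2) unfolding ordinal_def by auto
  note sub = \<Lambda>(3)[OF SM this]
  have stM: "stage \<Lambda> \<in> M" by (rule in_M) (rule dfn term_const \<Lambda>(1))+
  have "vpair f r \<notin> ext (stage \<Lambda>)" for f r
  proof
    assume fr: "vpair f r \<in> ext (stage \<Lambda>)"
    then have fM: "f \<in> M" using mem_Fam unfolding mem_stage by blast
    have "\<not> vpair f r \<in> ext (stage \<Lambda>)"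
    proof (rule no_postfixed[where S = "\<lambda>r. vpair f r \<in> ext (stage \<Lambda>)", OF _ fM])
      show "Def (\<lambda>e. vpair f (e 0) \<in> ext (stage \<Lambda>))" by (rule dfn term_const stM fM \<Lambda>(1))+
      show "r \<in> ext PP \<and> r \<unlhd> p0" if "vpair f r \<in> ext (stage \<Lambda>)" for r
        using that r0(2) unfolding mem_stage mem_below by blast
      fix r n assume r: "vpair f r \<in> ext (stage \<Lambda>)"
      then have "vpair f r \<in> ext (stage ?S)" using sub by blast
      then have many: "many (stage \<Lambda>) (vnat n) f r" unfolding mem_stage by simp
      obtain t where t: "t \<in> ext r" "K n \<lesssim> extendible (stage \<Lambda>) (vnat n) f r t"
        by (rule bexE[OF many[unfolded many_def app_Kc]]) (rule that)
      have "ext (extendible (stage \<Lambda>) (vnat n) f r t) \<subseteq> {u \<in> ext (succs r t). \<exists>r'\<in>ext PP.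
          r' \<unlhd> restr r u \<and> agrees r' (vnat n) f \<and> vpair f r' \<in> ext (stage \<Lambda>)}" (is "_ \<subseteq> ?E")
      proof
        fix u assume "u \<in> ext (extendible (stage \<Lambda>) (vnat n) f r t)"
        then obtain r' where r': "u \<in> ext (succs r t)" "r' \<in> ext (below r0)" "r' \<unlhd> restr r u"
            "agrees r' (vnat n) f" "vpair f r' \<in> ext (stage \<Lambda>)"
          unfolding mem_extendible by blast
        moreover have "r' \<in> ext PP" using r'(2) mem_below by blast
        ultimately show "u \<in> ?E" by blast
      qed
      then have "card_le_in M (ext (K n)) ?E" by (rule card_le_mono[OF t(2)])
      then show "\<exists>t\<in>ext r. card_le_in M (ext (K n)) {u \<in> ext (succs r t). \<exists>r'\<in>ext PP. r' \<unlhd> restr r u \<and>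
          agrees r' (vnat n) f \<and> vpair f r' \<in> ext (stage \<Lambda>)}"
        using t(1) by blast
    qed
    then show False using fr by blast
  qed
  then show thesis by (rule that[OF \<Lambda>(1,2)])
qed

text \<open>The step of the construction that lowers the ranks of all \<open>f\<close> in \<open>Fam\<close> at once: for each \<open>f\<close>
  only few successors are bad, and there are fewer functions than successors.\<close>
lemma good_step:
  assumes \<Lambda>: "\<Lambda> \<in> M" "ordinal \<Lambda>" and r: "r \<in> ext (below r0)"
  shows "\<exists>r'\<in>ext (below r0). r' \<unlhd> r \<and> (\<exists>x\<in>ext X. Fo r' (vnat n) x) \<and>
    (\<forall>f\<in>ext Fam. \<forall>\<beta>\<in>ext \<Lambda>. \<not> many (stage \<beta>) (vnat n) f r \<longrightarrow>
       \<not> (agrees r' (vnat n) f \<and> vpair f r' \<in> ext (stage \<beta>)))"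
proof -
  obtain j c where c: "c \<in> ext (K j)" "Fam \<lesssim> c" using Fam_card by blast
  \<comment> \<open>\<open>j\<close> makes the family smaller than \<kappa>_N, so that the
    pigeonhole applies; \<open>n\<close> ensures that a bad set of size \<kappa>_N has size at least
    \<kappa>_n.\<close>
  define N where "N = max n j"
  have cN: "c \<in> ext (K N)" using c(1) K_mono[of j N] unfolding N_def by auto
  have rP: "r \<in> ext PP" "r \<unlhd> r0" using r mem_below by blast+
  have rM: "r \<in> M" by (rule PP_elem_M[OF rP(1)])
  obtain s0 where "s0 \<in> ext r" using PP_ex[OF rP(1)] by blast
  then obtain t where t: "t \<in> ext r" "K N \<lesssim> succs r t"
    using PP_split[OF rP(1)] by blast
  have tM: "t \<in> M" by (rule mem_M[OF t(1) rM])
  define B where "B f = vset {u \<in> ext (succs r t). \<exists>\<beta>\<in>ext \<Lambda>. \<not> many (stage \<beta>) (vnat n) f r \<and>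
      u \<in> ext (extendible (stage \<beta>) (vnat n) f r t)}" for f
  have B: "u \<in> ext (B f) \<longleftrightarrow> u \<in> ext (succs r t) \<and> (\<exists>\<beta>\<in>ext \<Lambda>. \<not> many (stage \<beta>) (vnat n) f r \<and>
      u \<in> ext (extendible (stage \<beta>) (vnat n) f r t))" for u f
    unfolding B_def by (rule mem_vset_Collect)
  have trmB: "Trm (\<lambda>e. B (e 0))"
    unfolding B_def extendible_def
    by (rule dfn def_many' term_const rM tM \<Lambda>(1) vnat_M below_M r0_M)+
  have small: "\<not> K n \<lesssim> B f" for f
  proof
    assume le: "K n \<lesssim> B f"
    then obtain u where "u \<in> ext (B f)" by (rule two_elements) blast
    \<comment> \<open>The successors bad for \<beta> become fewer as \<beta> grows, so those of the
      least failing \<beta> comprise all of \<open>B f\<close>. Were they many, \<beta> would not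
      fail.\<close>
    then obtain \<beta>0 where "\<beta>0 \<in> {\<beta>. \<beta> \<in> ext \<Lambda> \<and> \<not> many (stage \<beta>) (vnat n) f r}" unfolding B by blast
    then obtain \<beta> where \<beta>: "\<beta> \<in> ext \<Lambda>" "\<not> many (stage \<beta>) (vnat n) f r"
      "\<And>\<gamma>. \<gamma> \<in> ext \<beta> \<Longrightarrow> \<gamma> \<notin> {\<beta>. \<beta> \<in> ext \<Lambda> \<and> \<not> many (stage \<beta>) (vnat n) f r}"
      by (rule wfE_min[OF wf_vmem]) (auto simp: mem_ext)
    have "B f \<unlhd> extendible (stage \<beta>) (vnat n) f r t"
    proof
      fix u assume "u \<in> ext (B f)"
      then obtain \<gamma> where *: "\<gamma> \<in> ext \<Lambda>" "\<not> many (stage \<gamma>) (vnat n) f r"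
        "u \<in> ext (extendible (stage \<gamma>) (vnat n) f r t)"
        unfolding B by blast
      have "ordinal \<gamma>" "ordinal \<beta>" using ordinal_elem[OF \<Lambda>(2)] *(1) \<beta>(1) by blast+
      then have "\<gamma> \<notin> ext \<beta> \<Longrightarrow> \<beta> \<unlhd> \<gamma>"
        using ordinal_linear[of \<gamma> \<beta>] ordinal_trans by blast
      moreover have "\<gamma> \<notin> ext \<beta>" using \<beta>(3) *(1,2) by blast
      ultimately have "stage \<gamma> \<unlhd> stage \<beta>" by (intro stage_antimono)
      then show "u \<in> ext (extendible (stage \<beta>) (vnat n) f r t)"
        using *(3) unfolding mem_extendible by blast
    qed
    then have "many (stage \<beta>) (vnat n) f r"
      unfolding many_def app_Kc using t(1) card_le_mono[OF le] by blast
    then show False using \<beta>(2) by blast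
  qed
  have "\<not> ext (succs r t) \<subseteq> (\<Union>f\<in>ext Fam. ext (B f))"
  proof
    assume "ext (succs r t) \<subseteq> (\<Union>f\<in>ext Fam. ext (B f))"
    then have "card_le_in M (ext (K N)) (\<Union>f\<in>ext Fam. ext (B f))"
      by (rule card_le_mono[OF t(2)])
    from regular.pigeonhole[OF regular_K Fam_M cN c(2) trmB this]
    obtain f where f: "K N \<lesssim> B f" by blast
    have "K n \<lesssim> B f"
      by (rule card_le_K_mono[OF _ f]) (simp add: N_def)
    then show False using small by blast
  qed
  then obtain u where u: "u \<in> ext (succs r t)" "\<And>f. f \<in> ext Fam \<Longrightarrow> u \<notin> ext (B f)" by blast
  have ur: "u \<in> ext r" using u(1) by simp
  have sub: "restr r u \<unlhd> r" by auto
  obtain r' x where r': "r' \<in> ext PP" "r' \<unlhd> restr r u" "Fo r' (vnat n) x"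
    using Fo_total[OF restr_PP[OF rP(1) ur]] sub rP(2) r0(2) by blast
  have "r' \<in> ext (below r0)" "r' \<unlhd> r" using r' sub rP(2) mem_below by blast+
  moreover have "\<exists>x\<in>ext X. Fo r' (vnat n) x" using r'(3) Fo_X by blast
  moreover have "\<not> (agrees r' (vnat n) f \<and> vpair f r' \<in> ext (stage \<beta>))"
    if "f \<in> ext Fam" "\<beta> \<in> ext \<Lambda>" "\<not> many (stage \<beta>) (vnat n) f r" for f \<beta>
    using u(2)[OF that(1)] that(2,3) u(1) r'(2) calculation(1) unfolding B mem_extendible by blast
  ultimately show ?thesis by blast
qed

text \<open>Iterating \<open>good_step\<close> gives a decreasing sequence \<open>F\<close> that
  decides a function \<open>fh\<close> of the family. As the final stage is empty, \<open>fh\<close>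
  fails somewhere along \<open>F\<close>; the least \<beta> at which it ever fails is undercut after
  one more step.\<close>

lemma contradiction: False
proof -
  obtain \<Lambda> where \<Lambda>: "\<Lambda> \<in> M" "ordinal \<Lambda>" "\<And>f r. vpair f r \<notin> ext (stage \<Lambda>)"
    by (rule stage_empty) blast
  have r0b: "r0 \<in> ext (below r0)" using r0(1) mem_below by blast
  obtain F where F: "lam vomega F \<in> M" "F (vnat 0) = r0" and
    "\<And>n. F (vnat n) \<in> ext (below r0) \<and> (F (vnat (Suc n)) \<unlhd> F (vnat n) \<and>
      (\<exists>x\<in>ext X. Fo (F (vnat (Suc n))) (vnat n) x) \<and>
      (\<forall>f\<in>ext Fam. \<forall>\<beta>\<in>ext \<Lambda>. \<not> many (stage \<beta>) (vnat n) f (F (vnat n)) \<longrightarrow>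
        \<not> (agrees (F (vnat (Suc n))) (vnat n) f \<and> vpair f (F (vnat (Suc n))) \<in> ext (stage \<beta>))))"
  proof (rule omega_choice[OF below_M[OF r0_M] r0b, where R = "\<lambda>n r r'. r' \<unlhd> r \<and>
      (\<exists>x\<in>ext X. Fo r' n x) \<and> (\<forall>f\<in>ext Fam. \<forall>\<beta>\<in>ext \<Lambda>. \<not> many (stage \<beta>) n f r \<longrightarrow>
        \<not> (agrees r' n f \<and> vpair f r' \<in> ext (stage \<beta>)))"])
    show "Def (\<lambda>e. e 2 \<unlhd> e 1 \<and>
      (\<exists>x\<in>ext X. Fo (e 2) (e 0) x) \<and> (\<forall>f\<in>ext Fam. \<forall>\<beta>\<in>ext \<Lambda>. \<not> many (stage \<beta>) (e 0) f (e 1) \<longrightarrow>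
        \<not> (agrees (e 2) (e 0) f \<and> vpair f (e 2) \<in> ext (stage \<beta>))))"
      by (rule dfn def_many' term_const X Fam_M \<Lambda>(1))+
  qed (rule good_step[OF \<Lambda>(1,2)], assumption, erule (1) that, blast)
  then have Fb: "\<And>n. F (vnat n) \<in> ext (below r0)"
    and dec: "\<And>n. F (vnat (Suc n)) \<unlhd> F (vnat n)"
    and dcd: "\<And>n. \<exists>x. Fo (F (vnat (Suc n))) (vnat n) x"
    and kill: "\<And>n f \<beta>. f \<in> ext Fam \<Longrightarrow> \<beta> \<in> ext \<Lambda> \<Longrightarrow> \<not> many (stage \<beta>) (vnat n) f (F (vnat n)) \<Longrightarrow>
        agrees (F (vnat (Suc n))) (vnat n) f \<Longrightarrow> vpair f (F (vnat (Suc n))) \<notin> ext (stage \<beta>)"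
    by blast+
  have FP: "F (vnat n) \<in> ext PP" "F (vnat n) \<unlhd> r0" "F (vnat n) \<in> M" for n
    using Fb[of n] mem_below below_elem_M by blast+
  have mono: "F (vnat n) \<unlhd> F (vnat m)" if "m \<le> n" for m n
    using that by (induction rule: dec_induct) (use dec in blast)+
  obtain f where f: "lam vomega f \<in> M"
    "\<And>i. i \<in> ext vomega \<Longrightarrow> f i \<in> ext X \<and> (\<exists>k\<in>ext vomega. Fo (app (lam vomega F) k) i (f i))"
  proof (rule choice_rel[OF omega_M X, where R = "\<lambda>i x. \<exists>k\<in>ext vomega. Fo (app (lam vomega F) k) i x"])
    show "Def (\<lambda>e. \<exists>k\<in>ext vomega. Fo (app (lam vomega F) k) (e 0) (e 1))"
      by (rule term_const[OF F(1)] dfn term_const omega_M)+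
    show "\<exists>y\<in>ext X. \<exists>k\<in>ext vomega. Fo (app (lam vomega F) k) i y" if i: "i \<in> ext vomega" for i
    proof -
      obtain n where n: "i = vnat n" using i by auto
      obtain x where "Fo (F (vnat (Suc n))) (vnat n) x" using dcd by blast
      then have "Fo (app (lam vomega F) (vnat (Suc n))) i x" "x \<in> ext X" using Fo_X n by auto
      moreover have "(vnat (Suc n) :: 'a) \<in> ext vomega" by simp
      ultimately show ?thesis by blast
    qed
  qed (erule that, blast)
  define fh where "fh = lam vomega f"
  have app_fh: "app fh (vnat n) = f (vnat n)" for n unfolding fh_def by simp
  have Fo_fh: "Fo (F (vnat (Suc n))) (vnat n) (app fh (vnat n))" for n
  proof -
    obtain k where "Fo (app (lam vomega F) (vnat k)) (vnat n) (f (vnat n))"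
      using f(2)[of "vnat n"] by auto
    then have k: "Fo (F (vnat k)) (vnat n) (f (vnat n))" by simp
    obtain x where x: "Fo (F (vnat (Suc n))) (vnat n) x" using dcd by blast
    let ?r = "F (vnat (max k (Suc n)))"
    have "Fo ?r (vnat n) (f (vnat n))" by (rule Fo_mono[OF k FP(1) mono]) simp
    moreover have "Fo ?r (vnat n) x" by (rule Fo_mono[OF x FP(1) mono]) simp
    ultimately have "x = f (vnat n)" using Fo_unique[OF FP(1)] FP(2) r0(2) by blast
    then show ?thesis using x app_fh by simp
  qed
  have fh: "fh \<in> ext Fam"
    unfolding mem_Fam
  proof (intro conjI allI)
    show "fh \<in> M" unfolding fh_def by (rule f(1))
    show "fh = lam vomega (app fh)" unfolding fh_def by simp
    show "app fh (vnat n) \<in> ext (vals r0 (vnat n))" for n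
      unfolding mem_vals using Fo_fh FP(1,2) by blast
  qed
  have agrees: "agrees (F (vnat (Suc n))) (vnat n) fh" for n
    unfolding agrees_def
  proof
    fix i :: 'a assume "i \<in> ext (vnat n)"
    then obtain l where l: "i = vnat l" "l < n" by (auto simp: ext_vnat)
    show "Fo (F (vnat (Suc n))) i (app fh i)"
      unfolding l(1) by (rule Fo_mono[OF Fo_fh FP(1) mono]) (use l(2) in simp)
  qed
  have bad: "\<exists>\<beta>\<in>ext \<alpha>. \<exists>k. \<not> many (stage \<beta>) (vnat k) fh (F (vnat n))"
    if "vpair fh (F (vnat n)) \<notin> ext (stage \<alpha>)" for \<alpha> n
    using that fh Fb[of n] unfolding mem_stage by blast
  \<comment> \<open>The stage \<Lambda> is empty, so the pair of \<open>fh\<close> and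
    \<open>F (vnat 0)\<close> must have failed before \<Lambda>.\<close>
  obtain \<beta>0 where "\<beta>0 \<in> {\<beta>. \<beta> \<in> ext \<Lambda> \<and> (\<exists>n k. \<not> many (stage \<beta>) (vnat k) fh (F (vnat n)))}"
    using bad[OF \<Lambda>(3), of 0] by blast
  then obtain \<beta> where "\<beta> \<in> {\<beta>. \<beta> \<in> ext \<Lambda> \<and> (\<exists>n k. \<not> many (stage \<beta>) (vnat k) fh (F (vnat n)))}"
    and min: "\<And>\<gamma>. \<gamma> \<in> ext \<beta> \<Longrightarrow> \<gamma> \<notin> {\<beta>. \<beta> \<in> ext \<Lambda> \<and> (\<exists>n k. \<not> many (stage \<beta>) (vnat k) fh (F (vnat n)))}"
    by (rule wfE_min[OF wf_vmem]) (simp add: mem_ext)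
  then obtain n k where nk: "\<beta> \<in> ext \<Lambda>" "\<not> many (stage \<beta>) (vnat k) fh (F (vnat n))" by blast
  \<comment> \<open>The step from \<open>F (vnat n)\<close> removes failures of precision exactly n,
    so the position and the precision are both raised to their maximum.\<close>
  let ?N = "max n k"
  have "\<not> many (stage \<beta>) (vnat ?N) fh (F (vnat ?N))"
    using many_mono[of "stage \<beta>" ?N fh "F (vnat ?N)" k "F (vnat n)"] nk(2) mono[of n ?N] FP(3) by auto
  then have "vpair fh (F (vnat (Suc ?N))) \<notin> ext (stage \<beta>)"
    using kill[OF fh nk(1)] agrees by blast
  then obtain \<gamma> l where "\<gamma> \<in> ext \<beta>" "\<not> many (stage \<gamma>) (vnat l) fh (F (vnat (Suc ?N)))"
    using bad by blast
  moreover have "\<gamma> \<in> ext \<Lambda>" using ordinal_trans[OF \<Lambda>(2) nk(1)] calculation(1) by blast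
  ultimately show False using min by blast
qed

end

context decision begin

lemma many_values:
  assumes "r0 \<in> ext PP" "r0 \<unlhd> p0"
  shows "\<exists>n. K m \<lesssim> vals r0 (vnat n)"
proof (rule ccontr)
  assume "\<not> ?thesis"
  then interpret few_values M K p0 X Fo r0 m
    using assms by unfold_locales blast+
  show False by (rule contradiction)
qed

end

section \<open>Trees whose branches are determined by the new sequence\<close>

context decision begin

definition separating :: "'a \<Rightarrow> bool" where
  "separating Q \<longleftrightarrow> (\<forall>t\<in>ext Q. \<forall>u\<in>ext (succs Q t). \<forall>v\<in>ext (succs Q t). u \<noteq> v \<longrightarrow>
     (\<exists>i\<in>ext X. \<exists>x\<in>ext X. \<exists>y\<in>ext X. x \<noteq> y \<and> Fo (restr Q u) i x \<and> Fo (restr Q v) i y))"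

lemma def_separating: "Def (\<lambda>e. separating (e 0))"
  unfolding separating_def by (rule term_const[OF X] dfn)+

text \<open>One index serves all of \<open>U\<close>, and the value that \<open>app h u\<close>
  forces there identifies \<open>u\<close>.\<close>

definition tells_apart :: "'a \<Rightarrow> 'a \<Rightarrow> 'a \<Rightarrow> bool" where
  "tells_apart n U h \<longleftrightarrow> (\<exists>i\<in>ext vomega. \<forall>u\<in>ext U. \<exists>x\<in>ext X. Fo (app h u) i x \<and>
     (\<forall>v\<in>ext U. Fo (app h v) i x \<longrightarrow> v = u))"

text \<open>Above each successor, some index keeps many possible values. Regularity provides one
  index for a full set of successors, and these can then be assigned pairwise different values at
  it.\<close>

lemma separating_step:
  assumes r: "r \<in> ext PP" "r \<unlhd> p0"
  shows "\<exists>t\<in>ext r. \<exists>U\<in>M. \<exists>f. lam U f \<in> M \<and>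
      U \<unlhd> succs r t \<and> K n \<lesssim> U \<and>
      (\<forall>u\<in>ext U. f u \<in> ext PP \<and> f u \<unlhd> p0 \<and> f u \<unlhd> restr r u) \<and>
      tells_apart (vnat n) U (lam U f)"
proof -
  \<comment> \<open>\<kappa>_0 may be omega, which is too small for a pigeonhole over the indices in
    omega; the next cardinal of the sequence has \<kappa>_0 as an element and still exceeds
    \<kappa>_n.\<close>
  let ?k = "K (Suc n)"
  interpret k: regular M ?k by (rule regular_K)
  have rM: "r \<in> M" by (rule PP_elem_M[OF r(1)])
  obtain s0 where "s0 \<in> ext r" using PP_ex[OF r(1)] by blast
  then obtain t where t: "t \<in> ext r" "?k \<lesssim> succs r t"
    using PP_split[OF r(1)] by blast
  have tM: "t \<in> M" by (rule mem_M[OF t(1) rM])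
  have restr: "restr r u \<in> ext PP" "restr r u \<unlhd> p0" if "u \<in> ext (succs r t)" for u
    using restr_PP[OF r(1)] that r(2) by auto
  \<comment> \<open>The successors above which many values remain possible at the index
    \<open>i\<close>; by \<open>many_values\<close> these sets cover all successors of
    \<open>t\<close>.\<close>
  define B where "B i = vset {u \<in> ext (succs r t). ?k \<lesssim> vals (restr r u) i}" for i
  have B: "u \<in> ext (B i) \<longleftrightarrow> u \<in> ext (succs r t) \<and> ?k \<lesssim> vals (restr r u) i" for u i
    unfolding B_def by (rule mem_vset_Collect)
  have trmB: "Trm (\<lambda>e. B (e 0))"
    unfolding B_def by (rule dfn term_const K_M rM tM)+
  have "ext (succs r t) \<subseteq> (\<Union>i\<in>ext vomega. ext (B i))"
  proof
    fix u assume u: "u \<in> ext (succs r t)"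
    obtain l where "?k \<lesssim> vals (restr r u) (vnat l)"
      using many_values[OF restr[OF u]] by blast
    then have "u \<in> ext (B (vnat l))" using u B by blast
    then show "u \<in> (\<Union>i\<in>ext vomega. ext (B i))" by auto
  qed
  then have le: "card_le_in M (ext ?k) (\<Union>i\<in>ext vomega. ext (B i))"
    by (rule card_le_mono[OF t(2)])
  have "K 0 \<in> ext ?k" using K_increasing[of 0 "Suc n"] by (simp add: mem_ext)
  moreover have "vomega \<lesssim> K 0"
    by (rule card_le_subset[OF omega_M]) (use vnat_K in auto)
  ultimately obtain i where i: "i \<in> ext vomega" "?k \<lesssim> B i"
    using k.pigeonhole[OF omega_M _ _ trmB le] by blast
  have iM: "i \<in> M" by (rule mem_M[OF i(1) omega_M])
  obtain e where e: "lam ?k e \<in> M" "inj_on e (ext ?k)" "\<And>\<alpha>. \<alpha> \<in> ext ?k \<Longrightarrow> e \<alpha> \<in> ext (B i)"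
    using card_leD[OF i(2)] by blast
  let ?e = "\<lambda>\<alpha>. app (lam ?k e) \<alpha>"
  obtain F where F: "lam ?k F \<in> M" "inj_on F (ext ?k)"
    "\<And>\<alpha>. \<alpha> \<in> ext ?k \<Longrightarrow> F \<alpha> \<in> ext (vals (restr r (?e \<alpha>)) i)"
  proof (rule k.distinct_representatives[OF X, where X = "\<lambda>\<alpha>. vals (restr r (?e \<alpha>)) i"])
    show "Trm (\<lambda>ea. vals (restr r (?e (ea 0))) i)"
      by (rule term_const[OF e(1)] dfn term_const rM iM)+
    show "vals (restr r (?e \<alpha>)) i \<unlhd> X" for \<alpha>
      using mem_vals Fo_X by blast
    show "?k \<lesssim> vals (restr r (?e \<alpha>)) i" if "\<alpha> \<in> ext ?k" for \<alpha>
      using e(3)[OF that] B that by simp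
  qed (erule (1) that, blast)
  define U where "U = vset (?e ` ext ?k)"
  have U: "u \<in> ext U \<longleftrightarrow> (\<exists>\<alpha>\<in>ext ?k. u = ?e \<alpha>)" for u
    unfolding U_def by (rule mem_vset_image)
  have UM: "U \<in> M" unfolding U_def by (rule in_M) (rule term_const[OF e(1)] dfn term_const K_M)+
  have Us: "U \<unlhd> succs r t" using U e(3) B by auto
  have "?k \<lesssim> U"
  proof (rule card_leI[OF lam_app_M[OF K_M e(1)]])
    show "inj_on ?e (ext ?k)" by (rule lam_inj_app[OF e(2)])
    show "?e ` ext ?k \<subseteq> ext U" using U by blast
  qed
  then have U_card: "K n \<lesssim> U"
    by (rule card_le_K_mono[of n "Suc n", rotated]) simp
  obtain h where h: "lam U h \<in> M" "\<And>u. u \<in> ext U \<Longrightarrow> h u \<in> ext PP \<and>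
      h u \<unlhd> restr r u \<and> (\<exists>\<alpha>\<in>ext ?k. u = ?e \<alpha> \<and> Fo (h u) i (app (lam ?k F) \<alpha>))"
  proof (rule choice_rel[OF UM PP_M, where R = "\<lambda>u r'. r' \<unlhd> restr r u \<and>
        (\<exists>\<alpha>\<in>ext ?k. u = ?e \<alpha> \<and> Fo r' i (app (lam ?k F) \<alpha>))"])
    show "Def (\<lambda>ea. ea 1 \<unlhd> restr r (ea 0) \<and>
        (\<exists>\<alpha>\<in>ext ?k. ea 0 = ?e \<alpha> \<and> Fo (ea 1) i (app (lam ?k F) \<alpha>)))"
      by (rule term_const[OF e(1)] term_const[OF F(1)] dfn term_const rM iM K_M)+
    fix u assume "u \<in> ext U"
    then obtain \<alpha> where \<alpha>: "\<alpha> \<in> ext ?k" "u = ?e \<alpha>" unfolding U by blast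
    obtain r' where "r' \<in> ext PP" "r' \<unlhd> restr r u" "Fo r' i (F \<alpha>)"
      using F(3)[OF \<alpha>(1)] unfolding mem_vals \<alpha>(2) by blast
    then show "\<exists>r'\<in>ext PP. r' \<unlhd> restr r u \<and>
        (\<exists>\<alpha>\<in>ext ?k. u = ?e \<alpha> \<and> Fo r' i (app (lam ?k F) \<alpha>))"
      using \<alpha> by (intro bexI[of _ r'] conjI bexI[of _ \<alpha>]) simp_all
  qed (erule that, blast)
  have "tells_apart (vnat n) U (lam U h)"
    unfolding tells_apart_def
  proof (intro bexI[OF _ i(1)] ballI)
    fix u assume u: "u \<in> ext U"
    obtain \<alpha> where \<alpha>: "\<alpha> \<in> ext ?k" "u = ?e \<alpha>" "Fo (h u) i (app (lam ?k F) \<alpha>)" using h(2)[OF u] by blast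
    show "\<exists>x\<in>ext X. Fo (app (lam U h) u) i x \<and> (\<forall>v\<in>ext U. Fo (app (lam U h) v) i x \<longrightarrow> v = u)"
    proof (intro bexI[of _ "F \<alpha>"] conjI ballI impI)
      show "Fo (app (lam U h) u) i (F \<alpha>)" using \<alpha>(1,3) u by simp
      then show "F \<alpha> \<in> ext X" by (rule Fo_X)
      fix v assume v: "v \<in> ext U" "Fo (app (lam U h) v) i (F \<alpha>)"
      obtain \<beta> where \<beta>: "\<beta> \<in> ext ?k" "v = ?e \<beta>" "Fo (h v) i (app (lam ?k F) \<beta>)"
        using h(2)[OF v(1)] by blast
      have "h v \<in> ext PP" "h v \<unlhd> p0"
        using h(2)[OF v(1)] restr(2) Us v(1) by blast+
      then have "F \<alpha> = F \<beta>" using Fo_unique[of "h v" i "F \<alpha>" "F \<beta>"] v \<beta>(1,3) by simp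
      then have "\<alpha> = \<beta>" using F(2) \<alpha>(1) \<beta>(1) by (simp add: inj_on_def)
      then show "v = u" using \<alpha>(2) \<beta>(2) by simp
    qed
  qed
  moreover have "\<forall>u\<in>ext U. h u \<in> ext PP \<and> h u \<unlhd> p0 \<and> h u \<unlhd> restr r u"
    using h(2) restr(2) Us by blast
  ultimately show ?thesis using t(1) UM h(1) Us U_card by blast
qed

lemma separating_dense:
  assumes r: "r \<in> ext PP" "r \<unlhd> p0"
  shows "\<exists>Q\<in>ext PP. Q \<unlhd> r \<and> separating Q"
proof -
  obtain Q where Q: "Q \<in> ext PP" "Q \<unlhd> r"
    "\<forall>t u v. u \<in> ext (succs Q t) \<and> v \<in> ext (succs Q t) \<and> u \<noteq> v \<longrightarrow>
       (\<exists>n U h. tells_apart (vnat n) U h \<and> u \<in> ext U \<and> v \<in> ext U \<and>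
         restr Q u \<unlhd> app h u \<and> restr Q v \<unlhd> app h v)"
  proof (rule fusion[where Inv = "\<lambda>r. r \<unlhd> p0"])
    show "Def (\<lambda>e. e 0 \<unlhd> p0)" by (rule dfn term_const PP_elem_M p0)+
    show "Def (\<lambda>e. tells_apart (e 0) (e 1) (e 2))"
      unfolding tells_apart_def by (rule dfn term_const X omega_M)+
    show "r \<in> ext PP" "r \<unlhd> p0" by (fact r)+
  qed ((rule separating_step; assumption), (rule that; assumption))
  have "separating Q"
    unfolding separating_def
  proof (intro ballI impI)
    fix t u v assume uv: "u \<in> ext (succs Q t)" "v \<in> ext (succs Q t)" "u \<noteq> v"
    obtain n U h where *: "tells_apart (vnat n) U h" "u \<in> ext U" "v \<in> ext U"
         "restr Q u \<unlhd> app h u" "restr Q v \<unlhd> app h v"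
      using Q(3)[rule_format, OF conjI[OF uv(1) conjI[OF uv(2,3)]]] by blast
    obtain i x where i: "Fo (app h u) i x" "\<forall>v\<in>ext U. Fo (app h v) i x \<longrightarrow> v = u"
      "\<exists>y. Fo (app h v) i y"
      using *(1-3) unfolding tells_apart_def by blast
    then obtain y where y: "Fo (app h v) i y" by blast
    have ne: "x \<noteq> y" using i(2) *(3) uv(3) y by blast
    have "restr Q u \<in> ext PP" "restr Q v \<in> ext PP" using restr_PP[OF Q(1)] uv by auto
    then have "Fo (restr Q u) i x" "Fo (restr Q v) i y"
      using Fo_mono i(1) y *(4,5) by blast+
    then show "\<exists>i\<in>ext X. \<exists>x\<in>ext X. \<exists>y\<in>ext X. x \<noteq> y \<and> Fo (restr Q u) i x \<and> Fo (restr Q v) i y"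
      using ne Fo_X Fo_i by blast
  qed
  then show ?thesis using Q(1,2) by blast
qed

end

section \<open>The generic branch\<close>

sublocale trees \<subseteq> forcing M PP
  by unfold_locales (rule PP_M)

context trees begin

lemma isucc_below:
  assumes "w \<in> ext Nd" shows "t \<in> ext Nd \<Longrightarrow> t \<unlhd> w \<Longrightarrow> t \<noteq> w \<Longrightarrow> \<exists>u. isucc t u \<and> u \<unlhd> w"
  using assms
proof (induction w rule: node_induct)
  case root
  then show ?case using ext_empty_iff by fastforce
next
  case (succ w w')
  then have "t \<unlhd> w" using below_isucc by blast
  show ?case
  proof (cases "t = w")
    case False
    then show ?thesis using succ \<open>t \<unlhd> w\<close> isuccD(3)[OF succ.hyps] by blast
  qed (use succ.hyps in blast)
qed

text \<open>A node comparable with all nodes of \<open>q\<close> lies on the stem of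
  \<open>q\<close>, so the branch is the union of the stems of the conditions in
  \<open>G\<close>.\<close>

definition branch :: "'a set \<Rightarrow> 'a set" where
  "branch G = {s \<in> ext Nd. \<exists>q\<in>G. \<forall>t\<in>ext q. t \<unlhd> s \<or> s \<unlhd> t}"

lemma cone_node:
  assumes q: "q \<in> ext PP" and s: "s \<in> ext Nd" "\<And>t. t \<in> ext q \<Longrightarrow> t \<unlhd> s \<or> s \<unlhd> t"
  shows "\<exists>w\<in>ext q. s \<unlhd> w \<and> w \<noteq> s"
proof -
  obtain s0 where "s0 \<in> ext q" using PP_ex[OF q] by blast
  then obtain t where t: "K 0 \<lesssim> succs q t" using PP_split[OF q] by blast
  obtain u v where "u \<in> ext (succs q t)" "v \<in> ext (succs q t)" "u \<noteq> v"
    by (rule two_elements[OF t])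
  then have *: "u \<in> ext q" "v \<in> ext q" "isucc t u" "isucc t v" "u \<noteq> v" by auto
  then have "\<not> (u \<unlhd> s \<and> v \<unlhd> s)" using isucc_unique s(1) by blast
  then show ?thesis using s(2)[OF *(1)] s(2)[OF *(2)] *(1,2) by blast
qed

lemma branch_mem:
  assumes G: "Gen G" and s: "s \<in> branch G" and T: "T \<in> G"
  shows "s \<in> ext T" "restr T s \<in> G"
proof -
  obtain q where q: "q \<in> G" "s \<in> ext Nd" "\<And>t. t \<in> ext q \<Longrightarrow> t \<unlhd> s \<or> s \<unlhd> t"
    using s unfolding branch_def by blast
  obtain r where r: "r \<in> G" "r \<unlhd> q" "r \<unlhd> T" using genericD(3)[OF G q(1) T] by blast
  have P: "r \<in> ext PP" "T \<in> ext PP" using r(1) T genericD(1)[OF G] by blast+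
  obtain w where "w \<in> ext r" "s \<unlhd> w" using cone_node[OF P(1) q(2)] q(3) r(2) by blast
  then show *: "s \<in> ext T" using PP_closed[OF P(2) _ q(2)] r(3) by blast
  have "r \<unlhd> restr T s" using r(2,3) q(3) by auto
  then show "restr T s \<in> G" using genericD(2)[OF G r(1) restr_PP[OF P(2) *]] by blast
qed

text \<open>A condition not included in \<open>T\<close> has a node outside \<open>T\<close>, and
  restricting it to that node puts the node on the branch. Hence densely many conditions are below
  \<open>T\<close> or contradict \<open>branch G \<subseteq> ext T\<close>.\<close>

lemma branch_generic:
  assumes G: "Gen G" and T: "T \<in> ext PP" and sub: "branch G \<subseteq> ext T"
  shows "T \<in> G"
proof -
  obtain p where p: "p \<in> G" using genericD(4)[OF G] by blast
  have "\<exists>q\<in>G. q \<unlhd> T \<or> (\<exists>s\<in>ext Nd. s \<notin> ext T \<and> (\<forall>t\<in>ext q. t \<unlhd> s \<or> s \<unlhd> t))"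
  proof (rule generic_dense_below[OF G p])
    show "Def (\<lambda>e. e 0 \<unlhd> T \<or>
        (\<exists>s\<in>ext Nd. s \<notin> ext T \<and> (\<forall>t\<in>ext (e 0). t \<unlhd> s \<or> s \<unlhd> t)))"
      by (rule dfn term_const Nd(1) PP_elem_M T)+
    fix q assume q: "q \<in> ext PP"
    show "\<exists>q'\<in>ext PP. q' \<unlhd> q \<and> (q' \<unlhd> T \<or>
        (\<exists>s\<in>ext Nd. s \<notin> ext T \<and> (\<forall>t\<in>ext q'. t \<unlhd> s \<or> s \<unlhd> t)))"
    proof (cases "q \<unlhd> T")
      case False
      then obtain s where s: "s \<in> ext q" "s \<notin> ext T" by blast
      have "restr q s \<unlhd> q" "\<forall>t\<in>ext (restr q s). t \<unlhd> s \<or> s \<unlhd> t" by auto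
      then show ?thesis using restr_PP[OF q s(1)] s(2) PP_nodes[OF q s(1)] by blast
    qed (use q in blast)
  qed
  then obtain q where q: "q \<in> G"
    "q \<unlhd> T \<or> (\<exists>s\<in>ext Nd. s \<notin> ext T \<and> (\<forall>t\<in>ext q. t \<unlhd> s \<or> s \<unlhd> t))" by blast
  have "\<not> (\<exists>s\<in>ext Nd. s \<notin> ext T \<and> (\<forall>t\<in>ext q. t \<unlhd> s \<or> s \<unlhd> t))"
    using sub q(1) unfolding branch_def by blast
  then show ?thesis using q genericD(2)[OF G q(1) T] by blast
qed

text \<open>Every condition below one whose stem reaches \<open>t\<close> has a node properly above
  \<open>t\<close>; restricting to the immediate successor of \<open>t\<close> on the way there
  prolongs the stem.\<close>

lemma branch_succ:
  assumes G: "Gen G" and t: "t \<in> branch G"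
  shows "\<exists>u\<in>branch G. isucc t u"
proof -
  obtain p where p: "p \<in> G" "t \<in> ext Nd" "\<And>s. s \<in> ext p \<Longrightarrow> s \<unlhd> t \<or> t \<unlhd> s"
    using t unfolding branch_def by blast
  have "\<exists>q\<in>G. \<exists>u\<in>ext Nd. isucc t u \<and> (\<forall>s\<in>ext q. s \<unlhd> u \<or> u \<unlhd> s)"
  proof (rule generic_dense_below[OF G p(1)])
    show "Def (\<lambda>e. \<exists>u\<in>ext Nd. isucc t u \<and> (\<forall>s\<in>ext (e 0). s \<unlhd> u \<or> u \<unlhd> s))"
      by (rule dfn term_const Nd(1) node_M p(2))+
    fix q assume q: "q \<in> ext PP" "q \<unlhd> p"
    obtain w where w: "w \<in> ext q" "t \<unlhd> w" "w \<noteq> t"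
      using cone_node[OF q(1) p(2)] p(3) q(2) by blast
    obtain u where u: "isucc t u" "u \<unlhd> w"
      using isucc_below[OF PP_nodes[OF q(1) w(1)] p(2) w(2)] w(3) by blast
    have uq: "u \<in> ext q" by (rule PP_closed[OF q(1) w(1) isuccD(2)[OF u(1)] u(2)])
    have "restr q u \<unlhd> q" "\<forall>s\<in>ext (restr q u). s \<unlhd> u \<or> u \<unlhd> s" by auto
    then show "\<exists>q'\<in>ext PP. q' \<unlhd> q \<and>
        (\<exists>u\<in>ext Nd. isucc t u \<and> (\<forall>s\<in>ext q'. s \<unlhd> u \<or> u \<unlhd> s))"
      using restr_PP[OF q(1) uq] isuccD(2)[OF u(1)] u(1) by blast
  qed
  then show ?thesis unfolding branch_def by blast
qed

lemma root_branch: assumes G: "Gen G" shows "vset {} \<in> branch G"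
proof -
  obtain p where p: "p \<in> G" using genericD(4)[OF G] by blast
  have "[] \<in> nodes K" by (simp add: nodes_def)
  then have "vset {} \<in> ext Nd" using Nd(2) vlist_Nil by (metis imageI)
  then show ?thesis using p unfolding branch_def by auto
qed

end

context decision begin

text \<open>Climbing node by node: if \<open>t\<close> is on the branch and its successor
  \<open>u\<close> passes the test, then \<open>u\<close> must be the successor that the branch
  takes, since \<open>separating\<close> would otherwise make the two force different values at one
  index, both of them true.\<close>

lemma branch_eq:
  assumes G: "Gen G" and Q: "Q \<in> G" "separating Q"
    and a: "\<And>q i x. q \<in> G \<Longrightarrow> Fo q i x \<Longrightarrow> vpair i x \<in> ext a"
    and functional: "\<And>i x y. vpair i x \<in> ext a \<Longrightarrow> vpair i y \<in> ext a \<Longrightarrow> x = y"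
  shows "branch G = {s \<in> ext Q. \<forall>i x. Fo (restr Q s) i x \<longrightarrow> vpair i x \<in> ext a}"
proof (intro equalityI subsetI)
  fix s assume "s \<in> branch G"
  then show "s \<in> {s \<in> ext Q. \<forall>i x. Fo (restr Q s) i x \<longrightarrow> vpair i x \<in> ext a}"
    using branch_mem[OF G _ Q(1)] a by blast
next
  have QP: "Q \<in> ext PP" using Q(1) genericD(1)[OF G] by blast
  fix s assume "s \<in> {s \<in> ext Q. \<forall>i x. Fo (restr Q s) i x \<longrightarrow> vpair i x \<in> ext a}"
  then have s: "s \<in> ext Q" "\<And>i x. Fo (restr Q s) i x \<Longrightarrow> vpair i x \<in> ext a" by blast+
  have "s \<in> ext Nd" by (rule PP_nodes[OF QP s(1)])
  then show "s \<in> branch G" using s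
  proof (induction s rule: node_induct)
    case root
    show ?case by (rule root_branch[OF G])
  next
    case (succ t u)
    note tu = isuccD[OF succ.hyps]
    have tQ: "t \<in> ext Q" by (rule PP_closed[OF QP succ.prems(1) tu(1,3)])
    have "restr Q u \<unlhd> restr Q t"
      using below_isucc[OF succ.hyps] tu(3) PP_nodes[OF QP] by auto
    then have "vpair i x \<in> ext a" if "Fo (restr Q t) i x" for i x
      using succ.prems(2) Fo_mono[OF that restr_PP[OF QP succ.prems(1)]] by blast
    then have t: "t \<in> branch G" using succ.IH tQ by blast
    obtain v where v: "v \<in> branch G" "isucc t v" using branch_succ[OF G t] by blast
    have vQ: "v \<in> ext Q" "restr Q v \<in> G" using branch_mem[OF G v(1) Q(1)] by blast+
    have "u = v"
    proof (rule ccontr)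
      assume "u \<noteq> v"
      moreover have "u \<in> ext (succs Q t)" "v \<in> ext (succs Q t)"
        using succ.prems(1) succ.hyps vQ(1) v(2) by auto
      ultimately obtain i x y where "x \<noteq> y" "Fo (restr Q u) i x" "Fo (restr Q v) i y"
        using Q(2) tQ unfolding separating_def by blast
      then show False using succ.prems(2) a[OF vQ(2)] functional by blast
    qed
    then show ?case using v(1) by simp
  qed
qed

end

section \<open>Canonical names\<close>

lemma ext_check_name: "ext (check_name (ext P) x) = (\<Union>c\<in>check_name (ext P) ` ext x. (\<lambda>r. vpair c r) ` ext P)"
proof -
  have "(\<lambda>(c, r). vpair c r) ` (check_name (ext P) ` ext x \<times> ext P) =
      (\<Union>c\<in>check_name (ext P) ` ext x. (\<lambda>r. vpair c r) ` ext P)" by auto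
  then show ?thesis by (subst check_name.simps) simp
qed

lemma name_val_check_name:
  assumes "G \<subseteq> ext P" "G \<noteq> {}" shows "name_val G (check_name (ext P) x) = x"
proof (induction x rule: vmem_induct)
  case (step x)
  have "{s. \<exists>r\<in>G. vpair s r \<in> ext (check_name (ext P) x)} = check_name (ext P) ` ext x"
    using assms unfolding ext_check_name by auto
  then have "ext (name_val G (check_name (ext P) x)) = (\<lambda>y. name_val G (check_name (ext P) y)) ` ext x"
    unfolding ext_name_val by (simp add: image_image)
  also have "\<dots> = ext x" using step by simp
  finally show ?case by (rule ext_inject)
qed

lemma ext_name_val_filter_name:
  assumes "G \<subseteq> ext P" "G \<noteq> {}" shows "ext (name_val G (filter_name (ext P))) = G"
proof -
  have "{s. \<exists>r\<in>G. vpair s r \<in> ext (filter_name (ext P))} = check_name (ext P) ` G"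
    using assms(1) by (auto simp: filter_name_def)
  then show ?thesis
    unfolding ext_name_val using name_val_check_name[OF assms] by (simp add: image_image)
qed

section \<open>Values of names in transitive models\<close>

context ctm begin

text \<open>The evaluation of names, carried out in a model that contains the filter. It shows that
  such a model includes the generic extension.\<close>

lemma name_val_in_model:
  assumes g: "g \<in> M" and t: "t \<in> M" shows "name_val (ext g) t \<in> M"
proof -
  define N where "N x h = vset ((\<lambda>s. app h s) ` ext (vset {s \<in> ext (tcl x). \<exists>r\<in>ext g. vpair s r \<in> ext x}))" for x h
  have N: "Trm (\<lambda>e. N (e 0) (e 1))"
    unfolding N_def by (rule dfn term_const g)+
  have "name_val (ext g) t = vrec N t" for t
  proof (induction t rule: tcl_induct)
    case (step t)
    have dom: "ext (vset {s \<in> ext (tcl t). \<exists>r\<in>ext g. vpair s r \<in> ext t}) = {s. \<exists>r\<in>ext g. vpair s r \<in> ext t}"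
      using vpair_mem_tcl[of _ _ t] by auto
    have "ext (vrec N t) = (\<lambda>s. app (lam (tcl t) (vrec N)) s) `
        ext (vset {s \<in> ext (tcl t). \<exists>r\<in>ext g. vpair s r \<in> ext t})"
      unfolding vrec[of N t] N_def[of t] by (rule ext_vset_small[OF small_image[OF small_ext]])
    also have "\<dots> = (\<lambda>s. app (lam (tcl t) (vrec N)) s) ` {s. \<exists>r\<in>ext g. vpair s r \<in> ext t}"
      unfolding dom ..
    also have "\<dots> = name_val (ext g) ` {s. \<exists>r\<in>ext g. vpair s r \<in> ext t}"
    proof (rule image_cong[OF refl])
      fix s assume "s \<in> {s. \<exists>r\<in>ext g. vpair s r \<in> ext t}"
      then have "s \<in> ext (tcl t)" using vpair_mem_tcl by blast
      then show "app (lam (tcl t) (vrec N)) s = name_val (ext g) s" using step by simp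
    qed
    finally show ?case unfolding ext_name_val[symmetric] by (rule ext_inject[symmetric])
  qed
  moreover have "vrec N t \<in> M" by (rule in_M) (rule trm_vrec[OF N] term_const t)+
  ultimately show ?thesis by simp
qed

text \<open>Bounds the ordinals among the values of a name, so that generic extensions add no ordinals.\<close>
definition name_rank :: "'a \<Rightarrow> 'a" where
  "name_rank = vrec (\<lambda>x h. vset (\<Union>y\<in>ext (tcl x). ext (vset (insert (app h y) (ext (app h y))))))"

lemma name_rank_M: assumes "x \<in> M" shows "name_rank x \<in> M"
  unfolding name_rank_def by (rule in_M) (rule trm_vrec dfn term_const assms)+

lemma mem_name_rank: "z \<in> ext (name_rank x) \<longleftrightarrow> (\<exists>y\<in>ext (tcl x). z = name_rank y \<or> z \<in> ext (name_rank y))"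
proof -
  have "name_rank x = vset (\<Union>y\<in>ext (tcl x). ext (vset (insert (app (lam (tcl x) name_rank) y)
      (ext (app (lam (tcl x) name_rank) y)))))"
    unfolding name_rank_def by (rule vrec)
  then have "z \<in> ext (name_rank x) \<longleftrightarrow> (\<exists>y\<in>ext (tcl x). z \<in> ext (vset (insert (app (lam (tcl x) name_rank) y)
      (ext (app (lam (tcl x) name_rank) y)))))"
    by (simp only: mem_vset_UN)
  then show ?thesis by auto
qed

lemma ordinal_name_rank: "ordinal (name_rank x)"
proof (induction x rule: tcl_induct)
  case (step x)
  show ?case
    unfolding ordinal_def
  proof (intro conjI ballI)
    fix z assume "z \<in> ext (name_rank x)"
    then obtain y where y: "y \<in> ext (tcl x)" "z = name_rank y \<or> z \<in> ext (name_rank y)"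
      using mem_name_rank[THEN iffD1] by blast
    show "z \<unlhd> name_rank x"
    proof
      fix w assume "w \<in> ext z"
      then have "w \<in> ext (name_rank y)" using y(2) ordinal_trans[OF step[OF y(1)]] by blast
      then show "w \<in> ext (name_rank x)" using y(1) mem_name_rank[THEN iffD2] by blast
    qed
    have "ordinal z" using y step ordinal_elem by blast
    then show "w \<unlhd> z" if "w \<in> ext z" for w
      using that ordinal_trans by blast
  qed
qed

lemma ordinal_name_val:
  assumes "ordinal (name_val G s)" "s \<in> M" shows "name_val G s \<in> M"
proof -
  have "ordinal (name_val G s) \<Longrightarrow> name_val G s \<unlhd> name_rank s" for s
  proof (induction s rule: tcl_induct)
    case (step s)
    show ?case
    proof
      fix z assume z: "z \<in> ext (name_val G s)"
      then obtain t r where t: "z = name_val G t" "vpair t r \<in> ext s"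
        unfolding ext_name_val by blast
      note ts = vpair_mem_tcl[OF t(2)]
      have oz: "ordinal z" by (rule ordinal_elem[OF step.prems z])
      then have "z \<unlhd> name_rank t" using step.IH[OF ts] t(1) by simp
      then have "name_rank t \<notin> ext z" using vmem_irrefl by blast
      then have "z = name_rank t \<or> z \<in> ext (name_rank t)"
        using ordinal_linear[OF oz ordinal_name_rank[of t]] by blast
      then show "z \<in> ext (name_rank s)" using ts mem_name_rank[THEN iffD2] by blast
    qed
  qed
  from this[OF assms(1)] have "name_rank s \<notin> ext (name_val G s)" using vmem_irrefl by blast
  then have "name_val G s = name_rank s \<or> name_val G s \<in> ext (name_rank s)"
    using ordinal_linear[OF assms(1) ordinal_name_rank[of s]] by blast
  then show ?thesis using name_rank_M[OF assms(2)] mem_M by metis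
qed

end

section \<open>Reconstruction of the generic filter\<close>

context trees begin

lemma generic_in_model:
  assumes powers: "\<And>m. \<exists>j. \<exists>c\<in>ext (K j). card_le_in M (omega_seqs_in M (K m)) (ext c)"
    and G: "Gen G" and A: "A \<in> M"
    and seq: "is_omega_seq (name_val G A) M" and new: "name_val G A \<notin> M"
    and N: "transitive_model N" "M \<subseteq> N" "name_val G A \<in> N"
  shows "\<exists>g\<in>N. ext g = G"
proof -
  let ?a = "name_val G A"
  obtain a where a: "range a \<subseteq> M" "ext ?a = seq_graph a" using seq unfolding is_omega_seq_def by blast
  have mem_a: "vpair i x \<in> ext ?a \<longleftrightarrow> (\<exists>n. i = vnat n \<and> x = a n)" for i x
    unfolding a(2) seq_graph_def by auto
  have functional: "x = y" if "vpair i x \<in> ext ?a" "vpair i y \<in> ext ?a" for i x y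
    using that unfolding mem_a by auto
  define X where "X = vUnion (vUnion (value_bound A (rel_below A)))"
  have X: "X \<in> M" unfolding X_def by (rule vUnion_M value_bound_M A)+
  define Fo where "Fo q i x \<longleftrightarrow> forces_mem A q (vpair i x)" for q i x
  have def_Fo: "Def (\<lambda>e. Fo (e 0) (e 1) (e 2))"
    unfolding Fo_def by (rule dfn definable3[OF def_forces_mem] term_const A)+
  note [dfn] = definable3[OF def_Fo]
  have Fo_X: "x \<in> ext X" "i \<in> ext X" if "Fo q i x" for q i x
    using fst_snd_mem_vUnion2[OF forces_mem_bound[OF that[unfolded Fo_def]]] unfolding X_def by blast+
  have Fo_PP: "q \<in> ext PP" if "Fo q i x" for q i x
    using that unfolding Fo_def forces_mem_def by blast
  have Fo_mono: "Fo q' i x" if "Fo q i x" "q' \<in> ext PP" "q' \<unlhd> q" for q q' i x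
    using forces_mem_mono[OF A] that unfolding Fo_def by blast
  have truth: "vpair i x \<in> ext ?a" if "q \<in> G" "Fo q i x" for q i x
  proof -
    have "vpair i x \<in> M"
      using forces_mem_bound[OF that(2)[unfolded Fo_def]] value_bound_M[OF A] mem_M by blast
    then show ?thesis using truth_mem[OF G A] that unfolding Fo_def by blast
  qed
  have truth': "\<exists>q\<in>G. Fo q (vnat n) (a n)" for n
  proof -
    have "a n \<in> M" using a(1) by blast
    then have "vpair (vnat n) (a n) \<in> M" by (intro in_M) (rule dfn term_const vnat_M | assumption)+
    then show ?thesis using truth_mem[OF G A] mem_a unfolding Fo_def by blast
  qed
  \<comment> \<open>Three obstructions: the sequence has no value at some index, two values at one
    index, or coincides with a function of \<open>M\<close>.\<close>
  define D1 where "D1 q \<longleftrightarrow> (\<exists>i\<in>ext vomega. \<forall>q'\<in>ext PP. q' \<unlhd> q \<longrightarrow> (\<forall>x\<in>ext X. \<not> Fo q' i x))" for q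
  define D2 where "D2 q \<longleftrightarrow> (\<exists>i\<in>ext X. \<exists>x\<in>ext X. \<exists>y\<in>ext X. x \<noteq> y \<and> Fo q i x \<and> Fo q i y)" for q
  define D3 where "D3 q \<longleftrightarrow> (\<exists>f\<in>M. \<forall>i\<in>ext vomega. \<forall>q'\<in>ext PP. q' \<unlhd> q \<longrightarrow>
      (\<exists>q''\<in>ext PP. q'' \<unlhd> q' \<and> Fo q'' i (app f i)))" for q
  \<comment> \<open>By density \<open>G\<close> contains a condition that is \<open>ok\<close> or
    obstructed, and an obstruction in \<open>G\<close> would contradict that the value of
    \<open>A\<close> is a new sequence. Being \<open>ok\<close> is what the locale
    \<open>decision\<close> asks of \<open>p0\<close>.\<close>
  define ok where "ok q \<longleftrightarrow> (\<forall>q'\<in>ext PP. q' \<unlhd> q \<longrightarrow> \<not> (D1 q' \<or> D2 q' \<or> D3 q'))" for q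
  have def_D: "Def (\<lambda>e. D1 (e 0))" "Def (\<lambda>e. D2 (e 0))" "Def (\<lambda>e. D3 (e 0))"
    unfolding D1_def D2_def D3_def
    by (rule term_const[OF PP_M] term_const[OF X] term_const[OF omega_M] dfn)+
  have def_ok: "Def (\<lambda>e. ok (e 0))"
    unfolding ok_def by (rule term_const[OF PP_M] dfn def_D[THEN definable1])+
  obtain q1 where q1: "q1 \<in> G" using genericD(4)[OF G] by blast
  have "\<exists>q\<in>G. ok q \<or> D1 q \<or> D2 q \<or> D3 q"
  proof (rule generic_dense_below[OF G q1])
    show "Def (\<lambda>e. ok (e 0) \<or> D1 (e 0) \<or> D2 (e 0) \<or> D3 (e 0))"
      by (rule definable_disj def_ok def_D)+
    show "\<exists>q'\<in>ext PP. q' \<unlhd> q \<and> (ok q' \<or> D1 q' \<or> D2 q' \<or> D3 q')" if "q \<in> ext PP" for q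
      using that unfolding ok_def by blast
  qed
  then obtain p0 where p0G: "p0 \<in> G" "ok p0 \<or> D1 p0 \<or> D2 p0 \<or> D3 p0" by blast
  have GP: "q \<in> ext PP" if "q \<in> G" for q using that genericD(1)[OF G] by blast
  have "\<not> D1 p0"
  proof
    assume "D1 p0"
    then obtain n where n: "\<And>q' x. q' \<in> ext PP \<Longrightarrow> q' \<unlhd> p0 \<Longrightarrow> \<not> Fo q' (vnat n) x"
      unfolding D1_def ext_omega using Fo_X by blast
    obtain q where q: "q \<in> G" "Fo q (vnat n) (a n)" using truth' by blast
    obtain r where "r \<in> G" "r \<unlhd> p0" "r \<unlhd> q" using genericD(3)[OF G p0G(1) q(1)] by blast
    then show False using n Fo_mono[OF q(2)] GP by blast
  qed
  moreover have "\<not> D2 p0"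
    unfolding D2_def using truth[OF p0G(1)] functional by blast
  moreover have "\<not> D3 p0"
  proof
    assume "D3 p0"
    then obtain f where f: "f \<in> M" "\<And>n q'. q' \<in> ext PP \<Longrightarrow> q' \<unlhd> p0 \<Longrightarrow>
        \<exists>q''\<in>ext PP. q'' \<unlhd> q' \<and> Fo q'' (vnat n) (app f (vnat n))"
      unfolding D3_def ext_omega by blast
    have "a n = app f (vnat n)" for n
    proof -
      have "app f (vnat n) \<in> M" by (rule in_M) (rule dfn term_const f(1) vnat_M)+
      then have "\<exists>q\<in>G. Fo q (vnat n) (app f (vnat n))"
        by (intro generic_dense_below[OF G p0G(1)] f(2)) (rule dfn term_const vnat_M | assumption)+
      then obtain q where q: "q \<in> G" "Fo q (vnat n) (app f (vnat n))" by blast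
      from truth[OF q] show ?thesis unfolding mem_a by auto
    qed
    then have "ext ?a = ext (lam vomega (app f))"
      unfolding a(2) seq_graph_def by (simp add: image_image)
    then have "?a = lam vomega (app f)" by (rule ext_inject)
    then show False using new lam_app_M[OF omega_M f(1)] by simp
  qed
  ultimately have ok: "ok p0" using p0G(2) by blast
  interpret decision M K p0 X Fo
  proof
    show "Def (\<lambda>e. Fo (e 0) (e 1) (e 2))" by (rule def_Fo)
    show "X \<in> M" by (rule X)
    show "p0 \<in> ext PP" by (rule GP[OF p0G(1)])
    show "Fo q i x \<Longrightarrow> x \<in> ext X" "Fo q i x \<Longrightarrow> i \<in> ext X" for q i x by (fact Fo_X)+
    show "Fo q i x \<Longrightarrow> q' \<in> ext PP \<Longrightarrow> q' \<unlhd> q \<Longrightarrow> Fo q' i x" for q q' i x by (fact Fo_mono)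
    show "x = y" if "q \<in> ext PP" "q \<unlhd> p0" "Fo q i x" "Fo q i y" for q i x y
    proof -
      have "\<not> D2 q" using ok that(1,2) unfolding ok_def by blast
      then show ?thesis using that(3,4) Fo_X unfolding D2_def by blast
    qed
    show "\<exists>q'\<in>ext PP. q' \<unlhd> q \<and> (\<exists>x. Fo q' (vnat n) x)"
      if "q \<in> ext PP" "q \<unlhd> p0" for q n
    proof -
      have "\<not> D1 q" using ok that(1,2) unfolding ok_def by blast
      then show ?thesis unfolding D1_def ext_omega by blast
    qed
    show "\<exists>n. \<exists>q'\<in>ext PP. q' \<unlhd> q \<and>
          (\<forall>q''\<in>ext PP. q'' \<unlhd> q' \<longrightarrow> \<not> Fo q'' (vnat n) (app f (vnat n)))"
      if "q \<in> ext PP" "q \<unlhd> p0" "f \<in> M" for q f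
    proof -
      have "\<not> D3 q" using ok that(1,2) unfolding ok_def by blast
      then show ?thesis using that(3) unfolding D3_def ext_omega by blast
    qed
  qed (rule powers)
  obtain Q where Q: "Q \<in> G" "separating Q"
    using generic_dense_below[OF G p0G(1) def_separating separating_dense] by blast
  have QM: "Q \<in> M" by (rule PP_elem_M[OF GP[OF Q(1)]])
  \<comment> \<open>\<open>Fo\<close> is defined over \<open>M\<close>, and \<open>N\<close> has no
    access to that definition. The table \<open>lam Q S\<close> of everything forced by the
    restrictions of \<open>Q\<close> is formed in \<open>M\<close>, and \<open>N\<close> merely
    compares its entries with the sequence.\<close>
  define S where "S s = vset {z \<in> ext (cart X X). \<exists>i\<in>M. \<exists>x\<in>M. z = vpair i x \<and> Fo (restr Q s) i x}" for s
  have ext_S: "S s \<unlhd> ?a \<longleftrightarrow> (\<forall>i x. Fo (restr Q s) i x \<longrightarrow> vpair i x \<in> ext ?a)" for s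
  proof -
    have "vpair i x \<in> ext (cart X X) \<and> i \<in> M \<and> x \<in> M" if "Fo (restr Q s) i x" for i x
      using Fo_X[OF that] Fo_i[OF that] mem_M[OF _ X] by simp
    then have "z \<in> ext (S s) \<longleftrightarrow> (\<exists>i x. z = vpair i x \<and> Fo (restr Q s) i x)" for z
      unfolding S_def mem_vset_Collect by blast
    then have "ext (S s) = {z. \<exists>i x. z = vpair i x \<and> Fo (restr Q s) i x}" by (intro set_eqI) simp
    then show ?thesis by auto
  qed
  have SM: "lam Q S \<in> M"
    unfolding S_def by (rule in_M) (rule term_const[OF X] dfn term_const QM)+
  interpret N: ctm N by unfold_locales (rule N(1))
  define b where "b = vset {s \<in> ext Q. app (lam Q S) s \<unlhd> ?a}"
  have bN: "b \<in> N"
    unfolding b_def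
    by (rule N.in_M) (rule N.term_const[OF subsetD[OF N(2) SM]] N.term_const[OF N(3)]
        N.term_const[OF subsetD[OF N(2) QM]] N.dfn)+
  have b: "ext b = branch G"
  proof -
    have "branch G = {s \<in> ext Q. \<forall>i x. Fo (restr Q s) i x \<longrightarrow> vpair i x \<in> ext ?a}"
      by (rule branch_eq[OF G Q truth functional])
    also have "\<dots> = {s \<in> ext Q. app (lam Q S) s \<unlhd> ?a}"
      by (intro Collect_cong conj_cong refl) (simp only: app_lam ext_S)
    also have "\<dots> = ext b"
      unfolding b_def by (rule ext_vset_small[OF small_Collect[OF small_ext], symmetric])
    finally show ?thesis ..
  qed
  have "vset {T \<in> ext PP. b \<unlhd> T} \<in> N"
    by (rule N.in_M) (rule N.term_const[OF bN] N.term_const[OF subsetD[OF N(2) PP_M]] N.dfn)+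
  moreover have "ext (vset {T \<in> ext PP. b \<unlhd> T}) = G"
  proof (intro set_eqI iffI)
    fix T assume "T \<in> ext (vset {T \<in> ext PP. b \<unlhd> T})"
    then show "T \<in> G" unfolding mem_vset_Collect b using branch_generic[OF G] by blast
  next
    fix T assume "T \<in> G"
    then show "T \<in> ext (vset {T \<in> ext PP. b \<unlhd> T})"
      unfolding mem_vset_Collect b using branch_mem(1)[OF G] GP by blast
  qed
  ultimately show ?thesis by blast
qed

end

theorem theorem2p5:
  fixes M :: "'a::set_universe set"
    and K :: "nat \<Rightarrow> 'a"
    and \<kappa> :: 'a
    and \<PP> :: "'a set"
  assumes ground: "transitive_model M"
    and seq_in_ground: "coded_in M (seq_graph K)"
    and seq_regular: "\<And>n. regular_in M (K n)"
    and seq_increasing: "\<And>m n. m < n \<Longrightarrow> K m \<in>\<^sub>V K n"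
    and seq_sup: "ext \<kappa> = (\<Union>n. ext (K n))"
    and singular: "singular_in M \<kappa>"
    and cofinality: "cofinality_in M \<kappa> vomega"
    and powers: "\<And>\<nu>. \<nu> \<in>\<^sub>V \<kappa> \<Longrightarrow> cardinal_in M \<nu> \<Longrightarrow> omega_power_less_in M \<nu> \<kappa>"
    and forcing: "\<PP> = perfect_trees M K"
  shows "(\<forall>p\<in>\<PP>. \<forall>A\<in>M. is_name \<PP> A \<and>
            forces M \<PP> tree_le p
              (\<lambda>G. is_omega_seq (name_val G A) M \<and> name_val G A \<notin> M) \<longrightarrow>
            forces M \<PP> tree_le p
              (\<lambda>G. name_val G (filter_name \<PP>) \<in> model_adjoin M (name_val G A)) \<and>
            (\<forall>G. generic M \<PP> tree_le G \<and> p \<in> G \<longrightarrow>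
              coded_in (model_adjoin M (name_val G A)) G)) \<and>
         minimal_for_omega_sequences M \<PP> tree_le"
proof -
  interpret trees M K
    by unfold_locales (fact ground seq_in_ground seq_regular seq_increasing)+
  have \<PP>: "\<PP> = ext PP" unfolding forcing by (rule ext_PP[symmetric])
  \<comment> \<open>A cardinal below \<kappa> already lies in some \<kappa>_j, as \<kappa> is their
    union.\<close>
  have pow: "\<exists>j. \<exists>c\<in>ext (K j). card_le_in M (omega_seqs_in M (K m)) (ext c)" for m
  proof -
    have "K m \<in> ext (K (Suc m))" using seq_increasing[of m "Suc m"] by (simp add: mem_ext)
    then have "K m \<in>\<^sub>V \<kappa>" unfolding mem_ext seq_sup by blast
    moreover have "cardinal_in M (K m)"
      using seq_regular[of m] by (simp add: regular_in_def infinite_cardinal_in_def)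
    ultimately obtain c where c: "c \<in> ext \<kappa>" "equipollent_in M (omega_seqs_in M (K m)) (ext c)"
      using powers unfolding omega_power_less_in_def by blast
    then obtain j where "c \<in> ext (K j)" unfolding seq_sup by blast
    moreover have "card_le_in M (omega_seqs_in M (K m)) (ext c)"
      using c(2) unfolding equipollent_in_def card_le_in_def bij_betw_def by blast
    ultimately show ?thesis by blast
  qed
  have mem_G: "name_val G (filter_name \<PP>) \<in> model_adjoin M (name_val G A) \<and>
      ext (name_val G (filter_name \<PP>)) = G"
    if G: "generic M \<PP> tree_le G" and A: "A \<in> M"
      and seq: "is_omega_seq (name_val G A) M" "name_val G A \<notin> M" for G A
  proof -
    have gen: "Gen G" using G \<PP> by simp
    have ext_G: "ext (name_val G (filter_name \<PP>)) = G"
      unfolding \<PP> by (rule ext_name_val_filter_name[OF genericD(1)[OF gen] genericD(4)[OF gen]])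
    \<comment> \<open>\<open>model_adjoin\<close> is an intersection, so the filter is found in each
      model \<open>N\<close> separately; by extensionality its code is the same in all of
      them.\<close>
    have "name_val G (filter_name \<PP>) \<in> N"
      if N: "transitive_model N" "M \<subseteq> N" "name_val G A \<in> N" for N
    proof -
      obtain g where "g \<in> N" "ext g = G" using generic_in_model[OF pow gen A seq N] by blast
      then show ?thesis using ext_G ext_inject by metis
    qed
    then show ?thesis using ext_G unfolding model_adjoin_def by blast
  qed
  have "minimal_for_omega_sequences M \<PP> tree_le"
    unfolding minimal_for_omega_sequences_def
  proof (intro allI impI, elim conjE bexE)
    fix G N a
    assume G: "generic M \<PP> tree_le G" and N: "transitive_model N" "M \<subseteq> N"
      and sub: "N \<subseteq> generic_extension M \<PP> G"
      and a: "a \<in> N" "is_omega_seq a {b. ordinal b}" "a \<notin> M"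
    have gen: "Gen G" using G \<PP> by simp
    interpret N: ctm N by unfold_locales (rule N(1))
    obtain A where A: "A \<in> M" "a = name_val G A"
      using sub a(1) unfolding generic_extension_def by blast
    obtain f where f: "range f \<subseteq> {b. ordinal b}" "ext a = seq_graph f"
      using a(2) unfolding is_omega_seq_def by blast
    \<comment> \<open>Names in \<open>M\<close> have no new ordinals as values, so each entry of the
      sequence lies in \<open>M\<close> even if the sequence does not.\<close>
    have "f n \<in> M" for n
    proof -
      have "vpair (vnat n) (f n) \<in> ext a" unfolding f(2) seq_graph_def by blast
      then have "f n \<in> N" using N.vpair_M(2)[OF N.mem_M[OF _ a(1)]] by blast
      then obtain s where s: "s \<in> M" "f n = name_val G s"
        using sub unfolding generic_extension_def by blast
      moreover have "ordinal (f n)" using f(1) by blast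
      ultimately show ?thesis using ordinal_name_val by simp
    qed
    then have "is_omega_seq (name_val G A) M"
      using f(2) A(2) unfolding is_omega_seq_def by blast
    then obtain g where g: "g \<in> N" "ext g = G"
      using generic_in_model[OF pow gen A(1) _ _ N] a(1,3) A(2) by blast
    \<comment> \<open>With \<open>G\<close> in \<open>N\<close>, all names of \<open>M\<close> can
      be evaluated there, which gives the missing inclusion.\<close>
    have "name_val G t \<in> N" if "t \<in> M" for t
      using N.name_val_in_model[OF g(1), of t] that N(2) g(2) by blast
    then show "N = generic_extension M \<PP> G"
      using sub unfolding generic_extension_def by blast
  qed
  moreover have "coded_in (model_adjoin M (name_val G A)) G"
    if "generic M \<PP> tree_le G" "A \<in> M" "is_omega_seq (name_val G A) M" "name_val G A \<notin> M" for G A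
    using mem_G[OF that] unfolding coded_in_def by blast
  ultimately show ?thesis
    using mem_G unfolding forces_def by blast
qed

end
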